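(* Assume $\alpha\in\ell^6$ and $(S-1)\alpha\in\ell^3$. Then $$\int_0^{2\pi}(1-\cos\theta)^4\log w(\theta)\frac{d\theta}{2\pi}>-\infty\iff(S-1)^4\alpha\in\ell^2.$$
   Context: $\mu$ is a probability measure with infinite support on the unit circle (identified with $[0,2\pi]$ via $e^{i\theta}\mapsto\theta$), with Lebesgue decomposition $d\mu(\theta)=w(\theta)\frac{d\theta}{2\pi}+d\mu_s(\theta)$. $\Phi_n$ are its monic orthogonal polynomials, and its sequence of Verblunsky coefficients is $\alpha=(\alpha_n)_{n\ge0}$, $\alpha_n=-\overline{\Phi_{n+1}(0)}\in\mathbb{D}$. $S$ is the left shift on sequences, $(S\alpha)_n=\alpha_{n+1}$. The integral is well defined in $[-\infty,\infty)$. *)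

theory Defs
  imports "HOL-Probability.Probability" "HOL-Computational_Algebra.Polynomial"
begin

definition msupport :: "'a::topological_space measure \<Rightarrow> 'a set" where
  "msupport M = {x. \<forall>U. open U \<longrightarrow> x \<in> U \<longrightarrow> emeasure M U > 0}"

text \<open>
  Measures on the unit circle are Borel measures on the complex plane that give no mass
  to the complement of the circle.
\<close>

definition nontrivial_circle_prob :: "complex measure \<Rightarrow> bool" where
  "nontrivial_circle_prob \<mu> \<longleftrightarrow>
     prob_space \<mu> \<and> sets \<mu> = sets borel \<and> (AE z in \<mu>. z \<in> sphere 0 1) \<and> infinite (msupport \<mu>)"

text \<open>The normalized Lebesgue measure \<open>d\<theta>/(2\<pi>)\<close> in the angular variable.\<close>

definition angle_measure :: "real measure" where
  "angle_measure = uniform_measure lborel {0..2*pi}"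

text \<open>
  \<open>d\<mu> = w(\<theta>) d\<theta>/(2\<pi>) + d\<mu>\<^sub>s\<close>: the density \<open>w\<close> is a function of the angle, while \<open>\<mu>\<close> and
  \<open>\<mu>\<^sub>s\<close> live on the circle itself, so the absolutely continuous part is transported by
  \<open>\<theta> \<mapsto> exp (\<i> \<theta>)\<close>, and so is the Lebesgue measure with respect to which \<open>\<mu>\<^sub>s\<close> is singular.
\<close>

definition circle_lebesgue_decomposition ::
    "complex measure \<Rightarrow> (real \<Rightarrow> real) \<Rightarrow> complex measure \<Rightarrow> bool" where
  "circle_lebesgue_decomposition \<mu> w \<mu>s \<longleftrightarrow>
     w \<in> borel_measurable borel \<and> (\<forall>\<theta>\<in>{0..2*pi}. 0 \<le> w \<theta>) \<and>
     sets \<mu>s = sets borel \<and>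
     (\<forall>A\<in>sets borel.
        emeasure \<mu> A =
          emeasure (distr (density angle_measure (\<lambda>\<theta>. ennreal (w \<theta>))) borel cis) A
            + emeasure \<mu>s A) \<and>
     (\<exists>N\<in>sets borel. emeasure (distr angle_measure borel cis) N = 0 \<and> emeasure \<mu>s (- N) = 0)"

text \<open>Existence and uniqueness hold for every \<open>n\<close> because \<open>\<mu>\<close> has infinite support.\<close>

definition monic_OP :: "complex measure \<Rightarrow> nat \<Rightarrow> complex poly" where
  "monic_OP \<mu> n =
     (THE p. degree p = n \<and> lead_coeff p = 1 \<and>
             (\<forall>k<n. integral\<^sup>L \<mu> (\<lambda>z. cnj (z ^ k) * poly p z) = 0))"

definition verblunsky :: "complex measure \<Rightarrow> nat \<Rightarrow> complex" where
  "verblunsky \<mu> n = - cnj (poly (monic_OP \<mu> (Suc n)) 0)"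

definition in_ell :: "nat \<Rightarrow> (nat \<Rightarrow> complex) \<Rightarrow> bool" where
  "in_ell p a \<longleftrightarrow> summable (\<lambda>n. norm (a n) ^ p)"

definition left_shift :: "(nat \<Rightarrow> complex) \<Rightarrow> nat \<Rightarrow> complex" where
  "left_shift a n = a (Suc n)"

definition shift_minus_id :: "(nat \<Rightarrow> complex) \<Rightarrow> nat \<Rightarrow> complex" where
  "shift_minus_id a n = left_shift a n - a n"

text \<open>The logarithm with \<open>log 0 = -\<infinity>\<close>, unlike \<^const>\<open>ln\<close>, for which \<open>ln 0 = 0\<close>.\<close>

definition ext_log :: "real \<Rightarrow> ereal" where
  "ext_log x = (if x > 0 then ereal (ln x) else -\<infinity>)"

text \<open>
  The integral of an extended-real function as positive part minus negative part
  (\<^const>\<open>e2ennreal\<close> sends negative values to \<open>0\<close>).  It is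
  meaningful when at most one part is infinite; below, the positive part is finite since
  \<open>log w \<le> w\<close> and \<open>w\<close> is integrable, so the value lies in \<open>[-\<infinity>,\<infinity>)\<close>.
\<close>

definition ext_integral :: "'a measure \<Rightarrow> ('a \<Rightarrow> ereal) \<Rightarrow> ereal" where
  "ext_integral M f =
     enn2ereal (\<integral>\<^sup>+x. e2ennreal (f x) \<partial>M) - enn2ereal (\<integral>\<^sup>+x. e2ennreal (- f x) \<partial>M)"

end

theory Submission
  imports Defs "HOL-Complex_Analysis.Complex_Analysis"
begin

text \<open>
  Let \<open>\<phi>\<^sub>n\<close> be the orthonormal polynomials, \<open>\<mu>\<^sub>n = d\<theta> / (2\<pi> |\<phi>\<^sub>n|\<^sup>2)\<close> the Bernstein--Szego approximants and
  \<open>E\<^sub>n = \<integral> (1 - cos \<theta>)\<^sup>4 log |\<phi>\<^sub>n|\<^sup>2 d\<theta>/2\<pi>\<close>.  The entropy of \<open>\<mu>\<close> is finite iff \<open>E\<^sub>n\<close> is bounded above, and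
  both directions only use \<open>log x \<le> x - 1\<close>: with \<open>x = w |\<phi>\<^sub>n|\<^sup>2\<close> and \<open>\<integral> |\<phi>\<^sub>n|\<^sup>2 d\<mu> = 1\<close> it bounds \<open>E\<^sub>n\<close>
  by the entropy, and with \<open>x = h / |\<phi>\<^sub>n|\<^sup>2\<close>, the weak convergence of \<open>\<mu>\<^sub>n\<close> to \<open>\<mu>\<close> and test functions \<open>h\<close>
  close to \<open>1/w\<close> it bounds the entropy by \<open>sup E\<^sub>n\<close>.

  On the other hand \<open>\<Phi>\<^sub>n\<^sub>+\<^sub>1\<^sup>* / \<Phi>\<^sub>n\<^sup>* = 1 - \<alpha>\<^sub>n z b\<^sub>n\<close> is zero-free on the closed disc, so by the mean value
  property \<open>E\<^sub>n\<close> is a sum of local terms, each a function of five consecutive Verblunsky coefficients.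
  The quadratic part of these terms is \<open>|(S-1)\<^sup>4\<alpha>|\<^sup>2\<close> up to telescoping, the terms of degree at least 6 are
  controlled by \<open>\<alpha> \<in> \<ell>\<^sup>6\<close>, and the coefficients of the quartic part add up to 0.  Since
  \<open>Re (x y cnj (z w))\<close> differs from the average of the fourth powers of the moduli by a term quadratic in
  the differences, the quartic part is, up to telescoping, \<open>O(|\<alpha>|\<^sup>2 |(S-1)\<alpha>|\<^sup>2) = O(|\<alpha>|\<^sup>6 + |(S-1)\<alpha>|\<^sup>3)\<close>.
\<close>

section \<open>Local entropy terms\<close>

text \<open>The weight fits the fourth difference because 16 (1 - cos \<theta>)^4 = |1 - exp(i
  \<theta>)|^8 is the Fourier symbol of the quadratic form |(S-1)^4 \<alpha>|^2. Being a
  trigonometric polynomial of degree 4, it sees only four Taylor coefficients of each logarithm. The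
  squared norm of the monic polynomial is the product of the 1 - |\<alpha>_j|^2; times the mean
  70/16 of the weight it yields the term 70 log(1 - |\<alpha>_n|^2).

  The approximants converge weakly because the n-th one shares its first n Verblunsky coefficients
  with \<mu>, hence all trigonometric moments up to order n.

  The obstacle in the second inequality is that 1/w may be unbounded, infinite or discontinuous, and
  that w does not see the singular part. The test function is therefore the reciprocal of a
  truncation of w, reset to 1 on a Lebesgue null set carrying the singular part. It is approximated
  by continuous functions in L^1 of \<mu> plus Lebesgue measure, so that both sides of the
  inequality pass to the limit, and monotone convergence removes the truncation. Only finiteness
  matters, so the weight is often bounded by its maximum 16.\<close>

definition bdd_sums :: "(nat \<Rightarrow> real) \<Rightarrow> bool" where
  "bdd_sums f \<longleftrightarrow> (\<exists>C. \<forall>N. \<bar>\<Sum>n<N. f n\<bar> \<le> C)"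

lemma bdd_sums_add: 
  assumes "bdd_sums f" "bdd_sums g" shows "bdd_sums (\<lambda>n. f n + g n)"
proof -
  obtain C D where "\<forall>N. \<bar>\<Sum>n<N. f n\<bar> \<le> C" "\<forall>N. \<bar>\<Sum>n<N. g n\<bar> \<le> D"
    using assms unfolding bdd_sums_def by blast
  then have "\<bar>\<Sum>n<N. f n + g n\<bar> \<le> C + D" for N
    unfolding sum.distrib by (meson abs_triangle_ineq add_mono order_trans)
  then show ?thesis unfolding bdd_sums_def by blast
qed

lemma bdd_sums_cmult: 
  assumes "bdd_sums f" shows "bdd_sums (\<lambda>n. c * f n)"
proof -
  obtain C where "\<forall>N. \<bar>\<Sum>n<N. f n\<bar> \<le> C" using assms unfolding bdd_sums_def by blast
  then have "\<bar>\<Sum>n<N. c * f n\<bar> \<le> \<bar>c\<bar> * C" for N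
    unfolding sum_distrib_left[symmetric] abs_mult by (simp add: mult_left_mono)
  then show ?thesis unfolding bdd_sums_def by blast
qed

lemma bdd_sums_summable:
  assumes "summable (\<lambda>n. \<bar>f n\<bar>)" shows "bdd_sums f"
proof -
  have "\<bar>\<Sum>n<N. f n\<bar> \<le> (\<Sum>n. \<bar>f n\<bar>)" for N
    by (rule order_trans[OF sum_abs]) (rule sum_le_suminf[OF assms], auto)
  then show ?thesis unfolding bdd_sums_def by blast
qed

lemma bdd_sums_comparison:
  assumes "\<And>n. \<bar>f n\<bar> \<le> g n" "summable g" shows "bdd_sums f"
  by (rule bdd_sums_summable, rule summable_comparison_test'[OF assms(2), of 0]) (simp add: assms(1))

text \<open>The sums telescope, and boundedness of \<open>f\<close> controls the boundary terms.
  Such series need not converge, which is why the error terms are measured by bounded partial sums;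
  against a series of nonnegative terms this is enough.\<close>

lemma bdd_sums_diff:
  assumes "bounded (range f)" shows "bdd_sums (\<lambda>n. f (n + k) - f n)"
proof (induction k)
  case 0
  then show ?case by (auto simp: bdd_sums_def)
next
  case (Suc k)
  obtain B where B: "\<And>n. \<bar>f n\<bar> \<le> B" using assms by (auto simp: bounded_iff)
  have "\<bar>\<Sum>n<N. f (n + Suc k) - f (n + k)\<bar> \<le> 2 * B" for N
  proof -
    have "(\<Sum>n<N. f (Suc n + k) - f (n + k)) = f (N + k) - f (0 + k)"
      by (rule sum_lessThan_telescope)
    then show ?thesis using B[of "N + k"] B[of k] by simp
  qed
  then have "bdd_sums (\<lambda>n. f (n + Suc k) - f (n + k))" unfolding bdd_sums_def by blast
  from bdd_sums_add[OF this Suc] show ?case by simp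
qed

lemma bdd_sums_cong: "bdd_sums f \<Longrightarrow> (\<And>n. f n = g n) \<Longrightarrow> bdd_sums g"
  by (simp add: bdd_sums_def)

lemma summable_power_add:
  fixes f g :: "nat \<Rightarrow> real"
  assumes "summable (\<lambda>n. f n ^ k)" "summable (\<lambda>n. g n ^ k)" "\<And>n. 0 \<le> f n" "\<And>n. 0 \<le> g n"
  shows "summable (\<lambda>n. (f n + g n) ^ k)"
proof (rule summable_comparison_test'[where N = 0])
  show "summable (\<lambda>n. 2 ^ k * (f n ^ k + g n ^ k))"
    by (intro summable_mult summable_add assms)
  fix n
  have "(f n + g n) ^ k \<le> (2 * max (f n) (g n)) ^ k"
    by (rule power_mono) (use assms(3,4)[of n] in auto)
  also have "\<dots> \<le> 2 ^ k * (f n ^ k + g n ^ k)"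
    using assms(3,4)[of n] by (auto simp: power_mult_distrib max_def)
  finally show "norm ((f n + g n) ^ k) \<le> 2 ^ k * (f n ^ k + g n ^ k)"
    using assms(3,4)[of n] by simp
qed

section \<open>Quartic forms compared with averages of fourth powers\<close>

definition re4 :: "complex \<Rightarrow> complex \<Rightarrow> complex \<Rightarrow> complex \<Rightarrow> real" where
  "re4 x y z w = Re (x * y * cnj z * cnj w)"

text \<open>The average is chosen so that the difference vanishes for equal arguments, while fourth
  powers of moduli can be moved along the sequence by telescoping.\<close>

definition dev4 :: "complex \<Rightarrow> complex \<Rightarrow> complex \<Rightarrow> complex \<Rightarrow> real" where
  "dev4 x y z w = re4 x y z w - (cmod x ^ 4 + cmod y ^ 4 + cmod z ^ 4 + cmod w ^ 4) / 4"

text \<open>All the squares on the right are of second order in the differences of the arguments.\<close>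

lemma dev4_eq:
  "dev4 x y z w = - (cmod (x * y - z * w))\<^sup>2 / 2 
     - (((cmod x)\<^sup>2 - (cmod y)\<^sup>2)\<^sup>2 + ((cmod z)\<^sup>2 - (cmod w)\<^sup>2)\<^sup>2) / 4"
proof -
  have *: "cmod u ^ 4 = ((cmod u)\<^sup>2)\<^sup>2" for u by (simp flip: power_mult)
  show ?thesis unfolding dev4_def re4_def * cmod_power2
    by (simp add: power2_eq_square field_simps)
qed

text \<open>Each square in \<open>dev4_eq\<close> is at most 4 (M D)^2. The remaining estimate is a
  form of Young's inequality with exponents 3 and 3/2, and it is here that the exponents 6 and 3 of
  the two summability hypotheses arise.\<close>

lemma dev4_bound:
  assumes "cmod x \<le> M" "cmod y \<le> M" "cmod z \<le> M" "cmod w \<le> M"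
    and "cmod (x - y) \<le> D" "cmod (z - w) \<le> D" "cmod (x - z) \<le> D" "cmod (y - w) \<le> D"
  shows "\<bar>dev4 x y z w\<bar> \<le> 4 * (M ^ 6 + D ^ 3)"
proof -
  have M: "0 \<le> M" and D: "0 \<le> D" using assms(1,5) norm_ge_zero order_trans by blast+
  have sq: "((cmod u)\<^sup>2 - (cmod v)\<^sup>2)\<^sup>2 \<le> 4 * (M * D)\<^sup>2"
    if "cmod u \<le> M" "cmod v \<le> M" "cmod (u - v) \<le> D" for u v
  proof -
    have "\<bar>(cmod u)\<^sup>2 - (cmod v)\<^sup>2\<bar> = (cmod u + cmod v) * \<bar>cmod u - cmod v\<bar>"
      by (simp add: power2_eq_square square_diff_square_factored abs_mult)
    also have "\<dots> \<le> (2 * M) * D"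
      using that norm_triangle_ineq3[of u v] M by (intro mult_mono) auto
    finally have "\<bar>(cmod u)\<^sup>2 - (cmod v)\<^sup>2\<bar>\<^sup>2 \<le> ((2 * M) * D)\<^sup>2" by (rule power_mono) simp
    then show ?thesis by (simp add: power_mult_distrib)
  qed
  have abs: "\<bar>- p / 2 - (q + r) / 4\<bar> \<le> 4 * k"
    if "p \<le> 4 * k" "q \<le> 4 * k" "r \<le> 4 * k" "0 \<le> p" "0 \<le> q" "0 \<le> r" for p q r k :: real
    using that by (simp add: field_simps)
  have "x * y - z * w = x * (y - w) + w * (x - z)" by (simp add: algebra_simps)
  then have "cmod (x * y - z * w) \<le> cmod x * cmod (y - w) + cmod w * cmod (x - z)"
    by (metis norm_mult norm_triangle_ineq)
  also have "\<dots> \<le> M * D + M * D" using assms M by (intro add_mono mult_mono) auto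
  finally have "(cmod (x * y - z * w))\<^sup>2 \<le> (2 * (M * D))\<^sup>2" by (intro power_mono) (auto simp: mult_ac)
  then have "(cmod (x * y - z * w))\<^sup>2 \<le> 4 * (M * D)\<^sup>2" by (simp add: power_mult_distrib)
  then have "\<bar>dev4 x y z w\<bar> \<le> 4 * (M * D)\<^sup>2"
    unfolding dev4_eq using sq[OF assms(1,2,5)] sq[OF assms(3,4,6)] by (intro abs) simp_all
  also have "(M * D)\<^sup>2 \<le> M ^ 6 + D ^ 3"
  \<comment> \<open>If D is at most M^2, replacing it by M^2 gives M^6; otherwise replacing M^2 by D
    gives D^3.\<close>
  proof (cases "D \<le> M\<^sup>2")
    case True
    then have "M\<^sup>2 * D\<^sup>2 \<le> M\<^sup>2 * (M\<^sup>2)\<^sup>2" by (intro mult_left_mono power_mono D) auto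
    also have "\<dots> = M ^ 6" by (simp flip: power_mult power_add)
    finally show ?thesis using D by (simp add: power_mult_distrib add_increasing2)
  next
    case False
    then have "M\<^sup>2 * D\<^sup>2 \<le> D * D\<^sup>2" by (intro mult_right_mono) auto
    also have "\<dots> = D ^ 3" by (simp add: power2_eq_square power3_eq_cube)
    finally show ?thesis using M by (simp add: power_mult_distrib add_increasing)
  qed
  finally show ?thesis by simp
qed

text \<open>
  \<open>lc1, \<dots>, lc4\<close> are the first four Taylor coefficients at \<open>z = 0\<close> of \<open>log (1 - \<alpha>\<^sub>n z b\<^sub>n(z))\<close> with
  \<open>b\<^sub>n = \<Phi>\<^sub>n / \<Phi>\<^sub>n\<^sup>*\<close>, expanded in \<open>(a, b, c, d, e) = (\<alpha>\<^sub>n, \<alpha>\<^sub>n\<^sub>-\<^sub>1, \<alpha>\<^sub>n\<^sub>-\<^sub>2, \<alpha>\<^sub>n\<^sub>-\<^sub>3, \<alpha>\<^sub>n\<^sub>-\<^sub>4)\<close>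
  (\<open>log_coeff_local\<close>); the \<open>_rem\<close> parts collect the monomials of degree at least 6.
\<close>

definition lc1 :: "complex \<Rightarrow> complex \<Rightarrow> complex" where
  "lc1 a b = a * cnj b"

definition lc2 :: "complex \<Rightarrow> complex \<Rightarrow> complex \<Rightarrow> complex" where
  "lc2 a b c = a * cnj c - a * b * cnj b * cnj c - a * a * cnj b * cnj b / 2"

definition lc3_rem :: "complex \<Rightarrow> complex \<Rightarrow> complex \<Rightarrow> complex \<Rightarrow> complex" where
  "lc3_rem a b c d = 1/3 * (a*a*a*cnj b*cnj b*cnj b) + a*a*b*cnj b*cnj b*cnj c
     + a*b*b*cnj b*cnj c*cnj c + a*b*c*cnj b*cnj c*cnj d"

definition lc3 :: "complex \<Rightarrow> complex \<Rightarrow> complex \<Rightarrow> complex \<Rightarrow> complex" where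
  "lc3 a b c d = a * cnj d - a*a*cnj b*cnj c - a*b*cnj b*cnj d - a*b*cnj c*cnj c - a*c*cnj c*cnj d 
     + lc3_rem a b c d"

definition lc4_rem :: "complex \<Rightarrow> complex \<Rightarrow> complex \<Rightarrow> complex \<Rightarrow> complex \<Rightarrow> complex" where
  "lc4_rem a b c d e = a*a*a*cnj b*cnj b*cnj c + a*a*b*cnj b*cnj b*cnj d + 2*(a*a*b*cnj b*cnj c*cnj c)
     + a*a*c*cnj b*cnj c*cnj d + 2*(a*b*b*cnj b*cnj c*cnj d) + a*b*c*cnj b*cnj c*cnj e
     + a*b*c*cnj b*cnj d*cnj d + a*b*d*cnj b*cnj d*cnj e + a*b*b*cnj c*cnj c*cnj c
     + 2*(a*b*c*cnj c*cnj c*cnj d) + a*c*c*cnj c*cnj d*cnj d + a*c*d*cnj c*cnj d*cnj e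
     - 1/4*(a*a*a*cnj b*cnj b*cnj b*(a*cnj b)) - a*a*a*cnj b*cnj b*cnj b*(b*cnj c)
     - 3/2*(a*a*b*cnj b*cnj b*cnj c*(b*cnj c)) - a*a*b*cnj b*cnj b*cnj c*(c*cnj d)
     - a*b*b*cnj b*cnj c*cnj c*(b*cnj c) - 2*(a*b*b*cnj b*cnj c*cnj c*(c*cnj d))
     - a*b*c*cnj b*cnj c*cnj d*(c*cnj d) - a*b*c*cnj b*cnj c*cnj d*(d*cnj e)"

definition lc4 :: "complex \<Rightarrow> complex \<Rightarrow> complex \<Rightarrow> complex \<Rightarrow> complex \<Rightarrow> complex" where
  "lc4 a b c d e = a * cnj e - a*a*cnj b*cnj d - a*b*cnj b*cnj e - a*a*cnj c*cnj c / 2 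
     - 2*(a*b*cnj c*cnj d) - a*c*cnj c*cnj e - a*c*cnj d*cnj d - a*d*cnj d*cnj e 
     + lc4_rem a b c d e"

text \<open>
  The weights come from \<open>16 (1 - cos \<theta>)\<^sup>4 = 70 - 112 cos \<theta> + 56 cos 2\<theta> - 16 cos 3\<theta> + 2 cos 4\<theta>\<close>.
\<close>

definition local_entropy :: "complex \<Rightarrow> complex \<Rightarrow> complex \<Rightarrow> complex \<Rightarrow> complex \<Rightarrow> real" where
  "local_entropy a b c d e = 70 * ln (1 - (cmod a)\<^sup>2)
     + Re (112 * lc1 a b - 56 * lc2 a b c + 16 * lc3 a b c d - 2 * lc4 a b c d e)"

section \<open>Remainders of degree at least six\<close>

lemma norm_prod6_le:
  fixes x1 :: complex
  assumes "cmod x1 \<le> M" "cmod x2 \<le> M" "cmod x3 \<le> M" "cmod x4 \<le> M" "cmod x5 \<le> M" "cmod x6 \<le> M"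
  shows "cmod (x1 * x2 * x3 * x4 * x5 * x6) \<le> M ^ 6"
proof -
  have "0 \<le> M" using assms(1) norm_ge_zero order_trans by blast
  then have "cmod (x1 * x2 * x3 * x4 * x5 * x6) \<le> M * M * M * M * M * M"
    unfolding norm_mult by (intro mult_mono assms mult_nonneg_nonneg norm_ge_zero)
  then show ?thesis by (simp add: numeral_eq_Suc mult_ac)
qed

text \<open>Monomials of degree eight are estimated like those of degree six, the extra pair being
  bounded by 1. The bracketed pairs in \<open>lc4_rem\<close> are written for this shape.\<close>

lemma norm_prod8_le:
  fixes x1 :: complex
  assumes "cmod x1 \<le> M" "cmod x2 \<le> M" "cmod x3 \<le> M" "cmod x4 \<le> M" "cmod x5 \<le> M" "cmod x6 \<le> M"
    and "cmod y \<le> 1" "cmod z \<le> 1"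
  shows "cmod (x1 * x2 * x3 * x4 * x5 * x6 * (y * z)) \<le> M ^ 6"
proof -
  have "cmod (y * z) \<le> 1" unfolding norm_mult using assms(7,8) by (simp add: mult_le_one)
  then have "cmod (x1 * x2 * x3 * x4 * x5 * x6) * cmod (y * z) \<le> M ^ 6 * 1"
    by (intro mult_mono norm_prod6_le assms) (auto intro: order_trans[OF norm_ge_zero norm_prod6_le[OF assms(1-6)]])
  then show ?thesis by (simp add: norm_mult)
qed

lemma lc_rem_bound:
  assumes M: "cmod a \<le> M" "cmod b \<le> M" "cmod c \<le> M" "cmod d \<le> M" "cmod e \<le> M" 
    and 1: "cmod a \<le> 1" "cmod b \<le> 1" "cmod c \<le> 1" "cmod d \<le> 1" "cmod e \<le> 1" 
  shows "cmod (lc3_rem a b c d) \<le> 4 * M ^ 6" "cmod (lc4_rem a b c d e) \<le> 30 * M ^ 6"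
proof -
  have M': "cmod (cnj b) \<le> M" "cmod (cnj c) \<le> M" "cmod (cnj d) \<le> M" "cmod (cnj e) \<le> M"
    "cmod (cnj b) \<le> 1" "cmod (cnj c) \<le> 1" "cmod (cnj d) \<le> 1" "cmod (cnj e) \<le> 1"
    using M 1 by simp_all
  have add: "cmod (u + v) \<le> (k + l) * M ^ 6" "cmod (u - v) \<le> (k + l) * M ^ 6" 
    if "cmod u \<le> k * M ^ 6" "cmod v \<le> l * M ^ 6" for u v k l
    using that norm_triangle_ineq[of u v] norm_triangle_ineq4[of u v] by (auto simp: algebra_simps)
  have one: "cmod u \<le> 1 * M ^ 6" if "cmod u \<le> M ^ 6" for u using that by simp
  have scale: "cmod (k * u) \<le> cmod k * M ^ 6" if "cmod u \<le> M ^ 6" for u k 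
    using that by (simp add: norm_mult mult_left_mono)
  \<comment> \<open>The constants 4 and 30 round up the sums 10/3 and 95/4 of the moduli of the
    coefficients.\<close>
  have "cmod (lc3_rem a b c d) \<le> (cmod (1/3) + 1 + 1 + 1) * M ^ 6"
    unfolding lc3_rem_def by (intro add scale one norm_prod6_le M M')
  also have "\<dots> \<le> 4 * M ^ 6" by (intro mult_right_mono) (auto simp: norm_divide)
  finally show "cmod (lc3_rem a b c d) \<le> 4 * M ^ 6" .
  have "cmod (lc4_rem a b c d e) \<le> (1+1+cmod 2+1+cmod 2+1+1+1+1+cmod 2+1+1+cmod (1/4)+1+cmod(3/2)+1+1+cmod 2+1+1) * M ^ 6"
    unfolding lc4_rem_def by (intro add scale one norm_prod8_le norm_prod6_le M 1 M')
  also have "\<dots> \<le> 30 * M ^ 6" by (intro mult_right_mono) (auto simp: norm_divide)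
  finally show "cmod (lc4_rem a b c d e) \<le> 30 * M ^ 6" .
qed

text \<open>Both inequalities are monotonicity statements: the derivative of the error is
  -y^2/(1-y), and adding x^3 makes it nonnegative for y up to 1/2. With x = |a|^2 the error has
  degree six, and the term x^2/2 joins the quartic part.\<close>

lemma ln_one_minus_taylor2:
  fixes x :: real
  assumes "0 \<le> x" "x \<le> 1 / 2"
  shows "\<bar>ln (1 - x) + x + x\<^sup>2 / 2\<bar> \<le> x ^ 3"
proof -
  have "ln (1 - x) + x + x\<^sup>2 / 2 \<le> ln (1 - 0) + 0 + 0\<^sup>2 / 2"
  proof (rule DERIV_nonpos_imp_nonincreasing[OF assms(1)])
    fix y :: real assume y: "0 \<le> y" "y \<le> x"
    then have "((\<lambda>x. ln (1 - x) + x + x\<^sup>2 / 2) has_real_derivative (- (y\<^sup>2 / (1 - y)))) (at y)"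
      using assms by (auto intro!: derivative_eq_intros simp: field_simps power2_eq_square)
    moreover have "- (y\<^sup>2 / (1 - y)) \<le> 0" using y assms by simp
    ultimately show "\<exists>l. ((\<lambda>x. ln (1 - x) + x + x\<^sup>2 / 2) has_real_derivative l) (at y) \<and> l \<le> 0"
      by blast
  qed
  moreover have "ln (1 - 0) + 0 + 0\<^sup>2 / 2 + 0 ^ 3 \<le> ln (1 - x) + x + x\<^sup>2 / 2 + x ^ 3"
  proof (rule DERIV_nonneg_imp_nondecreasing[OF assms(1)])
    fix y :: real assume y: "0 \<le> y" "y \<le> x"
    then have "((\<lambda>x. ln (1 - x) + x + x\<^sup>2 / 2 + x ^ 3) has_real_derivative (3 * y\<^sup>2 - y\<^sup>2 / (1 - y))) (at y)"
      using assms by (auto intro!: derivative_eq_intros simp: field_simps power2_eq_square)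
    moreover have "y\<^sup>2 / (1 - y) \<le> y\<^sup>2 / (1 / 2)"
      using y assms by (intro divide_left_mono) auto
    then have "y\<^sup>2 / (1 - y) \<le> 2 * y\<^sup>2" by (simp add: mult.commute)
    then have "0 \<le> 3 * y\<^sup>2 - y\<^sup>2 / (1 - y)" using zero_le_power2[of y] by linarith
    ultimately show "\<exists>l. ((\<lambda>x. ln (1 - x) + x + x\<^sup>2 / 2 + x ^ 3) has_real_derivative l) (at y) \<and> 0 \<le> l"
      by blast
  qed
  ultimately show ?thesis by simp
qed

text \<open>
  In each of the lines with \<open>(cmod _)\<^sup>2\<close>, with \<open>Re (_ * cnj _)\<close> of a fixed lag, and with \<open>cmod _ ^ 4\<close>
  the coefficients add up to 0, so these lines telescope along a sequence.
\<close>

lemma local_entropy_eq: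
  "local_entropy a b c d e + (cmod (a - 4*b + 6*c - 4*d + e))\<^sup>2 =
     - 69 * (cmod a)\<^sup>2 + 16 * (cmod b)\<^sup>2 + 36 * (cmod c)\<^sup>2 + 16 * (cmod d)\<^sup>2 + (cmod e)\<^sup>2
     + (104 * Re (a * cnj b) - 48 * Re (b * cnj c) - 48 * Re (c * cnj d) - 8 * Re (d * cnj e))
     + (- 44 * Re (a * cnj c) + 32 * Re (b * cnj d) + 12 * Re (c * cnj e))
     + (8 * Re (a * cnj d) - 8 * Re (b * cnj e))
     + (- 45/2 * cmod a ^ 4 + 57/2 * cmod b ^ 4 - 3 * cmod c ^ 4 - 9/2 * cmod d ^ 4 + 3/2 * cmod e ^ 4)
     + (56 * dev4 a b b c + 28 * dev4 a a b b 
        - 16 * (dev4 a b b d + dev4 a c c d + dev4 a b c c + dev4 a a b c)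
        + 2 * (dev4 a b b e + dev4 a c c e + dev4 a d d e + dev4 a c d d + 2 * dev4 a b c d
               + dev4 a a c c / 2 + dev4 a a b d))
     + 70 * (ln (1 - (cmod a)\<^sup>2) + (cmod a)\<^sup>2 + ((cmod a)\<^sup>2)\<^sup>2 / 2)
     + (16 * Re (lc3_rem a b c d) - 2 * Re (lc4_rem a b c d e))"
proof -
  have quad: "(cmod (a - 4*b + 6*c - 4*d + e))\<^sup>2 =
    (cmod a)\<^sup>2 + 16 * (cmod b)\<^sup>2 + 36 * (cmod c)\<^sup>2 + 16 * (cmod d)\<^sup>2 + (cmod e)\<^sup>2
    + 2 * (- 4 * Re (a * cnj b) + 6 * Re (a * cnj c) - 4 * Re (a * cnj d) + Re (a * cnj e)
      - 24 * Re (b * cnj c) + 16 * Re (b * cnj d) - 4 * Re (b * cnj e) - 24 * Re (c * cnj d)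
      + 6 * Re (c * cnj e) - 4 * Re (d * cnj e))"
    unfolding cmod_power2 by (simp add: power2_eq_square algebra_simps)
  \<comment> \<open>Every quartic form is traded for \<open>dev4\<close> plus an average. The forms
    have total weight 84 - 64 + 15 = 35 from \<open>lc2\<close>, \<open>lc3\<close> and
    \<open>lc4\<close>, and the logarithm contributes -35 |a|^4, so the fourth powers
    balance.\<close>
  have r4: "Re (x * y * cnj z * cnj w) = dev4 x y z w + (cmod x ^ 4 + cmod y ^ 4 + cmod z ^ 4 + cmod w ^ 4) / 4"
    for x y z w by (simp add: dev4_def re4_def)
  have re: "Re (numeral k * z) = numeral k * Re z" "Re (z / 2) = Re z / 2" for k z by simp_all
  have quart: "Re (112 * lc1 a b - 56 * lc2 a b c + 16 * lc3 a b c d - 2 * lc4 a b c d e) =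
      112 * Re (a * cnj b) - 56 * Re (a * cnj c) + 16 * Re (a * cnj d) - 2 * Re (a * cnj e)
      + 56 * Re (a * b * cnj b * cnj c) + 28 * Re (a * a * cnj b * cnj b)
      - 16 * (Re (a * b * cnj b * cnj d) + Re (a * c * cnj c * cnj d) + Re (a * b * cnj c * cnj c) 
         + Re (a * a * cnj b * cnj c))
      + 2 * (Re (a * b * cnj b * cnj e) + Re (a * c * cnj c * cnj e) + Re (a * d * cnj d * cnj e) 
         + Re (a * c * cnj d * cnj d) + 2 * Re (a * b * cnj c * cnj d) + Re (a * a * cnj c * cnj c) / 2
         + Re (a * a * cnj b * cnj d))
      + (16 * Re (lc3_rem a b c d) - 2 * Re (lc4_rem a b c d e))"
    unfolding lc1_def lc2_def lc3_def lc4_def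
    by (simp only: plus_complex.sel minus_complex.sel re) (simp add: field_simps del: times_complex.sel)
  show ?thesis
    unfolding local_entropy_def quart quad r4 by (simp add: field_simps del: times_complex.sel)
qed

section \<open>Summation of the local terms\<close>

lemma shift_minus_id_4:
  "(shift_minus_id ^^ 4) x n = x (n + 4) - 4 * x (n + 3) + 6 * x (n + 2) - 4 * x (n + 1) + x n"
  by (simp add: numeral_eq_Suc shift_minus_id_def left_shift_def)

lemma bounded_range_comp2:
  fixes x :: "nat \<Rightarrow> complex"
  assumes "\<And>n. cmod (x n) \<le> 1"
  shows "bounded (range (\<lambda>n. Re (x (n + k) * cnj (x n))))"
    and "bounded (range (\<lambda>n. cmod (x n) ^ k))"
proof -
  have "\<bar>Re (x (n + k) * cnj (x n))\<bar> \<le> 1" for n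
    using abs_Re_le_cmod[of "x (n + k) * cnj (x n)"] mult_le_one[OF assms[of "n + k"] norm_ge_zero assms[of n]]
    by (simp add: norm_mult)
  then show "bounded (range (\<lambda>n. Re (x (n + k) * cnj (x n))))" by (auto simp: bounded_iff)
  show "bounded (range (\<lambda>n. cmod (x n) ^ k))"
    using assms by (auto simp: bounded_iff power_le_one intro!: exI[of _ 1])
qed


text \<open>Every line of \<open>local_entropy_eq\<close> either telescopes or is dominated by a
  summable sequence. The two summability hypotheses enter through \<open>M\<close> and
  \<open>D\<close>.\<close>

lemma bdd_sums_local_entropy:
  fixes x :: "nat \<Rightarrow> complex"
  assumes x1: "\<And>n. cmod (x n) \<le> 1" and x6: "in_ell 6 x" and dx: "in_ell 3 (shift_minus_id x)"
  shows "bdd_sums (\<lambda>n. local_entropy (x (n+4)) (x (n+3)) (x (n+2)) (x (n+1)) (x n)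
           + (cmod ((shift_minus_id ^^ 4) x n))\<^sup>2)"
proof -
  \<comment> \<open>One window bound serves all five arguments, and \<open>D\<close> bounds the
    difference of any two of them. Sums are taken instead of maxima so that
    \<open>summable_power_add\<close> applies.\<close>
  define M where "M n = cmod (x (n+4)) + cmod (x (n+3)) + cmod (x (n+2)) + cmod (x (n+1)) + cmod (x n)" for n
  define D where "D n = cmod (x (n+4) - x (n+3)) + cmod (x (n+3) - x (n+2)) + cmod (x (n+2) - x (n+1)) 
    + cmod (x (n+1) - x n)" for n
  have sx: "summable (\<lambda>n. cmod (x (n + k)) ^ 6)" for k
    using x6 summable_iff_shift[of "\<lambda>n. cmod (x n) ^ 6" k] unfolding in_ell_def by blast
  have sx0: "summable (\<lambda>n. cmod (x n) ^ 6)" using sx[of 0] by simp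
  have sM: "summable (\<lambda>n. M n ^ 6)"
    unfolding M_def by (intro summable_power_add sx sx0 add_nonneg_nonneg norm_ge_zero)
  have sd: "summable (\<lambda>n. cmod (x (Suc (n + k)) - x (n + k)) ^ 3)" for k
    using dx summable_iff_shift[of "\<lambda>n. cmod (x (Suc n) - x n) ^ 3" k]
    unfolding in_ell_def shift_minus_id_def left_shift_def by blast
  have sD: "summable (\<lambda>n. D n ^ 3)"
    unfolding D_def using sd[of 3] sd[of 2] sd[of 1] sd[of 0]
    by (intro summable_power_add add_nonneg_nonneg norm_ge_zero) (simp_all add: eval_nat_numeral)
  define E where "E n = M n ^ 6 + D n ^ 3" for n
  have sE: "summable E" unfolding E_def by (intro summable_add sM sD)
  have M: "cmod (x (n+4)) \<le> M n" "cmod (x (n+3)) \<le> M n" "cmod (x (n+2)) \<le> M n" 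
    "cmod (x (n+1)) \<le> M n" "cmod (x n) \<le> M n" for n
    unfolding M_def by (simp_all add: add_nonneg_nonneg add_increasing add_increasing2)
  have tri: "cmod (u - w) \<le> cmod (u - v) + cmod (v - w)" for u v w :: complex
    using norm_triangle_ineq[of "u - v" "v - w"] by simp
  have D: "cmod (x (n+i) - x (n+j)) \<le> D n" if "i \<le> 4" "j \<le> 4" for n i j
  proof -
    have "i \<in> {0,1,2,3,4}" "j \<in> {0,1,2,3,4}" using that by auto
    then show ?thesis unfolding D_def
      using tri[of "x (n+4)" "x (n+2)" "x (n+3)"] tri[of "x (n+4)" "x (n+1)" "x (n+2)"] 
        tri[of "x (n+4)" "x n" "x (n+1)"] tri[of "x (n+3)" "x (n+1)" "x (n+2)"]
        tri[of "x (n+3)" "x n" "x (n+1)"] tri[of "x (n+2)" "x n" "x (n+1)"]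
        norm_ge_zero[of "x (n+4) - x (n+3)"] norm_ge_zero[of "x (n+3) - x (n+2)"]
        norm_ge_zero[of "x (n+2) - x (n+1)"] norm_ge_zero[of "x (n+1) - x n"]
        norm_minus_commute[of "x (n+i)" "x (n+j)"]
      by (elim insertE emptyE; hypsubst; simp only: add_0_right diff_self norm_zero; linarith)
  qed
  have dev: "bdd_sums (\<lambda>n. dev4 (x (n+i)) (x (n+j)) (x (n+k)) (x (n+l)))" 
    if "i \<le> 4" "j \<le> 4" "k \<le> 4" "l \<le> 4" for i j k l
  proof (rule bdd_sums_comparison)
    have M': "cmod (x (n+i)) \<le> M n" if "i \<le> 4" for i n
    proof -
      have "i \<in> {0,1,2,3,4}" using that by auto
      then show ?thesis using M[of n] by auto
    qed
    show "\<bar>dev4 (x (n+i)) (x (n+j)) (x (n+k)) (x (n+l))\<bar> \<le> 4 * E n" for n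
      unfolding E_def by (intro dev4_bound M' D that)
    show "summable (\<lambda>n. 4 * E n)" by (intro summable_mult sE)
  qed
  have lag: "bdd_sums (\<lambda>n. Re (x (n+j+k) * cnj (x (n+j))) - Re (x (n+k) * cnj (x n)))" for j k
    using bdd_sums_diff[OF bounded_range_comp2(1)[of x k, OF x1], of j] by simp
  have pow: "bdd_sums (\<lambda>n. cmod (x (n+j)) ^ k - cmod (x n) ^ k)" for j k
    using bdd_sums_diff[OF bounded_range_comp2(2)[of x k, OF x1], of j] by simp
  define L where "L n = ln (1 - (cmod (x (n+4)))\<^sup>2) + (cmod (x (n+4)))\<^sup>2 + ((cmod (x (n+4)))\<^sup>2)\<^sup>2 / 2" for n
  have log: "bdd_sums L"
  proof (rule bdd_sums_summable)
    have "(\<lambda>n. (cmod (x (n + 4)) ^ 6)) \<longlonglongrightarrow> 0" by (rule summable_LIMSEQ_zero[OF sx])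
    then have "\<forall>\<^sub>F n in sequentially. cmod (x (n + 4)) ^ 6 < (1/2) ^ 3"
      by (rule order_tendstoD) simp
    \<comment> \<open>The Taylor estimate needs |x|^2 at most 1/2. This holds from some index on,
      because x tends to 0, and finitely many terms do not affect summability.\<close>
    then have ev: "\<forall>\<^sub>F n in sequentially. (cmod (x (n + 4)))\<^sup>2 \<le> 1/2"
    proof eventually_elim
      case (elim n)
      have "((cmod (x (n + 4)))\<^sup>2) ^ 3 < (1/2) ^ 3" using elim by (simp flip: power_mult)
      then show ?case using power_less_imp_less_base by fastforce
    qed
    show "summable (\<lambda>n. \<bar>L n\<bar>)"
    proof (rule summable_comparison_test_ev[OF _ sx[of 4]], use ev in eventually_elim)
      case (elim n)
      have "((cmod (x (n + 4)))\<^sup>2) ^ 3 = cmod (x (n + 4)) ^ 6" by (simp flip: power_mult)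
      then show ?case using ln_one_minus_taylor2[OF _ elim] by (simp add: L_def)
    qed
  qed
  have rem: "bdd_sums (\<lambda>n. 16 * Re (lc3_rem (x (n+4)) (x (n+3)) (x (n+2)) (x (n+1))) 
      - 2 * Re (lc4_rem (x (n+4)) (x (n+3)) (x (n+2)) (x (n+1)) (x n)))" 
  proof (rule bdd_sums_comparison)
    show "\<bar>16 * Re (lc3_rem (x (n+4)) (x (n+3)) (x (n+2)) (x (n+1))) 
      - 2 * Re (lc4_rem (x (n+4)) (x (n+3)) (x (n+2)) (x (n+1)) (x n))\<bar> \<le> 124 * M n ^ 6" for n
      using lc_rem_bound[OF M[of n] x1 x1 x1 x1 x1]
        abs_Re_le_cmod[of "lc3_rem (x (n+4)) (x (n+3)) (x (n+2)) (x (n+1))"]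
        abs_Re_le_cmod[of "lc4_rem (x (n+4)) (x (n+3)) (x (n+2)) (x (n+1)) (x n)"] 
      by linarith
    show "summable (\<lambda>n. 124 * M n ^ 6)" by (intro summable_mult sM)
  qed
  let ?s = "\<lambda>k j n. cmod (x (n+j)) ^ k - cmod (x n) ^ k"
  let ?l = "\<lambda>k j n. Re (x (n+j+k) * cnj (x (n+j))) - Re (x (n+k) * cnj (x n))"
  let ?d = "\<lambda>i j k l n. dev4 (x (n+i)) (x (n+j)) (x (n+k)) (x (n+l))"
  \<comment> \<open>All telescoping terms are differences to the lowest index, so each line omits
    its last coefficient, which is minus the sum of the listed ones.\<close>
  have "bdd_sums (\<lambda>n. ((-69) * ?s 2 4 n + 16 * ?s 2 3 n + 36 * ?s 2 2 n + 16 * ?s 2 1 n)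
     + (104 * ?l 1 3 n + (-48) * ?l 1 2 n + (-48) * ?l 1 1 n)
     + ((-44) * ?l 2 2 n + 32 * ?l 2 1 n) + 8 * ?l 3 1 n
     + ((-45/2) * ?s 4 4 n + 57/2 * ?s 4 3 n + (-3) * ?s 4 2 n + (-9/2) * ?s 4 1 n)
     + (56 * ?d 4 3 3 2 n + 28 * ?d 4 4 3 3 n 
        + (-16) * (?d 4 3 3 1 n + ?d 4 2 2 1 n + ?d 4 3 2 2 n + ?d 4 4 3 2 n)
        + 2 * (?d 4 3 3 0 n + ?d 4 2 2 0 n + ?d 4 1 1 0 n + ?d 4 2 1 1 n + 2 * ?d 4 3 2 1 n
               + (1/2) * ?d 4 4 2 2 n + ?d 4 4 3 1 n))
     + 70 * L n
     + (16 * Re (lc3_rem (x (n+4)) (x (n+3)) (x (n+2)) (x (n+1))) 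
      - 2 * Re (lc4_rem (x (n+4)) (x (n+3)) (x (n+2)) (x (n+1)) (x n))))"
    apply (intro bdd_sums_add bdd_sums_cmult rem log pow lag)
    apply (rule dev; simp)+
    done
  then show ?thesis
  proof (rule bdd_sums_cong, goal_cases)
    case (1 n)
    have e: "n + 3 + 1 = n + 4" "n + 2 + 1 = n + 3" "n + 1 + 1 = n + 2" "n + 2 + 2 = n + 4" "n + 1 + 2 = n + 3"
      "n + 1 + 3 = n + 4" by simp_all
    show ?case
      unfolding shift_minus_id_4 local_entropy_eq e add_0_right L_def[symmetric]
      by (simp add: algebra_simps del: times_complex.sel)
  qed
qed

section \<open>Mean values over the circle\<close>

lemma angle_measure_eq_density: "angle_measure = density lborel (\<lambda>x. ennreal (indicator {0..2*pi} x / (2*pi)))"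
proof -
  have "indicator {0..2*pi} x / ennreal (2*pi) = ennreal (indicator {0..2*pi} x / (2*pi))" for x :: real
    by (auto split: split_indicator simp: divide_ennreal ennreal_1[symmetric] simp del: ennreal_1)
  then show ?thesis
    unfolding angle_measure_def uniform_measure_def by simp
qed

lemma sets_angle_measure [simp, measurable_cong]: "sets angle_measure = sets borel"
  by (simp add: angle_measure_def)

lemma space_angle_measure [simp]: "space angle_measure = UNIV"
  by (simp add: angle_measure_def)

lemma prob_space_angle_measure: "prob_space angle_measure"
  unfolding angle_measure_def by (rule prob_space_uniform_measure) auto

interpretation angle: prob_space angle_measure by (rule prob_space_angle_measure)

text \<open>Dropping the null endpoint 2 pi leaves the half-open interval on which
  \<open>Arg2pi\<close> inverts \<open>cis\<close>.\<close>

lemma AE_angle_measureI: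
  assumes "\<And>\<theta>. 0 \<le> \<theta> \<Longrightarrow> \<theta> < 2*pi \<Longrightarrow> P \<theta>"
  shows "AE \<theta> in angle_measure. P \<theta>"
  unfolding angle_measure_def
proof (rule AE_uniform_measureI)
  show "AE \<theta> in lborel. \<theta> \<in> {0..2*pi} \<longrightarrow> P \<theta>"
    using AE_lborel_singleton[of "2*pi"] by eventually_elim (use assms in auto)
qed simp

lemma integral_angle_measure:
  fixes f :: "real \<Rightarrow> complex"
  assumes "continuous_on UNIV f"
  shows "integral\<^sup>L angle_measure f = integral {0..2*pi} f / (2*pi)"
proof -
  have m: "f \<in> borel_measurable borel" using assms by (rule borel_measurable_continuous_onI)
  have "integral\<^sup>L angle_measure f = integral\<^sup>L lborel (\<lambda>x. (indicator {0..2*pi} x / (2*pi)) *\<^sub>R f x)"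
    unfolding angle_measure_eq_density by (rule integral_density) (use m in auto)
  also have "\<dots> = (LINT x:{0..2*pi}|lborel. f x) / (2*pi)"
    unfolding set_lebesgue_integral_def integral_divide_zero[symmetric]
    by (intro Bochner_Integration.integral_cong) (auto simp: scaleR_conv_of_real)
  also have "(LINT x:{0..2*pi}|lborel. f x) = integral {0..2*pi} f"
    by (intro set_borel_integral_eq_integral borel_integrable_atLeastAtMost' continuous_on_subset[OF assms]) auto
  finally show ?thesis by simp
qed

lemma continuous_on_comp_cis:
  assumes "continuous_on (sphere 0 1) f" shows "continuous_on UNIV (\<lambda>\<theta>. f (cis \<theta>))"
  by (rule continuous_on_compose2[OF assms]) (auto intro!: continuous_intros)

lemma integrable_angle_comp_cis:
  fixes f :: "complex \<Rightarrow> 'a::euclidean_space"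
  assumes "continuous_on (sphere 0 1) f" 
  shows "integrable angle_measure (\<lambda>\<theta>. f (cis \<theta>))"
proof -
  have "compact (f ` sphere 0 1)" using assms by (intro compact_continuous_image) auto
  then obtain B where "\<And>z. z \<in> sphere 0 1 \<Longrightarrow> norm (f z) \<le> B"
    using compact_imp_bounded bounded_iff by (metis imageI)
  then have "AE \<theta> in angle_measure. norm (f (cis \<theta>)) \<le> B" by simp
  moreover have "(\<lambda>\<theta>. f (cis \<theta>)) \<in> borel_measurable angle_measure"
    using borel_measurable_continuous_onI[OF continuous_on_comp_cis[OF assms]] by simp
  ultimately show ?thesis by (rule angle.integrable_const_bound)
qed

text \<open>Cauchy's formula for the k-th derivative, with the unit circle itself as contour;
  therefore continuity up to the boundary suffices.\<close>

lemma angle_taylor_coeff: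
  assumes "continuous_on (cball 0 1) f" "f holomorphic_on ball 0 1"
  shows "integral\<^sup>L angle_measure (\<lambda>\<theta>. f (cis \<theta>) / cis \<theta> ^ k) = (deriv ^^ k) f 0 / fact k"
proof -
  let ?g = "\<lambda>t. f (cis t) / cis t ^ k"
  have "((\<lambda>u. f u / (u - 0) ^ Suc k) has_contour_integral ((2 * pi * \<i>) / fact k * (deriv ^^ k) f 0))
           (circlepath 0 1)"
    by (rule Cauchy_has_contour_integral_higher_derivative_circlepath[OF assms]) simp
  then have "((\<lambda>t. f (cis t) / cis t ^ Suc k * \<i> * cis t) has_integral 
      ((2 * pi * \<i>) / fact k * (deriv ^^ k) f 0)) {0..2*pi}"
    unfolding circlepath_def by (subst (asm) has_contour_integral_part_circlepath_iff) auto
  then have "((\<lambda>t. f (cis t) / cis t ^ Suc k * \<i> * cis t / \<i>) has_integral 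
      ((2 * pi * \<i>) / fact k * (deriv ^^ k) f 0) / \<i>) {0..2*pi}"
    by (rule has_integral_divide)
  then have "(?g has_integral 2 * pi * ((deriv ^^ k) f 0 / fact k)) {0..2*pi}"
    by (simp add: field_simps)
  then have *: "integral {0..2*pi} ?g = 2 * pi * ((deriv ^^ k) f 0 / fact k)"
    by (rule integral_unique)
  have "continuous_on (sphere 0 1) (\<lambda>z. f z / z ^ k)"
    using continuous_on_subset[OF assms(1)] by (intro continuous_intros) auto
  then show ?thesis
    using integral_angle_measure[OF continuous_on_comp_cis, of "\<lambda>z. f z / z ^ k"] * by simp
qed

text \<open>Mean value property of z^k f(z), which vanishes at 0.\<close>

lemma angle_mean_zero:
  assumes "continuous_on (cball 0 1) f" "f holomorphic_on ball 0 1" "0 < k"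
  shows "integral\<^sup>L angle_measure (\<lambda>\<theta>. f (cis \<theta>) * cis \<theta> ^ k) = 0"
  using angle_taylor_coeff[of "\<lambda>z. f z * z ^ k" 0] assms
  by (force intro!: continuous_intros holomorphic_intros)

text \<open>With u = \<open>cis \<theta>\<close> one has 2 - u - 1/u = -(1-u)^2/u, so the numerator
  is (1-u)^8/u^4; this explains the alternating binomial coefficients 70, 56, 28, 8, 1 of order
  8.\<close>

lemma one_minus_cos_power4:
  "complex_of_real ((1 - cos \<theta>) ^ 4) = (70 - 56 * (cis \<theta> + 1 / cis \<theta>) 
     + 28 * (cis \<theta> ^ 2 + 1 / cis \<theta> ^ 2) - 8 * (cis \<theta> ^ 3 + 1 / cis \<theta> ^ 3)
     + (cis \<theta> ^ 4 + 1 / cis \<theta> ^ 4)) / 16"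
proof -
  have "of_real (cos \<theta>) = (cis \<theta> + 1 / cis \<theta>) / 2"
  proof -
    have "1 / cis \<theta> = cis (- \<theta>)" by (metis cis_inverse inverse_eq_divide)
    then show ?thesis by (simp add: complex_eq_iff)
  qed
  then have *: "of_real ((1 - cos \<theta>) ^ 4) = (1 - (cis \<theta> + 1 / cis \<theta>) / 2) ^ 4"
    by (simp only: of_real_power of_real_diff of_real_1)
  have alg: "(2 - (u + v)) ^ 4 = 70 - 56 * (u + v) + 28 * (u ^ 2 + v ^ 2) - 8 * (u ^ 3 + v ^ 3) + (u ^ 4 + v ^ 4)"
    if "u * v = 1" for u v :: complex
  proof -
    have 2: "(u + v)^2 = u^2 + v^2 + 2 * (u * v)" by (simp add: power2_eq_square algebra_simps)
    have 3: "(u + v)^3 = u^3 + v^3 + 3 * (u * v) * (u + v)" by (simp add: power3_eq_cube algebra_simps)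
    have 4: "(u + v)^4 = u^4 + v^4 + 4 * (u * v) * (u^2 + v^2) + 6 * (u * v)^2" 
      by (simp add: power4_eq_xxxx power2_eq_square algebra_simps)
    have "(2 - s) ^ 4 = 16 - 32 * s + 24 * s^2 - 8 * s^3 + s^4" for s :: complex
      by (simp add: power4_eq_xxxx power3_eq_cube power2_eq_square algebra_simps)
    note expand = this[of "u + v", unfolded 2 3 4 that]
    show ?thesis unfolding expand by (simp add: algebra_simps)
  qed
  have half: "1 - s / 2 = (2 - s) / 2" for s :: complex by (simp add: diff_divide_distrib)
  have uv: "cis \<theta> * (1 / cis \<theta>) = 1" by simp
  show ?thesis unfolding * half power_divide alg[OF uv] by (simp only: power_one) simp
qed

text \<open>Multiplication by a positive power of z gives mean 0 and division by it extracts a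
  Taylor coefficient. Hence each pair z^k + z^(-k) of the weight contributes its coefficient only
  once.\<close>

lemma angle_weighted_Re:
  assumes "continuous_on (cball 0 1) f" "f holomorphic_on ball 0 1"
  defines "c \<equiv> \<lambda>k. (deriv ^^ k) f 0 / fact k"
  shows "integral\<^sup>L angle_measure (\<lambda>\<theta>. (1 - cos \<theta>) ^ 4 * Re (f (cis \<theta>)))
     = Re (70 * c 0 - 56 * c 1 + 28 * c 2 - 8 * c 3 + c 4) / 16"
proof -
  have cf: "continuous_on (sphere 0 1) f" using assms(1) by (rule continuous_on_subset) auto
  have i1: "integrable angle_measure (\<lambda>\<theta>. f (cis \<theta>) / cis \<theta> ^ k)" for k
    using integrable_angle_comp_cis[of "\<lambda>z. f z / z ^ k"] cf by (force intro!: continuous_intros)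
  have i2: "integrable angle_measure (\<lambda>\<theta>. f (cis \<theta>) * cis \<theta> ^ k)" for k
    using integrable_angle_comp_cis[of "\<lambda>z. f z * z ^ k"] cf by (force intro!: continuous_intros)
  have e: "of_real ((1 - cos \<theta>) ^ 4) * f (cis \<theta>) = 
     (70 / 16) * (f (cis \<theta>) / cis \<theta> ^ 0) 
     - (56 / 16) * (f (cis \<theta>) * cis \<theta> ^ 1 + f (cis \<theta>) / cis \<theta> ^ 1)
     + (28 / 16) * (f (cis \<theta>) * cis \<theta> ^ 2 + f (cis \<theta>) / cis \<theta> ^ 2)
     - (8 / 16) * (f (cis \<theta>) * cis \<theta> ^ 3 + f (cis \<theta>) / cis \<theta> ^ 3)
     + (1 / 16) * (f (cis \<theta>) * cis \<theta> ^ 4 + f (cis \<theta>) / cis \<theta> ^ 4)" for \<theta>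
  proof -
    have "(70 - 56 * (u1 + v1) + 28 * (u2 + v2) - 8 * (u3 + v3) + (u4 + v4)) / 16 * F =
      (70 / 16) * F - (56 / 16) * (F * u1 + F * v1) + (28 / 16) * (F * u2 + F * v2) 
      - (8 / 16) * (F * u3 + F * v3) + (1 / 16) * (F * u4 + F * v4)"
      for u1 u2 u3 u4 v1 v2 v3 v4 F :: complex
      by (simp add: field_simps)
    from this[of "cis \<theta>" "1 / cis \<theta>" "cis \<theta> ^ 2" "1 / cis \<theta> ^ 2" "cis \<theta> ^ 3" "1 / cis \<theta> ^ 3"
      "cis \<theta> ^ 4" "1 / cis \<theta> ^ 4" "f (cis \<theta>)"]
    show ?thesis unfolding one_minus_cos_power4 by simp
  qed
  have m: "integral\<^sup>L angle_measure (\<lambda>\<theta>. f (cis \<theta>) * cis \<theta> ^ k) = 0" if "k > 0" for k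
    using angle_mean_zero[OF assms(1,2) that] .
  have t: "integral\<^sup>L angle_measure (\<lambda>\<theta>. f (cis \<theta>) / cis \<theta> ^ k) = c k" for k
    unfolding c_def by (rule angle_taylor_coeff[OF assms(1,2)])
  have hb1: "has_bochner_integral angle_measure (\<lambda>\<theta>. f (cis \<theta>) / cis \<theta> ^ k) (c k)" for k
    using i1[of k] t[of k] has_bochner_integral_integrable by metis
  have hb2: "has_bochner_integral angle_measure (\<lambda>\<theta>. f (cis \<theta>) * cis \<theta> ^ k) 0" if "k > 0" for k
    using i2[of k] m[OF that] has_bochner_integral_integrable by metis
  have "has_bochner_integral angle_measure (\<lambda>\<theta>. of_real ((1 - cos \<theta>) ^ 4) * f (cis \<theta>))
     ((70 / 16) * c 0 - (56 / 16) * (0 + c 1) + (28 / 16) * (0 + c 2) - (8 / 16) * (0 + c 3) 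
     + (1 / 16) * (0 + c 4))"
    unfolding e 
    by (intro has_bochner_integral_add has_bochner_integral_diff has_bochner_integral_mult_right hb1 hb2)
       simp_all
  then have "integral\<^sup>L angle_measure (\<lambda>\<theta>. of_real ((1 - cos \<theta>) ^ 4) * f (cis \<theta>)) = 
     (70 / 16) * c 0 - (56 / 16) * (0 + c 1) + (28 / 16) * (0 + c 2) - (8 / 16) * (0 + c 3) 
     + (1 / 16) * (0 + c 4)" 
    and "integrable angle_measure (\<lambda>\<theta>. of_real ((1 - cos \<theta>) ^ 4) * f (cis \<theta>))"
    by (auto simp: has_bochner_integral_iff)
  then have "integral\<^sup>L angle_measure (\<lambda>\<theta>. Re (of_real ((1 - cos \<theta>) ^ 4) * f (cis \<theta>))) =
     Re ((70 / 16) * c 0 - (56 / 16) * (0 + c 1) + (28 / 16) * (0 + c 2) - (8 / 16) * (0 + c 3) 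
     + (1 / 16) * (0 + c 4))"
    by (subst integral_Re) simp_all
  then show ?thesis by (simp add: field_simps)
qed

section \<open>The Szego recursion\<close>

text \<open>The second component is the reversed polynomial; carrying it along makes the recursion
  first order. The sequence is arbitrary here: the link to the orthogonal polynomials of a measure
  is \<open>verblunsky_recursion\<close>.\<close>

primrec szego_pair :: "(nat \<Rightarrow> complex) \<Rightarrow> nat \<Rightarrow> complex poly \<times> complex poly" where
  "szego_pair a 0 = (1, 1)"
| "szego_pair a (Suc n) = 
     (pCons 0 (fst (szego_pair a n)) - smult (cnj (a n)) (snd (szego_pair a n)),
      snd (szego_pair a n) - smult (a n) (pCons 0 (fst (szego_pair a n))))"

definition szego :: "(nat \<Rightarrow> complex) \<Rightarrow> nat \<Rightarrow> complex poly" where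
  "szego a n = fst (szego_pair a n)"

definition szego_rev :: "(nat \<Rightarrow> complex) \<Rightarrow> nat \<Rightarrow> complex poly" where
  "szego_rev a n = snd (szego_pair a n)"

lemma szego_0 [simp]: "szego a 0 = 1" "szego_rev a 0 = 1"
  by (simp_all add: szego_def szego_rev_def)

lemma szego_Suc: "szego a (Suc n) = pCons 0 (szego a n) - smult (cnj (a n)) (szego_rev a n)"
  by (simp add: szego_def szego_rev_def)

lemma szego_rev_Suc: "szego_rev a (Suc n) = szego_rev a n - smult (a n) (pCons 0 (szego a n))"
  by (simp add: szego_def szego_rev_def)

lemma degree_szego_rev_le: "degree (szego a n) = n \<and> coeff (szego a n) n = 1 \<and> degree (szego_rev a n) \<le> n"
proof (induction n)
  case (Suc n)
  have nz: "szego a n \<noteq> 0" using Suc by auto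
  have d: "degree (pCons 0 (szego a n)) = Suc n" using Suc nz by simp
  have l: "degree (smult (cnj (a n)) (szego_rev a n)) < Suc n"
    using Suc degree_smult_le[of "cnj (a n)" "szego_rev a n"] by linarith
  have "degree (szego a (Suc n)) = Suc n"
    unfolding szego_Suc diff_conv_add_uminus using d l by (subst degree_add_eq_left) auto
  moreover have "coeff (szego a (Suc n)) (Suc n) = 1"
  proof -
    have "coeff (szego a (Suc n)) (Suc n) = coeff (szego a n) n"
      unfolding szego_Suc using l coeff_eq_0[OF l] by (simp add: coeff_pCons del: coeff_smult)
    then show ?thesis using Suc by simp
  qed
  moreover have "degree (szego_rev a (Suc n)) \<le> Suc n"
    unfolding szego_rev_Suc
    by (intro degree_diff_le order_trans[OF degree_smult_le]) (use Suc d in auto)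
  ultimately show ?case by simp
qed auto

lemma degree_szego [simp]: "degree (szego a n) = n"
  and lead_coeff_szego [simp]: "coeff (szego a n) n = 1"
  using degree_szego_rev_le[of a n] by auto

lemma poly_szego_Suc: "poly (szego a (Suc n)) z = z * poly (szego a n) z - cnj (a n) * poly (szego_rev a n) z"
  by (simp add: szego_Suc)

lemma poly_szego_rev_Suc: 
  "poly (szego_rev a (Suc n)) z = poly (szego_rev a n) z - a n * (z * poly (szego a n) z)"
  by (simp add: szego_rev_Suc)

lemma poly_szego_rev_0 [simp]: "poly (szego_rev a n) 0 = 1"
  by (induction n) (simp_all add: poly_szego_rev_Suc)

lemma poly_szego_Suc_0: "poly (szego a (Suc n)) 0 = - cnj (a n)"
  by (simp add: poly_szego_Suc)

lemma szego_rev_circle: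
  assumes "cmod z = 1" shows "poly (szego_rev a n) z = z ^ n * cnj (poly (szego a n) z)"
proof -
  have zz: "z * cnj z = 1" by (metis assms complex_norm_square of_real_1 power_one)
  \<comment> \<open>Both reversal identities go through the induction together, since either
    recursion step involves both polynomials.\<close>
  have "poly (szego_rev a n) z = z ^ n * cnj (poly (szego a n) z) \<and> 
        poly (szego a n) z = z ^ n * cnj (poly (szego_rev a n) z)"
  proof (induction n)
    case (Suc n)
    let ?p = "poly (szego a n) z" and ?q = "poly (szego_rev a n) z"
    note IH = conjunct1[OF Suc, symmetric] conjunct2[OF Suc, symmetric]
    have "z ^ Suc n * cnj (poly (szego a (Suc n)) z) = (z * cnj z) * (z ^ n * cnj ?p) - a n * (z * (z ^ n * cnj ?q))"
      unfolding poly_szego_Suc complex_cnj_diff complex_cnj_mult complex_cnj_cnj power_Suc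
      by (simp only: algebra_simps)
    moreover have "z ^ Suc n * cnj (poly (szego_rev a (Suc n)) z) 
        = z * (z ^ n * cnj ?q) - cnj (a n) * ((z * cnj z) * (z ^ n * cnj ?p))"
      unfolding poly_szego_rev_Suc complex_cnj_diff complex_cnj_mult complex_cnj_cnj power_Suc
      by (simp only: algebra_simps)
    ultimately show ?case unfolding IH zz poly_szego_Suc[of a n z] poly_szego_rev_Suc[of a n z] by simp
  qed auto
  then show ?thesis by blast
qed

lemma cmod_szego_rev_circle:
  assumes "cmod z = 1" shows "cmod (poly (szego_rev a n) z) = cmod (poly (szego a n) z)"
  using assms by (simp add: szego_rev_circle norm_mult norm_power)

text \<open>A Szego step preserves the indefinite form |q|^2 - |p|^2 up to the positive factor 1 -
  |c|^2.\<close>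

lemma cmod_sq_diff_szego:
  fixes p q c :: complex
  shows "(cmod (q - c * p))\<^sup>2 - (cmod (p - cnj c * q))\<^sup>2 = (1 - (cmod c)\<^sup>2) * ((cmod q)\<^sup>2 - (cmod p)\<^sup>2)"
  unfolding cmod_power2 by (simp add: power2_eq_square algebra_simps)

section \<open>The logarithmic factors and their Taylor coefficients\<close>

lemma has_fps_expansion_eqI:
  fixes F G :: "complex fps"
  assumes "f has_fps_expansion F" "g has_fps_expansion G" "\<forall>\<^sub>F z in nhds 0. f z = g z"
  shows "F = G"
  using assms(2) fps_expansion_unique_complex[OF assms(1)] has_fps_expansion_cong[OF assms(3) refl]
  by blast

text \<open>For coefficients in the disc this is a finite Blaschke product whose Schur parameters
  are, up to sign and conjugation, the coefficients in reverse order. That is why its Taylor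
  coefficients at 0 look backwards along the sequence.\<close>

definition schur_inv :: "(nat \<Rightarrow> complex) \<Rightarrow> nat \<Rightarrow> complex \<Rightarrow> complex" where
  "schur_inv a n z = poly (szego a n) z / poly (szego_rev a n) z"

context
  fixes a :: "nat \<Rightarrow> complex"
  assumes a1: "\<And>n. cmod (a n) < 1"
begin

text \<open>Domination is part of the induction because it makes the next reversed polynomial
  nonzero; \<open>cmod_sq_diff_szego\<close> then hands the domination on.\<close>

lemma szego_rev_dominates:
  assumes "cmod z \<le> 1"
  shows "poly (szego_rev a n) z \<noteq> 0 \<and> cmod (poly (szego a n) z) \<le> cmod (poly (szego_rev a n) z)"
proof (induction n)
  case (Suc n)
  let ?p = "z * poly (szego a n) z" and ?q = "poly (szego_rev a n) z"
  have pq: "cmod ?p \<le> cmod ?q"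
    using Suc mult_mono[OF assms conjunct2[OF Suc]] by (simp add: norm_mult)
  have "cmod (a n * ?p) \<le> cmod (a n) * cmod ?q" using pq by (simp add: norm_mult mult_left_mono)
  also have "\<dots> < cmod ?q" using a1[of n] Suc by simp
  finally have "?q - a n * ?p \<noteq> 0" by auto
  moreover have "0 \<le> (1 - (cmod (a n))\<^sup>2) * ((cmod ?q)\<^sup>2 - (cmod ?p)\<^sup>2)"
    using a1[of n] pq by (intro mult_nonneg_nonneg) (auto simp: power_mono power_le_one)
  then have "(cmod (?p - cnj (a n) * ?q))\<^sup>2 \<le> (cmod (?q - a n * ?p))\<^sup>2"
    unfolding cmod_sq_diff_szego[symmetric] by simp
  then have "cmod (?p - cnj (a n) * ?q) \<le> cmod (?q - a n * ?p)"
    by (rule power2_le_imp_le) simp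
  ultimately show ?case unfolding poly_szego_Suc poly_szego_rev_Suc by blast
qed auto

lemma cmod_schur_inv_le:
  assumes "cmod z \<le> 1" shows "cmod (schur_inv a n z) \<le> 1"
  using szego_rev_dominates[OF assms, of n] by (simp add: schur_inv_def norm_divide)

text \<open>The factor stays in the open right half-plane, so the principal logarithm is holomorphic
  along it and its real part is the logarithm of the modulus.\<close>

lemma schur_inv_factor_Re_pos:
  assumes "cmod z \<le> 1" shows "0 < Re (1 - a n * (z * schur_inv a n z))"
proof -
  have "cmod (a n * (z * schur_inv a n z)) \<le> cmod (a n) * (1 * 1)"
    unfolding norm_mult using assms cmod_schur_inv_le[OF assms, of n] by (intro mult_mono) auto
  also have "\<dots> < 1" using a1[of n] by simp
  finally show ?thesis using complex_Re_le_cmod[of "a n * (z * schur_inv a n z)"] by simp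
qed

lemma schur_inv_factor_notin:
  assumes "cmod z \<le> 1"
  shows "1 - a n * (z * schur_inv a n z) \<notin> \<real>\<^sub>\<le>\<^sub>0" "1 - a n * (z * schur_inv a n z) \<noteq> 0"
  using schur_inv_factor_Re_pos[OF assms, of n] unfolding complex_nonpos_Reals_iff
  by (linarith, metis order_less_irrefl zero_complex.sel(1))

lemma szego_rev_factor:
  assumes "cmod z \<le> 1"
  shows "poly (szego_rev a (Suc n)) z = poly (szego_rev a n) z * (1 - a n * (z * schur_inv a n z))"
  using szego_rev_dominates[OF assms, of n] by (simp add: poly_szego_rev_Suc schur_inv_def field_simps)

text \<open>One step of the Schur algorithm, with the denominator cleared so that it can be read as
  an identity of power series.\<close>

lemma schur_inv_Suc:
  assumes "cmod z \<le> 1"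
  shows "schur_inv a (Suc n) z * (1 - a n * (z * schur_inv a n z)) = z * schur_inv a n z - cnj (a n)"
proof -
  have "poly (szego_rev a n) z \<noteq> 0" "poly (szego_rev a (Suc n)) z \<noteq> 0" 
    using szego_rev_dominates[OF assms] by auto
  moreover have "1 - a n * (z * schur_inv a n z) = poly (szego_rev a (Suc n)) z / poly (szego_rev a n) z"
    using szego_rev_factor[OF assms, of n] calculation by (simp add: field_simps)
  ultimately have "schur_inv a (Suc n) z * (1 - a n * (z * schur_inv a n z)) 
    = poly (szego a (Suc n)) z / poly (szego_rev a n) z"
    unfolding schur_inv_def[of a "Suc n"] by simp
  then show ?thesis
    using \<open>poly (szego_rev a n) z \<noteq> 0\<close> by (simp add: schur_inv_def[of a n] poly_szego_Suc diff_divide_distrib)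
qed

definition log_factor :: "nat \<Rightarrow> complex \<Rightarrow> complex" where
  "log_factor n z = Ln (1 - a n * (z * schur_inv a n z))"

lemma schur_inv_continuous: "continuous_on (cball 0 1) (schur_inv a n)"
  unfolding schur_inv_def using szego_rev_dominates by (intro continuous_intros) auto

lemma schur_inv_holomorphic: "schur_inv a n holomorphic_on ball 0 1"
  unfolding schur_inv_def using szego_rev_dominates by (intro holomorphic_intros) auto

lemma log_factor_continuous: "continuous_on (cball 0 1) (log_factor n)"
  unfolding log_factor_def
  by (intro continuous_intros schur_inv_continuous) (rule schur_inv_factor_notin, simp)

lemma log_factor_holomorphic: "log_factor n holomorphic_on ball 0 1"
  unfolding log_factor_def
  by (intro holomorphic_intros schur_inv_holomorphic) (rule schur_inv_factor_notin, simp)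

lemma exp_log_factor:
  assumes "cmod z \<le> 1" shows "exp (log_factor n z) = 1 - a n * (z * schur_inv a n z)"
  unfolding log_factor_def by (rule exp_Ln[OF schur_inv_factor_notin(2)[OF assms]])

text \<open>On the circle the polynomial and its reversal have equal modulus, and the reversal is
  the product of the factors \<open>1 - a n * (z * schur_inv a n z)\<close>.\<close>

lemma ln_cmod_szego_sum:
  assumes "cmod z = 1"
  shows "ln ((cmod (poly (szego a N) z))\<^sup>2) = (\<Sum>n<N. 2 * Re (log_factor n z))"
proof (induction N)
  case (Suc N)
  have z: "cmod z \<le> 1" using assms by simp
  have nz: "poly (szego_rev a n) z \<noteq> 0" for n using szego_rev_dominates[OF z] by auto
  have "ln ((cmod (poly (szego a (Suc N)) z))\<^sup>2) = 
    ln ((cmod (poly (szego a N) z))\<^sup>2 * (cmod (1 - a N * (z * schur_inv a N z)))\<^sup>2)"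
    unfolding cmod_szego_rev_circle[OF assms, symmetric] szego_rev_factor[OF z]
    by (simp add: norm_mult power_mult_distrib)
  also have "\<dots> = ln ((cmod (poly (szego a N) z))\<^sup>2) + ln ((cmod (1 - a N * (z * schur_inv a N z)))\<^sup>2)"
    using nz[of N] schur_inv_factor_notin(2)[OF z, of N] cmod_szego_rev_circle[OF assms, of a N]
    by (intro ln_mult_pos) auto
  also have "ln ((cmod (1 - a N * (z * schur_inv a N z)))\<^sup>2) = 2 * Re (log_factor N z)"
    unfolding exp_log_factor[OF z, symmetric] by (simp add: ln_realpow)
  finally show ?case using Suc by simp
qed simp

definition log_coeff :: "nat \<Rightarrow> nat \<Rightarrow> complex" where
  "log_coeff n k = (deriv ^^ k) (log_factor n) 0 / fact k"

lemma schur_inv_fps: "schur_inv a n has_fps_expansion fps_expansion (schur_inv a n) 0"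
  by (rule has_fps_expansion_fps_expansion[OF open_ball _ schur_inv_holomorphic]) simp

lemma log_factor_fps: "log_factor n has_fps_expansion fps_expansion (log_factor n) 0"
  by (rule has_fps_expansion_fps_expansion[OF open_ball _ log_factor_holomorphic]) simp

lemma eventually_in_unit_ball: "\<forall>\<^sub>F z in nhds (0::complex). z \<in> ball 0 1"
  by (rule eventually_nhds_in_open) auto

lemma schur_inv_fps_Suc:
  fixes n
  defines "B \<equiv> fps_expansion (schur_inv a n) 0"
  shows "fps_expansion (schur_inv a (Suc n)) 0 * (1 - fps_const (a n) * (fps_X * B)) 
    = fps_X * B - fps_const (cnj (a n))"
proof -
  have B: "schur_inv a n has_fps_expansion B" unfolding B_def by (rule schur_inv_fps)
  have "(\<lambda>z. schur_inv a (Suc n) z * (1 - a n * (z * schur_inv a n z))) has_fps_expansion 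
      fps_expansion (schur_inv a (Suc n)) 0 * (1 - fps_const (a n) * (fps_X * B))"
    by (intro fps_expansion_intros B schur_inv_fps)
  moreover have "(\<lambda>z. z * schur_inv a n z - cnj (a n)) has_fps_expansion fps_X * B - fps_const (cnj (a n))"
    by (intro fps_expansion_intros B)
  moreover have "\<forall>\<^sub>F z in nhds 0. schur_inv a (Suc n) z * (1 - a n * (z * schur_inv a n z)) 
      = z * schur_inv a n z - cnj (a n)"
    using eventually_in_unit_ball by eventually_elim (use schur_inv_Suc in auto)
  ultimately show ?thesis
    by (rule has_fps_expansion_eqI)
qed

text \<open>Differentiating replaces the logarithm by a linear equation, from which the Taylor
  coefficients follow one after another without composing power series.\<close>

lemma log_factor_fps_deriv:
  fixes n
  defines "U \<equiv> fps_const (a n) * (fps_X * fps_expansion (schur_inv a n) 0)"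
  shows "fps_deriv (fps_expansion (log_factor n) 0) * (1 - U) = - fps_deriv U"
proof -
  let ?u = "\<lambda>z. a n * (z * schur_inv a n z)"
  have U: "?u has_fps_expansion U"
    unfolding U_def by (intro fps_expansion_intros schur_inv_fps)
  have "(\<lambda>z. deriv (log_factor n) z * (1 - ?u z)) has_fps_expansion 
      fps_deriv (fps_expansion (log_factor n) 0) * (1 - U)"
    by (intro fps_expansion_intros U log_factor_fps)
  moreover have "(\<lambda>z. - deriv ?u z) has_fps_expansion - fps_deriv U"
    by (intro fps_expansion_intros U)
  moreover have "\<forall>\<^sub>F z in nhds 0. deriv (log_factor n) z * (1 - ?u z) = - deriv ?u z"
    using eventually_in_unit_ball
  proof eventually_elim
    case (elim z)
    have hu: "?u holomorphic_on ball 0 1" by (intro holomorphic_intros schur_inv_holomorphic)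
    have du: "(?u has_field_derivative deriv ?u z) (at z)"
      using holomorphic_derivI[OF hu open_ball elim] .
    have z: "cmod z \<le> 1" using elim by simp
    note schur_inv_factor_notin(1)[OF z, of n]
    then have "(log_factor n has_field_derivative (inverse (1 - ?u z) * (0 - deriv ?u z))) (at z)"
      unfolding log_factor_def by (intro derivative_intros DERIV_chain2[OF has_field_derivative_Ln] du)
    then have "deriv (log_factor n) z = inverse (1 - ?u z) * (0 - deriv ?u z)" by (rule DERIV_imp_deriv)
    moreover have "1 - ?u z \<noteq> 0" by (rule schur_inv_factor_notin(2)[OF z])
    ultimately show ?case by (simp add: field_simps)
  qed
  ultimately show ?thesis
    by (rule has_fps_expansion_eqI)
qed

lemma log_coeff_eq: "log_coeff n k = fps_nth (fps_expansion (log_factor n) 0) k"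
  by (simp add: log_coeff_def fps_expansion_def)

lemma log_coeff_0: "log_coeff n 0 = 0"
  by (simp add: log_coeff_def log_factor_def)

definition schur_coeff :: "nat \<Rightarrow> nat \<Rightarrow> complex" where
  "schur_coeff n k = fps_nth (fps_expansion (schur_inv a n) 0) k"

text \<open>Coefficients of \<open>schur_inv_fps_Suc\<close> are compared in increasing order, each
  result being substituted into the next. The factor \<rho> appears because the constant term is
  \<open>- cnj (a n)\<close>.\<close>

lemma schur_coeff_Suc:
  fixes n
  defines "\<rho> \<equiv> 1 - a n * cnj (a n)" and "b \<equiv> schur_coeff n"
  shows "schur_coeff (Suc n) 0 = - cnj (a n)"
    and "schur_coeff (Suc n) 1 = \<rho> * b 0"
    and "schur_coeff (Suc n) 2 = \<rho> * (b 1 + a n * b 0 * b 0)"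
    and "schur_coeff (Suc n) 3 = \<rho> * (b 2 + 2 * a n * b 0 * b 1 + a n * a n * b 0 * b 0 * b 0)"
proof -
  let ?F = "fps_expansion (schur_inv a (Suc n)) 0" and ?B = "fps_expansion (schur_inv a n) 0"
  have eq: "fps_nth (?F * (1 - fps_const (a n) * (fps_X * ?B))) k = fps_nth (fps_X * ?B - fps_const (cnj (a n))) k" for k
    by (simp only: schur_inv_fps_Suc)
  show 0: "schur_coeff (Suc n) 0 = - cnj (a n)"
    using eq[of 0] by (simp add: schur_coeff_def)
  have 1: "schur_coeff (Suc n) 1 = b 0 + schur_coeff (Suc n) 0 * a n * b 0"
    using eq[of 1] unfolding b_def schur_coeff_def
    by (simp add: fps_mult_nth fps_X_mult_nth eval_nat_numeral algebra_simps)
  then show 1: "schur_coeff (Suc n) 1 = \<rho> * b 0" 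
    unfolding 0 \<rho>_def by (simp add: algebra_simps)
  have 2: "schur_coeff (Suc n) 2 = b 1 + schur_coeff (Suc n) 0 * a n * b 1 + schur_coeff (Suc n) 1 * a n * b 0"
    using eq[of 2] unfolding b_def schur_coeff_def
    by (simp add: fps_mult_nth fps_X_mult_nth eval_nat_numeral algebra_simps)
  then show 2: "schur_coeff (Suc n) 2 = \<rho> * (b 1 + a n * b 0 * b 0)"
    unfolding 0 1 \<rho>_def by (simp add: algebra_simps)
  have 3: "schur_coeff (Suc n) 3 = b 2 + schur_coeff (Suc n) 0 * a n * b 2 
      + schur_coeff (Suc n) 1 * a n * b 1 + schur_coeff (Suc n) 2 * a n * b 0"
    using eq[of 3] unfolding b_def schur_coeff_def
    by (simp add: fps_mult_nth fps_X_mult_nth eval_nat_numeral algebra_simps)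
  then show "schur_coeff (Suc n) 3 = \<rho> * (b 2 + 2 * a n * b 0 * b 1 + a n * a n * b 0 * b 0 * b 0)"
    unfolding 0 1 2 \<rho>_def by (simp add: algebra_simps)
qed

lemma log_coeff_schur_coeff:
  fixes n
  defines "b \<equiv> schur_coeff n" and "x \<equiv> a n"
  shows "log_coeff n 1 = - x * b 0"
    and "log_coeff n 2 = - x * b 1 - x * x * b 0 * b 0 / 2"
    and "log_coeff n 3 = - x * b 2 - x * x * b 0 * b 1 - x * x * x * b 0 * b 0 * b 0 / 3"
    and "log_coeff n 4 = - x * b 3 - x * x * (b 1 * b 1 + 2 * b 0 * b 2) / 2 
           - x * x * x * b 0 * b 0 * b 1 - x * x * x * x * b 0 * b 0 * b 0 * b 0 / 4"
proof -
  let ?L = "fps_expansion (log_factor n) 0" and ?B = "fps_expansion (schur_inv a n) 0"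
  let ?U = "fps_const (a n) * (fps_X * ?B)"
  have eq: "fps_nth (fps_deriv ?L * (1 - ?U)) k = fps_nth (- fps_deriv ?U) k" for k
    by (simp only: log_factor_fps_deriv)
  show 1: "log_coeff n 1 = - x * b 0"
    using eq[of 0] by (simp add: log_coeff_eq b_def schur_coeff_def x_def)
  have 2: "2 * log_coeff n 2 = log_coeff n 1 * x * b 0 - 2 * x * b 1"
    using eq[of 1] unfolding b_def schur_coeff_def log_coeff_eq x_def
    by (simp add: fps_mult_nth fps_X_mult_nth eval_nat_numeral algebra_simps)
  have "2 * log_coeff n 2 = 2 * (- x * b 1 - x * x * b 0 * b 0 / 2)"
    unfolding 2 1 by (simp add: field_simps)
  then show 2: "log_coeff n 2 = - x * b 1 - x * x * b 0 * b 0 / 2"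
    by (metis mult_left_cancel zero_neq_numeral)
  have 3: "3 * log_coeff n 3 = 2 * log_coeff n 2 * x * b 0 + log_coeff n 1 * x * b 1 - 3 * x * b 2"
    using eq[of 2] unfolding b_def schur_coeff_def log_coeff_eq x_def
    by (simp add: fps_mult_nth fps_X_mult_nth eval_nat_numeral algebra_simps)
  have "3 * log_coeff n 3 = 3 * (- x * b 2 - x * x * b 0 * b 1 - x * x * x * b 0 * b 0 * b 0 / 3)"
    unfolding 3 1 2 by (simp add: field_simps)
  then show 3: "log_coeff n 3 = - x * b 2 - x * x * b 0 * b 1 - x * x * x * b 0 * b 0 * b 0 / 3"
    by (metis mult_left_cancel zero_neq_numeral)
  have 4: "4 * log_coeff n 4 = 3 * log_coeff n 3 * x * b 0 + 2 * log_coeff n 2 * x * b 1 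
      + log_coeff n 1 * x * b 2 - 4 * x * b 3"
    using eq[of 3] unfolding b_def schur_coeff_def log_coeff_eq x_def
    by (simp add: fps_mult_nth fps_X_mult_nth eval_nat_numeral algebra_simps)
  have "4 * log_coeff n 4 = 4 * (- x * b 3 - x * x * (b 1 * b 1 + 2 * b 0 * b 2) / 2 
           - x * x * x * b 0 * b 0 * b 1 - x * x * x * x * b 0 * b 0 * b 0 * b 0 / 4)"
    unfolding 4 1 2 3 by (simp add: field_simps)
  then show "log_coeff n 4 = - x * b 3 - x * x * (b 1 * b 1 + 2 * b 0 * b 2) / 2 
           - x * x * x * b 0 * b 0 * b 1 - x * x * x * x * b 0 * b 0 * b 0 * b 0 / 4"
    by (metis mult_left_cancel zero_neq_numeral)
qed

text \<open>Each step back along \<open>schur_coeff_Suc\<close> needs one Taylor coefficient fewer,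
  so four steps end at the constant term \<open>- cnj (a n)\<close>. The initial value
  \<open>schur_inv a 0 = 1\<close> is not reached, which is the reason for the offset 4.\<close>

lemma log_coeff_local:
  "log_coeff (n + 4) 1 = lc1 (a (n+4)) (a (n+3))"
  "log_coeff (n + 4) 2 = lc2 (a (n+4)) (a (n+3)) (a (n+2))"
  "log_coeff (n + 4) 3 = lc3 (a (n+4)) (a (n+3)) (a (n+2)) (a (n+1))"
  "log_coeff (n + 4) 4 = lc4 (a (n+4)) (a (n+3)) (a (n+2)) (a (n+1)) (a n)"
proof -
  have n: "n + 4 = Suc (n + 3)" "n + 3 = Suc (n + 2)" "n + 2 = Suc (n + 1)" "n + 1 = Suc n" by simp_all
  note b1 = schur_coeff_Suc(1)[of n, folded n]
  note b2 = schur_coeff_Suc(1,2)[of "n + 1", folded n, unfolded b1]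
  note b3 = schur_coeff_Suc(1,2,3)[of "n + 2", folded n, unfolded b2]
  note b4 = schur_coeff_Suc[of "n + 3", folded n, unfolded b3]
  show "log_coeff (n + 4) 1 = lc1 (a (n+4)) (a (n+3))"
    unfolding log_coeff_schur_coeff b4 lc1_def by simp
  show "log_coeff (n + 4) 2 = lc2 (a (n+4)) (a (n+3)) (a (n+2))"
    unfolding log_coeff_schur_coeff b4 lc2_def by (simp add: field_simps)
  show "log_coeff (n + 4) 3 = lc3 (a (n+4)) (a (n+3)) (a (n+2)) (a (n+1))"
    unfolding log_coeff_schur_coeff b4 lc3_def lc3_rem_def by (simp add: field_simps)
  show "log_coeff (n + 4) 4 = lc4 (a (n+4)) (a (n+3)) (a (n+2)) (a (n+1)) (a n)"
    unfolding log_coeff_schur_coeff b4 lc4_def lc4_rem_def by (simp add: field_simps)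
qed

text \<open>The weight 70 is absent because every logarithmic factor vanishes at 0. It returns only
  through the normalisation of the polynomials.\<close>

lemma integral_ln_szego:
  "integral\<^sup>L angle_measure (\<lambda>\<theta>. (1 - cos \<theta>) ^ 4 * ln ((cmod (poly (szego a N) (cis \<theta>)))\<^sup>2))
   = (\<Sum>n<N. Re (- 112 * log_coeff n 1 + 56 * log_coeff n 2 - 16 * log_coeff n 3 + 2 * log_coeff n 4)) / 16"
proof -
  let ?f = "\<lambda>n \<theta>. (1 - cos \<theta>) ^ 4 * Re (log_factor n (cis \<theta>))"
  have i: "integrable angle_measure (?f n)" for n
  proof -
    have c: "continuous_on (sphere 0 1) (log_factor n)"
      using log_factor_continuous by (rule continuous_on_subset) auto
    have "integrable angle_measure (\<lambda>\<theta>. (1 - Re (cis \<theta>)) ^ 4 * Re (log_factor n (cis \<theta>)))"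
      by (rule integrable_angle_comp_cis[of "\<lambda>z. (1 - Re z) ^ 4 * Re (log_factor n z)"])
         (intro continuous_intros c)
    then show ?thesis by simp
  qed
  have "integral\<^sup>L angle_measure (\<lambda>\<theta>. (1 - cos \<theta>) ^ 4 * ln ((cmod (poly (szego a N) (cis \<theta>)))\<^sup>2))
     = integral\<^sup>L angle_measure (\<lambda>\<theta>. \<Sum>n<N. 2 * ?f n \<theta>)"
    by (simp add: ln_cmod_szego_sum sum_distrib_left mult_ac)
  also have "\<dots> = (\<Sum>n<N. 2 * integral\<^sup>L angle_measure (?f n))"
    by (subst Bochner_Integration.integral_sum) (auto intro!: integrable_mult_right i)
  also have "\<dots> = (\<Sum>n<N. 2 * (Re (70 * log_coeff n 0 - 56 * log_coeff n 1 + 28 * log_coeff n 2 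
       - 8 * log_coeff n 3 + log_coeff n 4) / 16))"
    unfolding log_coeff_def
    by (intro sum.cong refl arg_cong[where f = "(*) 2"] angle_weighted_Re 
          log_factor_continuous log_factor_holomorphic)
  also have "\<dots> = (\<Sum>n<N. Re (- 112 * log_coeff n 1 + 56 * log_coeff n 2 - 16 * log_coeff n 3 + 2 * log_coeff n 4)) / 16"
    unfolding sum_divide_distrib by (intro sum.cong refl) (simp add: log_coeff_0 field_simps)
  finally show ?thesis .
qed

text \<open>The bounded quantity is, up to a bounded error, minus a partial sum of the squared
  fourth differences. Since these are nonnegative, bounded partial sums mean summability.\<close>

lemma szego_entropy_bdd_below_iff:
  assumes "in_ell 6 a" "in_ell 3 (shift_minus_id a)"
  shows "(\<exists>M. \<forall>N. M \<le> 70 * (\<Sum>n<N. ln (1 - (cmod (a n))\<^sup>2)) 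
      - 16 * integral\<^sup>L angle_measure (\<lambda>\<theta>. (1 - cos \<theta>) ^ 4 * ln ((cmod (poly (szego a N) (cis \<theta>)))\<^sup>2)))
    \<longleftrightarrow> in_ell 2 ((shift_minus_id ^^ 4) a)"
proof -
  define t where "t n = 70 * ln (1 - (cmod (a n))\<^sup>2) 
    + Re (112 * log_coeff n 1 - 56 * log_coeff n 2 + 16 * log_coeff n 3 - 2 * log_coeff n 4)" for n
  define D where "D n = (cmod ((shift_minus_id ^^ 4) a n))\<^sup>2" for n
  have eq: "70 * (\<Sum>n<N. ln (1 - (cmod (a n))\<^sup>2)) 
      - 16 * integral\<^sup>L angle_measure (\<lambda>\<theta>. (1 - cos \<theta>) ^ 4 * ln ((cmod (poly (szego a N) (cis \<theta>)))\<^sup>2))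
      = (\<Sum>n<N. t n)" for N
    unfolding integral_ln_szego t_def sum_distrib_left by (simp add: sum_subtractf[symmetric] algebra_simps)
  have t: "t (n + 4) = local_entropy (a (n+4)) (a (n+3)) (a (n+2)) (a (n+1)) (a n)" for n
    unfolding t_def log_coeff_local local_entropy_def ..
  have "bdd_sums (\<lambda>n. t (n + 4) + D n)"
    unfolding t D_def using a1 assms by (intro bdd_sums_local_entropy) (auto intro: less_imp_le)
  then obtain C where C: "\<And>N. \<bar>\<Sum>n<N. t (n + 4) + D n\<bar> \<le> C" unfolding bdd_sums_def by blast
  \<comment> \<open>The first four terms are set apart because the local formula only starts at
    index 4.\<close>
  have split: "(\<Sum>n<N + 4. t n) = (\<Sum>n<4. t n) + (\<Sum>n<N. t (n + 4))" for N
  proof (induction N)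
    case (Suc N)
    have "(\<Sum>n<Suc N + 4. t n) = (\<Sum>n<N + 4. t n) + t (N + 4)" by (simp only: add_Suc sum.lessThan_Suc)
    then show ?case using Suc by simp
  qed simp
  have "(\<exists>M. \<forall>N. M \<le> (\<Sum>n<N. t n)) \<longleftrightarrow> summable D"
  proof
    assume "\<exists>M. \<forall>N. M \<le> (\<Sum>n<N. t n)"
    then obtain M where M: "\<And>N. M \<le> (\<Sum>n<N. t n)" by blast
    show "summable D"
    proof (rule summableI_nonneg_bounded)
      show "0 \<le> D n" for n by (simp add: D_def)
      show "(\<Sum>n<N. D n) \<le> C - M + (\<Sum>n<4. t n)" for N
        using C[of N] M[of "N + 4"] unfolding split sum.distrib by linarith
    qed
  next
    assume D: "summable D"
    \<comment> \<open>The inner minimum handles the partial sums with fewer than four terms.\<close>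
    define M where "M = min (Min ((\<lambda>N. \<Sum>n<N. t n) ` {..<4})) ((\<Sum>n<4. t n) - C - suminf D)"
    have "M \<le> (\<Sum>n<N. t n)" for N
    proof (cases "N < 4")
      case True
      then have "Min ((\<lambda>N. \<Sum>n<N. t n) ` {..<4}) \<le> (\<Sum>n<N. t n)" by (intro Min_le) auto
      then show ?thesis by (simp add: M_def)
    next
      case False
      then obtain K where K: "N = K + 4" by (metis add.commute le_Suc_ex not_less)
      have "(\<Sum>n<K. D n) \<le> suminf D" by (rule sum_le_suminf[OF D]) (auto simp: D_def)
      then have "(\<Sum>n<4. t n) - C - suminf D \<le> (\<Sum>n<N. t n)"
        using C[of K] unfolding K split sum.distrib by linarith
      then show ?thesis by (simp add: M_def)
    qed
    then show "\<exists>M. \<forall>N. M \<le> (\<Sum>n<N. t n)" by blast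
  qed
  then show ?thesis unfolding eq in_ell_def D_def .
qed

end

section \<open>Orthogonal polynomials of a measure on the circle\<close>

text \<open>General enough for both \<mu> and the Bernstein--Szego measures, whose total mass is
  itself computed with the lemmas proved here.\<close>

locale circle_measure = finite_measure M for M :: "complex measure" +
  assumes sets_M [measurable_cong]: "sets M = sets borel"
    and AE_circle: "AE z in M. cmod z = 1"
begin

lemma measurable_continuous:
  fixes f :: "complex \<Rightarrow> 'b::euclidean_space"
  assumes "continuous_on UNIV f" shows "f \<in> borel_measurable M"
proof -
  have "f \<in> borel_measurable borel" using assms by (rule borel_measurable_continuous_onI)
  then show ?thesis using measurable_cong_sets[OF sets_M refl] by blast
qed

lemma integrable_continuous:
  fixes f :: "complex \<Rightarrow> 'b::euclidean_space"
  assumes "continuous_on UNIV f" shows "integrable M f"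
proof -
  have "compact (f ` sphere 0 1)"
    using assms by (intro compact_continuous_image continuous_on_subset[OF assms]) auto
  then obtain B where B: "\<And>z. z \<in> sphere 0 1 \<Longrightarrow> norm (f z) \<le> B"
    using compact_imp_bounded bounded_iff by (metis imageI)
  have "AE z in M. norm (f z) \<le> B" using AE_circle by eventually_elim (use B in auto)
  then show ?thesis using measurable_continuous[OF assms] by (rule integrable_const_bound)
qed

lemma integral_circle_cong:
  fixes f g :: "complex \<Rightarrow> 'b::euclidean_space"
  assumes "continuous_on UNIV f" "continuous_on UNIV g" "\<And>z. cmod z = 1 \<Longrightarrow> f z = g z"
  shows "integral\<^sup>L M f = integral\<^sup>L M g"
  using AE_circle assms(3)
  by (intro integral_cong_AE measurable_continuous assms(1,2)) (auto elim: eventually_mono)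

end

section \<open>Orthogonality and the Szego recursion\<close>

lemma cnj_power_mult_power:
  assumes "cmod z = 1" "k \<le> n" shows "cnj (z ^ k) * z ^ n = z ^ (n - k)"
proof -
  have "cnj (z ^ k) * z ^ k = 1"
    using assms(1) by (metis complex_norm_square mult.commute norm_power of_real_1 power_one)
  moreover have "z ^ n = z ^ k * z ^ (n - k)" using assms(2) by (metis le_add_diff_inverse power_add)
  ultimately show ?thesis by (simp add: mult.assoc[symmetric])
qed

lemma cnj_power_mult_Suc:
  assumes "cmod z = 1" shows "cnj (z ^ Suc k) * (z * w) = cnj (z ^ k) * w"
proof -
  have "cnj z * z = 1"
    using assms(1) by (metis complex_norm_square mult.commute of_real_1 power_one)
  then have "cnj (z ^ k) * (cnj z * z) * w = cnj (z ^ k) * w" by simp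
  then show ?thesis by (simp add: mult_ac)
qed

lemma cnj_poly_le:
  assumes "degree p \<le> n" shows "cnj (poly p z) = (\<Sum>k\<le>n. cnj (coeff p k) * cnj (z ^ k))"
proof -
  have "poly p z = (\<Sum>k\<le>n. coeff p k * z ^ k)"
    unfolding poly_altdef using assms by (intro sum.mono_neutral_left) (auto simp: coeff_eq_0)
  then show ?thesis by simp
qed

definition (in circle_measure) orthogonal_below :: "nat \<Rightarrow> complex poly \<Rightarrow> bool" where
  "orthogonal_below n p \<longleftrightarrow> (\<forall>k<n. integral\<^sup>L M (\<lambda>z. cnj (z ^ k) * poly p z) = 0)"

context circle_measure begin

text \<open>Reversal on the circle turns orthogonality to 1, ..., z^(n-1) into orthogonality to z,
  ..., z^n.\<close>

lemma integral_szego_rev_moment: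
  assumes "orthogonal_below n (szego a n)" "0 < k" "k \<le> n"
  shows "integral\<^sup>L M (\<lambda>z. cnj (z ^ k) * poly (szego_rev a n) z) = 0"
proof -
  have "integral\<^sup>L M (\<lambda>z. cnj (z ^ k) * poly (szego_rev a n) z) 
      = integral\<^sup>L M (\<lambda>z. cnj (cnj (z ^ (n - k)) * poly (szego a n) z))"
  proof (rule integral_circle_cong)
    fix z :: complex assume z: "cmod z = 1"
    show "cnj (z ^ k) * poly (szego_rev a n) z = cnj (cnj (z ^ (n - k)) * poly (szego a n) z)"
      using cnj_power_mult_power[OF z assms(3)]
      by (simp add: szego_rev_circle[OF z] mult.assoc[symmetric])
  qed (intro continuous_intros)+
  also have "\<dots> = cnj (integral\<^sup>L M (\<lambda>z. cnj (z ^ (n - k)) * poly (szego a n) z))"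
    by (rule Bochner_Integration.integral_cnj)
  also have "integral\<^sup>L M (\<lambda>z. cnj (z ^ (n - k)) * poly (szego a n) z) = 0"
    using assms unfolding orthogonal_below_def by simp
  finally show ?thesis by simp
qed

lemma integral_shift_moment:
  "integral\<^sup>L M (\<lambda>z. cnj (z ^ Suc k) * (z * poly p z)) = integral\<^sup>L M (\<lambda>z. cnj (z ^ k) * poly p z)"
  by (rule integral_circle_cong) (intro continuous_intros cnj_power_mult_Suc | assumption)+

text \<open>When the conjugate factor of |p|^2 is expanded in powers, orthogonality leaves only its
  leading term.\<close>

lemma integral_szego_rev_eq_norm:
  assumes "orthogonal_below n p" "degree p = n" "lead_coeff p = 1" "integral\<^sup>L M (poly q) = integral\<^sup>L M (\<lambda>z. z ^ n * cnj (poly p z))"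
  shows "integral\<^sup>L M (poly q) = of_real (integral\<^sup>L M (\<lambda>z. (cmod (poly p z))\<^sup>2))"
proof -
  have i: "integrable M (\<lambda>z. cnj (z ^ k) * poly p z)" for k
    by (intro integrable_continuous continuous_intros)
  have "of_real (integral\<^sup>L M (\<lambda>z. (cmod (poly p z))\<^sup>2)) = integral\<^sup>L M (\<lambda>z. cnj (poly p z) * poly p z)"
    unfolding integral_complex_of_real[symmetric] by (simp only: complex_norm_square mult.commute)
  also have "\<dots> = integral\<^sup>L M (\<lambda>z. \<Sum>k\<le>n. cnj (coeff p k) * (cnj (z ^ k) * poly p z))"
  proof (intro Bochner_Integration.integral_cong refl)
    fix z
    show "cnj (poly p z) * poly p z = (\<Sum>k\<le>n. cnj (coeff p k) * (cnj (z ^ k) * poly p z))"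
      unfolding cnj_poly_le[OF eq_refl[OF assms(2)]] by (simp only: sum_distrib_right mult.assoc)
  qed
  also have "\<dots> = (\<Sum>k\<le>n. cnj (coeff p k) * integral\<^sup>L M (\<lambda>z. cnj (z ^ k) * poly p z))"
    by (subst Bochner_Integration.integral_sum) (auto intro!: integrable_mult_right i simp del: complex_cnj_power)
  also have "\<dots> = (\<Sum>k\<le>n. if k = n then integral\<^sup>L M (\<lambda>z. cnj (z ^ n) * poly p z) else 0)"
    using assms(1-3) unfolding orthogonal_below_def by (intro sum.cong refl) auto
  also have "\<dots> = integral\<^sup>L M (\<lambda>z. cnj (z ^ n) * poly p z)" by simp
  finally have *: "integral\<^sup>L M (\<lambda>z. cnj (z ^ n) * poly p z) = of_real (integral\<^sup>L M (\<lambda>z. (cmod (poly p z))\<^sup>2))" ..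
  have "integral\<^sup>L M (\<lambda>z. z ^ n * cnj (poly p z)) = cnj (integral\<^sup>L M (\<lambda>z. cnj (z ^ n) * poly p z))"
    unfolding Bochner_Integration.integral_cnj[symmetric] by simp
  then show ?thesis unfolding assms(4) * by simp
qed

lemma integral_szego_rev:
  assumes "orthogonal_below n (szego a n)"
  shows "integral\<^sup>L M (poly (szego_rev a n)) = of_real (integral\<^sup>L M (\<lambda>z. (cmod (poly (szego a n) z))\<^sup>2))"
  by (rule integral_szego_rev_eq_norm[OF assms])
     (auto intro!: integral_circle_cong continuous_intros szego_rev_circle)

lemma integral_szego_rev_Suc:
  assumes "integral\<^sup>L M (poly (szego a (Suc n))) = 0"
  shows "integral\<^sup>L M (poly (szego_rev a (Suc n))) = of_real (1 - (cmod (a n))\<^sup>2) * integral\<^sup>L M (poly (szego_rev a n))"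
proof -
  have i: "integrable M (\<lambda>z. z * poly (szego a n) z)" "integrable M (poly (szego_rev a n))"
    by (intro integrable_continuous continuous_intros)+
  have "integral\<^sup>L M (poly (szego a (Suc n))) = integral\<^sup>L M (\<lambda>z. z * poly (szego a n) z) - cnj (a n) * integral\<^sup>L M (poly (szego_rev a n))"
    unfolding poly_szego_Suc[abs_def] using i by simp
  then have "integral\<^sup>L M (\<lambda>z. z * poly (szego a n) z) = cnj (a n) * integral\<^sup>L M (poly (szego_rev a n))"
    using assms by simp
  moreover have "integral\<^sup>L M (poly (szego_rev a (Suc n))) = integral\<^sup>L M (poly (szego_rev a n)) - a n * integral\<^sup>L M (\<lambda>z. z * poly (szego a n) z)"
    unfolding poly_szego_rev_Suc[abs_def] using i by simp
  ultimately show ?thesis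
    using complex_norm_square[of "a n"] by (simp add: algebra_simps)
qed

text \<open>Orthogonality to constants at every stage lets the two rows of the recursion eliminate
  the integral of z times the polynomial; each stage multiplies by 1 - |a_j|^2.\<close>

lemma integral_szego_rev_prod:
  assumes "\<And>m. 0 < m \<Longrightarrow> m \<le> n \<Longrightarrow> integral\<^sup>L M (poly (szego a m)) = 0"
  shows "integral\<^sup>L M (poly (szego_rev a n)) = of_real (\<Prod>j<n. 1 - (cmod (a j))\<^sup>2) * integral\<^sup>L M (\<lambda>z. 1)"
  using assms
proof (induction n)
  case (Suc n)
  then show ?case using integral_szego_rev_Suc[OF Suc.prems[of "Suc n"]] by simp
qed (simp add: poly_1[abs_def])

text \<open>The polynomials depend on \<open>a\<close> alone and are monic, so a vanishing integral
  of the m-th one determines the m-th moment by the lower moments, in the same way for both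
  measures.\<close>

lemma integral_monomial_unique:
  assumes N: "circle_measure N" and "integral\<^sup>L M (\<lambda>z. 1::complex) = integral\<^sup>L N (\<lambda>z. 1)"
    and "\<And>m. 0 < m \<Longrightarrow> m \<le> n \<Longrightarrow> integral\<^sup>L M (poly (szego a m)) = 0"
    and "\<And>m. 0 < m \<Longrightarrow> m \<le> n \<Longrightarrow> integral\<^sup>L N (poly (szego a m)) = 0"
    and "m \<le> n"
  shows "integral\<^sup>L M (\<lambda>z. z ^ m) = integral\<^sup>L N (\<lambda>z. z ^ m)"
  using assms(5)
proof (induction m rule: less_induct)
  case (less m)
  interpret N: circle_measure N by (rule N)
  show ?case
  proof (cases "m = 0")
    case True
    then show ?thesis using assms(2) by simp
  next
    case False
    have p: "poly (szego a m) z = (\<Sum>k<m. coeff (szego a m) k * z ^ k) + z ^ m" for z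
      unfolding poly_altdef degree_szego by (simp add: lessThan_Suc_atMost[symmetric])
    have "integral\<^sup>L L (poly (szego a m)) = (\<Sum>k<m. coeff (szego a m) k * integral\<^sup>L L (\<lambda>z. z ^ k)) + integral\<^sup>L L (\<lambda>z. z ^ m)"
      if "circle_measure L" for L
    proof -
      interpret L: circle_measure L by (rule that)
      have i: "integrable L (\<lambda>z. z ^ k)" for k by (intro L.integrable_continuous continuous_intros)
      show ?thesis unfolding p[abs_def]
        by (subst Bochner_Integration.integral_add Bochner_Integration.integral_sum; (intro Bochner_Integration.integrable_sum)?; simp add: i)+
    qed
    from this[OF N] this[of M] have 
      "integral\<^sup>L M (\<lambda>z. z ^ m) = - (\<Sum>k<m. coeff (szego a m) k * integral\<^sup>L M (\<lambda>z. z ^ k))"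
      "integral\<^sup>L N (\<lambda>z. z ^ m) = - (\<Sum>k<m. coeff (szego a m) k * integral\<^sup>L N (\<lambda>z. z ^ k))"
      using assms(3,4)[of m] False less.prems circle_measure_axioms
      by (simp_all add: add_eq_0_iff)
    moreover have "(\<Sum>k<m. coeff (szego a m) k * integral\<^sup>L M (\<lambda>z. z ^ k)) = (\<Sum>k<m. coeff (szego a m) k * integral\<^sup>L N (\<lambda>z. z ^ k))"
      using less by (intro sum.cong refl) auto
    ultimately show ?thesis by simp
  qed
qed

lemma integral_cnj_power_mult_power_unique:
  assumes N: "circle_measure N" and "integral\<^sup>L M (\<lambda>z. 1::complex) = integral\<^sup>L N (\<lambda>z. 1)"
    and "\<And>m. 0 < m \<Longrightarrow> m \<le> n \<Longrightarrow> integral\<^sup>L M (poly (szego a m)) = 0"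
    and "\<And>m. 0 < m \<Longrightarrow> m \<le> n \<Longrightarrow> integral\<^sup>L N (poly (szego a m)) = 0"
    and "k \<le> n" "l \<le> n"
  shows "integral\<^sup>L M (\<lambda>z. cnj (z ^ k) * z ^ l) = integral\<^sup>L N (\<lambda>z. cnj (z ^ k) * z ^ l)"
proof -
  interpret N: circle_measure N by (rule N)
  note mono = integral_monomial_unique[OF assms(1-4)]
  show ?thesis
  proof (cases "k \<le> l")
    case True
    have "integral\<^sup>L L (\<lambda>z. cnj (z ^ k) * z ^ l) = integral\<^sup>L L (\<lambda>z. z ^ (l - k))" if "circle_measure L" for L
      by (rule circle_measure.integral_circle_cong[OF that]) 
         (intro continuous_intros cnj_power_mult_power True | assumption)+
    then show ?thesis using mono[of "l - k"] assms(6) N circle_measure_axioms by simp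
  next
    case False
    have "integral\<^sup>L L (\<lambda>z. cnj (z ^ k) * z ^ l) = cnj (integral\<^sup>L L (\<lambda>z. z ^ (k - l)))" if "circle_measure L" for L
    proof -
      have "integral\<^sup>L L (\<lambda>z. cnj (z ^ k) * z ^ l) = integral\<^sup>L L (\<lambda>z. cnj (z ^ (k - l)))"
      proof (rule circle_measure.integral_circle_cong[OF that])
        fix z :: complex assume "cmod z = 1"
        from cnj_power_mult_power[OF this, of l k] False
        have "cnj (cnj (z ^ l) * z ^ k) = cnj (z ^ (k - l))" by simp
        then show "cnj (z ^ k) * z ^ l = cnj (z ^ (k - l))" by (simp add: mult.commute)
      qed (intro continuous_intros)+
      then show ?thesis unfolding Bochner_Integration.integral_cnj .
    qed
    then show ?thesis using mono[of "k - l"] assms(5) N circle_measure_axioms by simp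
  qed
qed

end

section \<open>Verblunsky coefficients of a nontrivial probability measure\<close>

locale circle_prob = prob_space M + circle_measure M for M :: "complex measure" +
  assumes infinite_msupport: "infinite (msupport M)"
begin

text \<open>If the integral vanished, the support would lie in the finite zero set of
  \<open>p\<close>. Infinite support enters the proof here.\<close>

lemma integral_cmod_poly_pos:
  assumes "p \<noteq> 0" shows "0 < integral\<^sup>L M (\<lambda>z. (cmod (poly p z))\<^sup>2)"
proof (rule ccontr)
  have i: "integrable M (\<lambda>z. (cmod (poly p z))\<^sup>2)"
    by (intro integrable_continuous continuous_intros)
  assume "\<not> 0 < integral\<^sup>L M (\<lambda>z. (cmod (poly p z))\<^sup>2)"
  moreover have "0 \<le> integral\<^sup>L M (\<lambda>z. (cmod (poly p z))\<^sup>2)"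
    by (intro integral_nonneg_AE AE_I2) simp
  ultimately have "integral\<^sup>L M (\<lambda>z. (cmod (poly p z))\<^sup>2) = 0" by linarith
  then have "AE z in M. (cmod (poly p z))\<^sup>2 = 0"
    using integral_nonneg_eq_0_iff_AE[OF i] by simp
  then have ae: "AE z in M. poly p z = 0" by simp
  have "msupport M \<subseteq> {z. poly p z = 0}"
  proof (rule subsetI, rule ccontr)
    fix z assume z: "z \<in> msupport M" "z \<notin> {z. poly p z = 0}"
    have o: "open (- {z. poly p z = 0})" using poly_roots_finite[OF assms] by (simp add: finite_imp_closed open_Compl)
    then have "emeasure M (- {z. poly p z = 0}) > 0" using z unfolding msupport_def by blast
    moreover have "emeasure M (- {z. poly p z = 0}) = 0"
    proof -
      have "emeasure M {z \<in> space M. poly p z \<noteq> 0} = 0"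
        by (rule emeasure_eq_0_AE) (use ae in simp)
      then show ?thesis using sets_eq_imp_space_eq[OF sets_M] by (simp add: Compl_eq)
    qed
    ultimately show False by simp
  qed
  then show False using infinite_msupport poly_roots_finite[OF assms] finite_subset by blast
qed

text \<open>The difference of two candidates has degree below n and is orthogonal to all powers
  below n, hence to itself. This resolves the definite description.\<close>

lemma monic_OP_eqI:
  assumes "degree p = n" "lead_coeff p = 1" "orthogonal_below n p"
  shows "monic_OP M n = p"
  unfolding monic_OP_def
proof (rule the_equality)
  show "degree p = n \<and> lead_coeff p = 1 \<and> (\<forall>k<n. integral\<^sup>L M (\<lambda>z. cnj (z ^ k) * poly p z) = 0)"
    using assms by (simp add: orthogonal_below_def)
  fix q assume q: "degree q = n \<and> lead_coeff q = 1 \<and> (\<forall>k<n. integral\<^sup>L M (\<lambda>z. cnj (z ^ k) * poly q z) = 0)"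
  let ?r = "q - p"
  have r0: "coeff ?r n = 0" using q assms by auto
  have rd: "degree ?r \<le> n" using q assms by (simp add: degree_diff_le)
  have orth: "integral\<^sup>L M (\<lambda>z. cnj (z ^ k) * poly ?r z) = 0" if "k < n" for k
  proof -
    have "integral\<^sup>L M (\<lambda>z. cnj (z ^ k) * poly q z - cnj (z ^ k) * poly p z) = 0"
      using q assms that unfolding orthogonal_below_def
      by (subst Bochner_Integration.integral_diff) (auto intro!: integrable_continuous continuous_intros)
    then show ?thesis by (simp add: algebra_simps)
  qed
  have "of_real (integral\<^sup>L M (\<lambda>z. (cmod (poly ?r z))\<^sup>2)) = integral\<^sup>L M (\<lambda>z. cnj (poly ?r z) * poly ?r z)"
    unfolding integral_complex_of_real[symmetric] by (simp only: complex_norm_square mult.commute)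
  also have "\<dots> = integral\<^sup>L M (\<lambda>z. \<Sum>k\<le>n. cnj (coeff ?r k) * (cnj (z ^ k) * poly ?r z))"
  proof (intro Bochner_Integration.integral_cong refl)
    fix z
    show "cnj (poly ?r z) * poly ?r z = (\<Sum>k\<le>n. cnj (coeff ?r k) * (cnj (z ^ k) * poly ?r z))"
      unfolding cnj_poly_le[OF rd] by (simp only: sum_distrib_right mult.assoc)
  qed
  also have "\<dots> = (\<Sum>k\<le>n. cnj (coeff ?r k) * integral\<^sup>L M (\<lambda>z. cnj (z ^ k) * poly ?r z))"
    by (subst Bochner_Integration.integral_sum) 
       (auto intro!: integrable_mult_right integrable_continuous continuous_intros simp del: poly_diff)
  also have "\<dots> = 0" using orth r0 by (intro sum.neutral) (metis le_neq_implies_less atMost_iff complex_cnj_zero mult_zero_left mult_zero_right)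
  finally have "?r = 0" using integral_cmod_poly_pos[of ?r] by auto
  then show "q = p" by simp
qed

text \<open>The next orthogonal polynomial is built with a free parameter c; comparing its value at
  0 with the definition of \<open>verblunsky\<close> identifies c as the conjugate of
  \<open>a n\<close>.\<close>

lemma verblunsky_recursion:
  assumes "\<And>n. a n = verblunsky M n"
  shows "orthogonal_below n (szego a n)"
proof (induction n)
  case (Suc n)
  \<comment> \<open>Chosen to make \<open>p\<close> orthogonal to constants; orthogonality to the
    higher powers holds for every c.\<close>
  define c where "c = integral\<^sup>L M (\<lambda>z. z * poly (szego a n) z) / integral\<^sup>L M (poly (szego_rev a n))"
  define p where "p = pCons 0 (szego a n) - smult c (szego_rev a n)"
  have pp: "poly p z = z * poly (szego a n) z - c * poly (szego_rev a n) z" for z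
    by (simp add: p_def)
  have "szego a n \<noteq> 0" using lead_coeff_szego[of a n] by (auto simp del: lead_coeff_szego)
  then have nz: "integral\<^sup>L M (poly (szego_rev a n)) \<noteq> 0"
    using integral_cmod_poly_pos[of "szego a n"] integral_szego_rev[OF Suc] by simp
  have "orthogonal_below (Suc n) p" unfolding orthogonal_below_def
  proof (intro allI impI)
    fix k assume k: "k < Suc n"
    have "integral\<^sup>L M (\<lambda>z. cnj (z ^ k) * poly p z) = 
       integral\<^sup>L M (\<lambda>z. cnj (z ^ k) * (z * poly (szego a n) z)) - c * integral\<^sup>L M (\<lambda>z. cnj (z ^ k) * poly (szego_rev a n) z)"
    proof -
      have "integral\<^sup>L M (\<lambda>z. cnj (z ^ k) * poly p z) = 
        integral\<^sup>L M (\<lambda>z. cnj (z ^ k) * (z * poly (szego a n) z) - c * (cnj (z ^ k) * poly (szego_rev a n) z))"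
        unfolding pp by (simp only: right_diff_distrib mult.left_commute)
      also have "\<dots> = integral\<^sup>L M (\<lambda>z. cnj (z ^ k) * (z * poly (szego a n) z)) - c * integral\<^sup>L M (\<lambda>z. cnj (z ^ k) * poly (szego_rev a n) z)"
        unfolding integral_mult_right_zero[symmetric]
        by (rule Bochner_Integration.integral_diff) (intro integrable_continuous continuous_intros)+
      finally show ?thesis .
    qed
    also have "\<dots> = 0"
    proof (cases k)
      case 0
      then show ?thesis using nz by (simp add: c_def)
    next
      case (Suc j)
      then show ?thesis
        using k integral_shift_moment[of j "szego a n"] integral_szego_rev_moment[OF \<open>orthogonal_below n (szego a n)\<close>, of k]
          \<open>orthogonal_below n (szego a n)\<close> unfolding orthogonal_below_def by simp
    qed
    finally show "integral\<^sup>L M (\<lambda>z. cnj (z ^ k) * poly p z) = 0" .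
  qed
  \<comment> \<open>Changing one entry exhibits \<open>p\<close> as a Szego polynomial before
    \<open>a n\<close> is known, which supplies its degree and leading coefficient.\<close>
  define a' where "a' = a(n := cnj c)"
  have eqm: "szego_pair a' m = szego_pair a m" if "m \<le> n" for m
    using that by (induction m) (auto simp: a'_def)
  have "szego a' n = szego a n" "szego_rev a' n = szego_rev a n"
    by (simp_all add: szego_def szego_rev_def eqm)
  then have p: "p = szego a' (Suc n)"
    unfolding p_def szego_Suc by (simp add: a'_def)
  have "monic_OP M (Suc n) = p"
    by (rule monic_OP_eqI) (use \<open>orthogonal_below (Suc n) p\<close> in \<open>simp_all add: p\<close>)
  then have "a n = - cnj (poly p 0)" using assms[of n] by (simp add: verblunsky_def)
  also have "\<dots> = cnj c" unfolding p poly_szego_Suc_0 by (simp add: a'_def)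
  finally have "a n = cnj c" .
  then have "szego a (Suc n) = p" by (simp add: p_def szego_Suc)
  then show ?case using \<open>orthogonal_below (Suc n) p\<close> by simp
qed (simp add: orthogonal_below_def)

lemma integral_one: "integral\<^sup>L M (\<lambda>z. 1 :: complex) = 1"
  using prob_space by simp

lemma verblunsky_norm:
  assumes "\<And>n. a n = verblunsky M n"
  shows "cmod (a n) < 1"
    and "integral\<^sup>L M (\<lambda>z. (cmod (poly (szego a n) z))\<^sup>2) = (\<Prod>j<n. 1 - (cmod (a j))\<^sup>2)"
    and "0 < m \<Longrightarrow> integral\<^sup>L M (poly (szego a m)) = 0"
proof -
  note orth = verblunsky_recursion[OF assms]
  show m: "integral\<^sup>L M (poly (szego a m)) = 0" if "0 < m" for m
    using orth[of m] that unfolding orthogonal_below_def by force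
  have N: "of_real (integral\<^sup>L M (\<lambda>z. (cmod (poly (szego a n) z))\<^sup>2)) = integral\<^sup>L M (poly (szego_rev a n))" for n
    by (rule integral_szego_rev[OF orth, symmetric])
  have "complex_of_real (integral\<^sup>L M (\<lambda>z. (cmod (poly (szego a n) z))\<^sup>2)) = of_real (\<Prod>j<n. 1 - (cmod (a j))\<^sup>2)" for n
    unfolding N by (subst integral_szego_rev_prod) (use m in \<open>simp_all only: integral_one mult_1_right\<close>)
  then show prod: "integral\<^sup>L M (\<lambda>z. (cmod (poly (szego a n) z))\<^sup>2) = (\<Prod>j<n. 1 - (cmod (a j))\<^sup>2)" for n
    by (simp only: of_real_eq_iff)
  \<comment> \<open>Positivity of the squared norms forces every new factor 1 - |a_n|^2 to be
    positive.\<close>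
  have pos: "0 < (\<Prod>j<n. 1 - (cmod (a j))\<^sup>2)" for n
    using lead_coeff_szego[of a n] integral_cmod_poly_pos[of "szego a n"] prod[of n]
    by (metis coeff_0 zero_neq_one)
  have "0 < (\<Prod>j<n. 1 - (cmod (a j))\<^sup>2) * (1 - (cmod (a n))\<^sup>2)" using pos[of "Suc n"] by simp
  then have "0 < 1 - (cmod (a n))\<^sup>2" using pos[of n] by (simp add: zero_less_mult_iff)
  then have "(cmod (a n))\<^sup>2 < 1" by simp
  then show "cmod (a n) < 1" by (simp add: power_less_one_iff)
qed

end

section \<open>Bernstein--Szego approximation\<close>

definition circle_lebesgue :: "complex measure" where
  "circle_lebesgue = distr angle_measure borel cis"

lemma measurable_cis [measurable]: "cis \<in> borel_measurable borel"
  by (intro borel_measurable_continuous_onI continuous_intros)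

lemma prob_space_circle_lebesgue: "prob_space circle_lebesgue"
  unfolding circle_lebesgue_def by (rule angle.prob_space_distr) simp

lemma sets_circle_lebesgue [simp, measurable_cong]: "sets circle_lebesgue = sets borel"
  by (simp add: circle_lebesgue_def)

lemma space_circle_lebesgue [simp]: "space circle_lebesgue = UNIV"
  by (simp add: circle_lebesgue_def)

lemma AE_circle_lebesgue: "AE z in circle_lebesgue. cmod z = 1"
  unfolding circle_lebesgue_def by (subst AE_distr_iff) auto

lemma circle_measure_circle_lebesgue: "circle_measure circle_lebesgue"
proof -
  interpret prob_space circle_lebesgue by (rule prob_space_circle_lebesgue)
  show ?thesis by unfold_locales (simp_all add: AE_circle_lebesgue)
qed

lemma integral_circle_lebesgue:
  fixes f :: "complex \<Rightarrow> 'b::{banach, second_countable_topology}"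
  assumes "f \<in> borel_measurable borel"
  shows "integral\<^sup>L circle_lebesgue f = integral\<^sup>L angle_measure (\<lambda>\<theta>. f (cis \<theta>))"
  unfolding circle_lebesgue_def using assms by (intro integral_distr) auto

context
  fixes a :: "nat \<Rightarrow> complex"
  assumes a1: "\<And>n. cmod (a n) < 1"
begin

definition szego_norm :: "nat \<Rightarrow> real" where
  "szego_norm n = (\<Prod>j<n. 1 - (cmod (a j))\<^sup>2)"

lemma one_minus_cmod_sq_pos: "0 < 1 - (cmod (a n))\<^sup>2"
  using a1[of n] by (simp add: power_less_one_iff)

lemma szego_norm_pos: "0 < szego_norm n"
  unfolding szego_norm_def by (intro prod_pos one_minus_cmod_sq_pos)

lemma ln_szego_norm: "ln (szego_norm n) = (\<Sum>j<n. ln (1 - (cmod (a j))\<^sup>2))"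
  unfolding szego_norm_def using one_minus_cmod_sq_pos by (intro ln_prod) (auto simp: less_imp_neq[symmetric])

lemma szego_circle_nonzero:
  assumes "cmod z = 1" shows "poly (szego a n) z \<noteq> 0"
  using szego_rev_dominates[of a z n, OF a1] cmod_szego_rev_circle[OF assms, of a n] assms by auto

definition bs_weight :: "nat \<Rightarrow> complex \<Rightarrow> real" where
  "bs_weight n z = szego_norm n / (cmod (poly (szego a n) z))\<^sup>2"

definition bernstein_szego :: "nat \<Rightarrow> complex measure" where
  "bernstein_szego n = density circle_lebesgue (\<lambda>z. ennreal (bs_weight n z))"

lemma poly_measurable [measurable]: "poly p \<in> borel_measurable (borel :: complex measure)"
  by (intro borel_measurable_continuous_onI continuous_intros)

lemma bs_weight_measurable [measurable]: "bs_weight n \<in> borel_measurable borel"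
  unfolding bs_weight_def by measurable

lemma bs_weight_nonneg: "0 \<le> bs_weight n z"
  using szego_norm_pos[of n] by (simp add: bs_weight_def)

lemma bs_weight_continuous: "continuous_on (sphere 0 1) (bs_weight n)"
  unfolding bs_weight_def using szego_circle_nonzero[of _ n] by (intro continuous_intros) auto

lemma circle_measure_bernstein_szego: "circle_measure (bernstein_szego n)"
proof -
  interpret C: circle_measure circle_lebesgue by (rule circle_measure_circle_lebesgue)
  have "compact (bs_weight n ` sphere 0 1)"
    by (intro compact_continuous_image bs_weight_continuous) auto
  then obtain B where B: "\<And>z. z \<in> sphere 0 1 \<Longrightarrow> norm (bs_weight n z) \<le> B"
    using compact_imp_bounded bounded_iff by (metis imageI)
  have "emeasure (bernstein_szego n) UNIV = (\<integral>\<^sup>+z. ennreal (bs_weight n z) \<partial>circle_lebesgue)"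
    unfolding bernstein_szego_def by (subst emeasure_density) auto
  also have "\<dots> \<le> (\<integral>\<^sup>+z. ennreal B \<partial>circle_lebesgue)"
  proof (rule nn_integral_mono_AE)
    show "AE z in circle_lebesgue. ennreal (bs_weight n z) \<le> ennreal B"
      using AE_circle_lebesgue by eventually_elim (use B in \<open>force intro!: ennreal_leI\<close>)
  qed
  also have "\<dots> < \<infinity>" 
    using prob_space.emeasure_space_1[OF prob_space_circle_lebesgue] by simp
  finally have "emeasure (bernstein_szego n) UNIV < \<infinity>" .
  then interpret finite_measure "bernstein_szego n"
    by (intro finite_measureI) (simp add: bernstein_szego_def)
  show ?thesis
  proof
    show "sets (bernstein_szego n) = sets borel" by (simp add: bernstein_szego_def)
    show "AE z in bernstein_szego n. cmod z = 1"
      unfolding bernstein_szego_def 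
      by (subst AE_density) (use AE_circle_lebesgue in \<open>auto elim: eventually_mono\<close>)
  qed
qed

lemma integral_bernstein_szego:
  fixes f :: "complex \<Rightarrow> 'b::{banach, second_countable_topology}"
  assumes [measurable]: "f \<in> borel_measurable borel"
  shows "integral\<^sup>L (bernstein_szego n) f = integral\<^sup>L angle_measure (\<lambda>\<theta>. bs_weight n (cis \<theta>) *\<^sub>R f (cis \<theta>))"
  unfolding bernstein_szego_def
  by (subst integral_density) (auto simp: bs_weight_nonneg integral_circle_lebesgue)

text \<open>On the circle the weight cancels the polynomial and leaves a constant times z^(n-k)
  divided by the reversed polynomial, which is zero-free on the closed disc; so the mean is
  0.\<close>

lemma integral_bernstein_szego_cnj_power:
  assumes "k < n"
  shows "integral\<^sup>L (bernstein_szego n) (\<lambda>z. cnj (z ^ k) * poly (szego a n) z) = 0"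
proof -
  have m: "(\<lambda>z. cnj (z ^ k) * poly (szego a n) z) \<in> borel_measurable borel"
    by (intro borel_measurable_continuous_onI continuous_intros)
  let ?f = "\<lambda>z. of_real (szego_norm n) / poly (szego_rev a n) z"
  have nz: "poly (szego_rev a n) z \<noteq> 0" if "cmod z \<le> 1" for z
    using szego_rev_dominates[of a, OF a1 that] by blast
  have "bs_weight n z *\<^sub>R (cnj (z ^ k) * poly (szego a n) z) = ?f z * z ^ (n - k)" if z: "cmod z = 1" for z
  proof -
    let ?p = "poly (szego a n) z"
    have p: "?p \<noteq> 0" by (rule szego_circle_nonzero[OF z])
    have zk: "z ^ n = z ^ k * z ^ (n - k)" using assms by (metis le_add_diff_inverse less_imp_le power_add)
    have "cnj (z ^ k) * z ^ k = 1" using cnj_power_mult_power[OF z order_refl, of k] by simp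
    moreover have "z ^ k \<noteq> 0" using z by auto
    ultimately have zc: "cnj (z ^ k) = 1 / z ^ k" by (simp only: nonzero_eq_divide_eq not_False_eq_True)
    have "bs_weight n z *\<^sub>R (cnj (z ^ k) * ?p) = of_real (szego_norm n) / (?p * cnj ?p) * (cnj (z ^ k) * ?p)"
      by (simp add: bs_weight_def scaleR_conv_of_real complex_norm_square[symmetric])
    also have "\<dots> = of_real (szego_norm n) / (z ^ n * cnj ?p) * z ^ (n - k)"
      unfolding zc zk using p \<open>z ^ k \<noteq> 0\<close> z by (auto simp: field_simps)
    finally show ?thesis by (simp add: szego_rev_circle[OF z])
  qed
  then have "integral\<^sup>L (bernstein_szego n) (\<lambda>z. cnj (z ^ k) * poly (szego a n) z) = 
     integral\<^sup>L angle_measure (\<lambda>\<theta>. ?f (cis \<theta>) * cis \<theta> ^ (n - k))"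
    unfolding integral_bernstein_szego[OF m] by simp
  also have "\<dots> = 0"
    using assms nz by (intro angle_mean_zero continuous_intros holomorphic_intros) auto
  finally show ?thesis .
qed

text \<open>Descending induction from n: the inverse Szego recursion writes (1 - |a_m|^2) z times
  the m-th polynomial through the two polynomials of index m+1.\<close>

lemma bernstein_szego_orthogonal:
  assumes "m \<le> n"
  shows "circle_measure.orthogonal_below (bernstein_szego n) m (szego a m)"
proof -
  interpret circle_measure "bernstein_szego n" by (rule circle_measure_bernstein_szego)
  show ?thesis using assms
  proof (induction m rule: inc_induct)
    case base
    then show ?case using integral_bernstein_szego_cnj_power unfolding orthogonal_below_def by blast
  next
    case (step m)
    show ?case unfolding orthogonal_below_def
    proof (intro allI impI)
      fix k assume k: "k < m"
      have id: "of_real (1 - (cmod (a m))\<^sup>2) * (z * poly (szego a m) z) = 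
         poly (szego a (Suc m)) z + cnj (a m) * poly (szego_rev a (Suc m)) z" for z
        using complex_norm_square[of "a m"] by (simp add: poly_szego_Suc poly_szego_rev_Suc algebra_simps)
      let ?I = "integral\<^sup>L (bernstein_szego n)"
      have "of_real (1 - (cmod (a m))\<^sup>2) * ?I (\<lambda>z. cnj (z ^ k) * poly (szego a m) z) = 
        ?I (\<lambda>z. of_real (1 - (cmod (a m))\<^sup>2) * (cnj (z ^ Suc k) * (z * poly (szego a m) z)))"
        unfolding integral_shift_moment[symmetric] integral_mult_right_zero ..
      also have "\<dots> = ?I (\<lambda>z. cnj (z ^ Suc k) * poly (szego a (Suc m)) z 
         + cnj (a m) * (cnj (z ^ Suc k) * poly (szego_rev a (Suc m)) z))"
      proof (intro Bochner_Integration.integral_cong refl)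
        fix z
        have "of_real (1 - (cmod (a m))\<^sup>2) * (cnj (z ^ Suc k) * (z * poly (szego a m) z)) = 
          cnj (z ^ Suc k) * (of_real (1 - (cmod (a m))\<^sup>2) * (z * poly (szego a m) z))"
          by (rule mult.left_commute)
        also have "\<dots> = cnj (z ^ Suc k) * poly (szego a (Suc m)) z 
           + cnj (a m) * (cnj (z ^ Suc k) * poly (szego_rev a (Suc m)) z)"
          unfolding id by (simp only: distrib_left mult.left_commute)
        finally show "of_real (1 - (cmod (a m))\<^sup>2) * (cnj (z ^ Suc k) * (z * poly (szego a m) z)) = 
          cnj (z ^ Suc k) * poly (szego a (Suc m)) z 
           + cnj (a m) * (cnj (z ^ Suc k) * poly (szego_rev a (Suc m)) z)" .
      qed
      also have "\<dots> = ?I (\<lambda>z. cnj (z ^ Suc k) * poly (szego a (Suc m)) z) 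
         + cnj (a m) * ?I (\<lambda>z. cnj (z ^ Suc k) * poly (szego_rev a (Suc m)) z)"
        unfolding integral_mult_right_zero[symmetric]
        by (rule Bochner_Integration.integral_add) (intro integrable_continuous continuous_intros)+
      also have "?I (\<lambda>z. cnj (z ^ Suc k) * poly (szego a (Suc m)) z) = 0"
        using step.IH k unfolding orthogonal_below_def by blast
      also have "?I (\<lambda>z. cnj (z ^ Suc k) * poly (szego_rev a (Suc m)) z) = 0"
        by (rule integral_szego_rev_moment[OF step.IH]) (use k in auto)
      finally have "of_real (1 - (cmod (a m))\<^sup>2) * ?I (\<lambda>z. cnj (z ^ k) * poly (szego a m) z) = 0" by simp
      moreover have "1 - (cmod (a m))\<^sup>2 \<noteq> 0" using one_minus_cmod_sq_pos[of m] by simp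
      ultimately show "?I (\<lambda>z. cnj (z ^ k) * poly (szego a m) z) = 0"
        by (metis mult_eq_0_iff of_real_eq_0_iff)
    qed
  qed
qed

lemma integral_bernstein_szego_szego:
  assumes "0 < m" "m \<le> n" shows "integral\<^sup>L (bernstein_szego n) (poly (szego a m)) = 0"
  using bernstein_szego_orthogonal[OF assms(2)] assms(1)
  unfolding circle_measure.orthogonal_below_def[OF circle_measure_bernstein_szego]
  by (auto dest: spec[of _ 0])

text \<open>The integral of the reversed polynomial is computed twice: the mean value property gives
  \<open>szego_norm\<close>, and the product formula gives \<open>szego_norm\<close> times the total
  mass.\<close>

lemma integral_bernstein_szego_one: "integral\<^sup>L (bernstein_szego n) (\<lambda>z. 1::complex) = 1"
proof -
  interpret circle_measure "bernstein_szego n" by (rule circle_measure_bernstein_szego)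
  have m: "poly (szego_rev a n) \<in> borel_measurable borel" by measurable
  have nz: "poly (szego_rev a n) z \<noteq> 0" if "cmod z \<le> 1" for z
    using szego_rev_dominates[of a, OF a1 that] by blast
  let ?f = "\<lambda>z. of_real (szego_norm n) / poly (szego_rev a n) z"
  have "bs_weight n z *\<^sub>R poly (szego_rev a n) z = cnj (?f z)" if z: "cmod z = 1" for z
  proof -
    let ?q = "poly (szego_rev a n) z"
    have "?q \<noteq> 0" using nz z by simp
    moreover have "bs_weight n z *\<^sub>R ?q = of_real (szego_norm n) / (?q * cnj ?q) * ?q"
      by (simp add: bs_weight_def scaleR_conv_of_real complex_norm_square[symmetric] cmod_szego_rev_circle[OF z])
    ultimately show ?thesis by simp
  qed
  then have "integral\<^sup>L (bernstein_szego n) (poly (szego_rev a n)) = integral\<^sup>L angle_measure (\<lambda>\<theta>. cnj (?f (cis \<theta>)))"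
    unfolding integral_bernstein_szego[OF m] by simp
  also have "\<dots> = cnj (integral\<^sup>L angle_measure (\<lambda>\<theta>. ?f (cis \<theta>)))" by (rule Bochner_Integration.integral_cnj)
  also have "integral\<^sup>L angle_measure (\<lambda>\<theta>. ?f (cis \<theta>)) = of_real (szego_norm n)"
    using angle_taylor_coeff[of ?f 0] nz by (force intro!: continuous_intros holomorphic_intros)
  finally have "integral\<^sup>L (bernstein_szego n) (poly (szego_rev a n)) = of_real (szego_norm n)" by simp
  moreover have "integral\<^sup>L (bernstein_szego n) (poly (szego_rev a n)) 
     = of_real (szego_norm n) * integral\<^sup>L (bernstein_szego n) (\<lambda>z. 1)"
    unfolding szego_norm_def by (rule integral_szego_rev_prod) (rule integral_bernstein_szego_szego)
  ultimately show ?thesis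
    using szego_norm_pos[of n] by (metis mult_cancel_left2 of_real_eq_0_iff order_less_irrefl)
qed

end

section \<open>Weak convergence of the Bernstein--Szego measures\<close>

lemma real_polynomial_function_on_circle:
  fixes g :: "complex \<Rightarrow> real"
  assumes "real_polynomial_function g"
  shows "\<exists>N q. \<forall>z. cmod z = 1 \<longrightarrow> complex_of_real (g z) = cnj (z ^ N) * poly q z"
  using assms
proof (induction rule: real_polynomial_function.induct)
  case (linear f)
  interpret f: bounded_linear f by (rule linear)
  let ?u = "complex_of_real (f 1)" and ?v = "complex_of_real (f \<i>)"
  \<comment> \<open>Re z and Im z are expressed by z and \<open>cnj z\<close>; multiplying z by
    \<open>cnj z * z = 1\<close> brings out the common factor \<open>cnj z\<close>.\<close>
  have "complex_of_real (f z) = cnj (z ^ 1) * poly [:?u / 2 + \<i> * ?v / 2, 0, ?u / 2 - \<i> * ?v / 2:] z"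
    if z: "cmod z = 1" for z
  proof -
    have "cnj z * z = 1" using cnj_power_mult_power[OF z order_refl, of 1] by simp
    then have zz: "cnj z * (z * z) = z" by (simp add: mult.assoc[symmetric])
    have "z = Re z *\<^sub>R 1 + Im z *\<^sub>R \<i>" by (simp add: complex_eq_iff)
    then have "f z = Re z * f 1 + Im z * f \<i>" by (metis f.add f.scaleR real_scaleR_def)
    then have "complex_of_real (f z) = (z + cnj z) / 2 * ?u + \<i> * (cnj z - z) / 2 * ?v"
      by (simp add: complex_eq_iff)
    also have "\<dots> = cnj z * (?u / 2 + \<i> * ?v / 2) + (cnj z * (z * z)) * (?u / 2 - \<i> * ?v / 2)"
      unfolding zz by (simp add: field_simps)
    also have "\<dots> = cnj (z ^ 1) * poly [:?u / 2 + \<i> * ?v / 2, 0, ?u / 2 - \<i> * ?v / 2:] z"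
      by (simp add: algebra_simps)
    finally show ?thesis .
  qed
  then show ?case by blast
next
  case (const c)
  have "complex_of_real c = cnj (z ^ 0) * poly [:of_real c:] z" for z by simp
  then show ?case by blast
next
  case (add f g)
  then obtain N q K r where
    q: "\<And>z. cmod z = 1 \<Longrightarrow> complex_of_real (f z) = cnj (z ^ N) * poly q z" and
    r: "\<And>z. cmod z = 1 \<Longrightarrow> complex_of_real (g z) = cnj (z ^ K) * poly r z" by blast
  have "complex_of_real (f z + g z) = cnj (z ^ (N + K)) * poly (monom 1 K * q + monom 1 N * r) z" 
    if z: "cmod z = 1" for z
  proof -
    have 1: "cnj (z ^ k) * z ^ k = 1" for k using cnj_power_mult_power[OF z order_refl, of k] by simp
    have "cnj (z ^ (N + K)) * poly (monom 1 K * q + monom 1 N * r) z =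
      cnj (z ^ N) * (cnj (z ^ K) * z ^ K) * poly q z + cnj (z ^ K) * (cnj (z ^ N) * z ^ N) * poly r z"
      by (simp add: poly_monom power_add algebra_simps)
    then show ?thesis unfolding 1 using q[OF z] r[OF z] by simp
  qed
  then show ?case by blast
next
  case (mult f g)
  then obtain N q K r where
    q: "\<And>z. cmod z = 1 \<Longrightarrow> complex_of_real (f z) = cnj (z ^ N) * poly q z" and
    r: "\<And>z. cmod z = 1 \<Longrightarrow> complex_of_real (g z) = cnj (z ^ K) * poly r z" by blast
  have "complex_of_real (f z * g z) = cnj (z ^ (N + K)) * poly (q * r) z" if "cmod z = 1" for z
    using q[OF that] r[OF that] by (simp add: power_add)
  then show ?case by blast
qed

lemma (in circle_measure) integral_cnj_power_poly:
  "integral\<^sup>L M (\<lambda>z. cnj (z ^ N) * poly q z) = 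
    (\<Sum>j\<le>degree q. coeff q j * integral\<^sup>L M (\<lambda>z. cnj (z ^ N) * z ^ j))"
proof -
  have "cnj (z ^ N) * poly q z = (\<Sum>j\<le>degree q. coeff q j * (cnj (z ^ N) * z ^ j))" for z
    unfolding poly_altdef sum_distrib_left by (simp only: mult.left_commute)
  then have "integral\<^sup>L M (\<lambda>z. cnj (z ^ N) * poly q z) = integral\<^sup>L M (\<lambda>z. \<Sum>j\<le>degree q. coeff q j * (cnj (z ^ N) * z ^ j))"
    by presburger
  also have "\<dots> = (\<Sum>j\<le>degree q. integral\<^sup>L M (\<lambda>z. coeff q j * (cnj (z ^ N) * z ^ j)))"
    by (rule Bochner_Integration.integral_sum) (intro integrable_continuous continuous_intros)
  finally show ?thesis unfolding integral_mult_right_zero .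
qed

lemma integral_circle_weight: "integral\<^sup>L angle_measure (\<lambda>\<theta>. (1 - cos \<theta>) ^ 4) = 70 / 16"
proof -
  have 0: "(deriv ^^ k) (\<lambda>z. 1) 0 = (if k = 0 then 1 else 0 :: complex)" for k
    by (induction k) (auto simp: deriv_const[abs_def] funpow_swap1)
  show ?thesis using angle_weighted_Re[of "\<lambda>z. 1"] by (simp add: 0)
qed

lemma integrable_angle_weighted:
  fixes f :: "complex \<Rightarrow> real"
  assumes "continuous_on (sphere 0 1) f"
  shows "integrable angle_measure (\<lambda>\<theta>. (1 - cos \<theta>) ^ 4 * f (cis \<theta>))"
proof -
  have "integrable angle_measure (\<lambda>\<theta>. (1 - Re (cis \<theta>)) ^ 4 * f (cis \<theta>))"
    by (rule integrable_angle_comp_cis[of "\<lambda>z. (1 - Re z) ^ 4 * f z"]) (intro continuous_intros assms)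
  then show ?thesis by simp
qed

context circle_prob
begin

context
  fixes a assumes a: "\<And>n. a n = verblunsky M n"
begin

interpretation BS: circle_measure "bernstein_szego a n" for n
  using circle_measure_bernstein_szego verblunsky_norm(1)[OF a] .

lemma measure_bernstein_szego: "measure (bernstein_szego a n) (space (bernstein_szego a n)) = 1"
proof -
  have "complex_of_real (measure (bernstein_szego a n) (space (bernstein_szego a n))) = 1"
    using integral_bernstein_szego_one[of a n, OF verblunsky_norm(1)[OF a]]
    by (simp add: scaleR_conv_of_real)
  then show ?thesis by (simp only: of_real_eq_1_iff)
qed

lemma bernstein_szego_poly_eq:
  assumes "N \<le> n" "degree q \<le> n"
  shows "integral\<^sup>L (bernstein_szego a n) (\<lambda>z. cnj (z ^ N) * poly q z) = integral\<^sup>L M (\<lambda>z. cnj (z ^ N) * poly q z)"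
  unfolding integral_cnj_power_poly BS.integral_cnj_power_poly
proof (intro sum.cong refl arg_cong2[where f = "(*)"])
  fix j assume "j \<in> {..degree q}"
  then have "j \<le> n" using assms by simp
  show "integral\<^sup>L (bernstein_szego a n) (\<lambda>z. cnj (z ^ N) * z ^ j) = integral\<^sup>L M (\<lambda>z. cnj (z ^ N) * z ^ j)"
    by (rule integral_cnj_power_mult_power_unique[symmetric, of _ n a])
       (use assms \<open>j \<le> n\<close> in \<open>simp_all add: BS.circle_measure_axioms verblunsky_norm(3)[OF a]
         integral_bernstein_szego_szego[OF verblunsky_norm(1)[OF a]] integral_one 
         integral_bernstein_szego_one[OF verblunsky_norm(1)[OF a]] del: lebesgue_integral_const\<close>)
qed

text \<open>By Stone--Weierstrass g is uniformly close on the circle to a trigonometric polynomial,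
  whose integrals agree exactly once n reaches its degree. All measures have mass 1, so the error is
  uniform in n.\<close>

lemma bernstein_szego_tendsto:
  fixes g :: "complex \<Rightarrow> real"
  assumes g: "continuous_on UNIV g"
  shows "(\<lambda>n. integral\<^sup>L (bernstein_szego a n) g) \<longlonglongrightarrow> integral\<^sup>L M g"
proof (rule LIMSEQ_I)
  fix e :: real assume e: "0 < e"
  obtain p where p: "real_polynomial_function p" "\<And>z. z \<in> sphere 0 1 \<Longrightarrow> \<bar>g z - p z\<bar> < e / 3"
    using Stone_Weierstrass_real_polynomial_function[of "sphere 0 1" g "e / 3"] e
      continuous_on_subset[OF g] by auto
  have pc: "continuous_on UNIV p"
    using p(1) by (intro continuous_on_polymonial_function) (simp add: real_polynomial_function_eq)
  obtain N q where q: "\<And>z. cmod z = 1 \<Longrightarrow> complex_of_real (p z) = cnj (z ^ N) * poly q z"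
    using real_polynomial_function_on_circle[OF p(1)] by blast
  have approx: "\<bar>integral\<^sup>L L g - integral\<^sup>L L p\<bar> \<le> e / 3" 
    if L: "circle_measure L" "measure L (space L) = 1" for L
  proof -
    interpret L: circle_measure L by (rule L(1))
    have "integral\<^sup>L L g - integral\<^sup>L L p = integral\<^sup>L L (\<lambda>z. g z - p z)"
      by (rule Bochner_Integration.integral_diff[symmetric]) (intro L.integrable_continuous g pc)+
    also have "\<bar>\<dots>\<bar> \<le> integral\<^sup>L L (\<lambda>z. \<bar>g z - p z\<bar>)" by (rule integral_abs_bound)
    also have "\<dots> \<le> integral\<^sup>L L (\<lambda>z. e / 3)"
    proof (rule integral_mono_AE)
      show "AE z in L. \<bar>g z - p z\<bar> \<le> e / 3"
        using L.AE_circle by eventually_elim (use p(2) in \<open>force intro: less_imp_le\<close>)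
    qed (intro L.integrable_continuous continuous_intros g pc)+
    also have "\<dots> = e / 3" using L(2) by simp
    finally show ?thesis .
  qed
  have poly: "complex_of_real (integral\<^sup>L L p) = integral\<^sup>L L (\<lambda>z. cnj (z ^ N) * poly q z)" 
    if L: "circle_measure L" for L
  proof -
    interpret L: circle_measure L by (rule L)
    show ?thesis unfolding integral_complex_of_real[symmetric]
      by (rule L.integral_circle_cong) (intro continuous_intros pc q | assumption)+
  qed
  have "norm (integral\<^sup>L (bernstein_szego a n) g - integral\<^sup>L M g) < e" if "n \<ge> max N (degree q)" for n
  proof -
    have "complex_of_real (integral\<^sup>L (bernstein_szego a n) p) = of_real (integral\<^sup>L M p)"
      unfolding poly[OF circle_measure_axioms] poly[OF BS.circle_measure_axioms]
      using that by (intro bernstein_szego_poly_eq) auto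
    then have "integral\<^sup>L (bernstein_szego a n) p = integral\<^sup>L M p" by (simp only: of_real_eq_iff)
    moreover have "\<bar>integral\<^sup>L (bernstein_szego a n) g - integral\<^sup>L (bernstein_szego a n) p\<bar> * 3 \<le> e"
      "\<bar>integral\<^sup>L M g - integral\<^sup>L M p\<bar> * 3 \<le> e"
      using approx[OF BS.circle_measure_axioms measure_bernstein_szego, of n] 
        approx[OF circle_measure_axioms prob_space] by simp_all
    moreover have "\<bar>x - y\<bar> < e" if "x' = y'" "\<bar>x - x'\<bar> * 3 \<le> e" "\<bar>y - y'\<bar> * 3 \<le> e" for x y x' y' :: real
      using that e by (simp add: abs_le_iff abs_less_iff abs_if split: if_splits)
    ultimately show ?thesis unfolding real_norm_def by blast
  qed
  then show "\<exists>no. \<forall>n\<ge>no. norm (integral\<^sup>L (bernstein_szego a n) g - integral\<^sup>L M g) < e" by blast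
qed

text \<open>The quotient is the squared modulus of the orthonormal polynomial, so this is the
  quantity E of the overview.\<close>

definition szego_entropy :: "nat \<Rightarrow> real" where
  "szego_entropy n = integral\<^sup>L angle_measure 
     (\<lambda>\<theta>. (1 - cos \<theta>) ^ 4 * ln ((cmod (poly (szego a n) (cis \<theta>)))\<^sup>2 / szego_norm a n))"

lemma szego_verblunsky_nonzero: "cmod z = 1 \<Longrightarrow> poly (szego a n) z \<noteq> 0"
  by (rule szego_circle_nonzero[OF verblunsky_norm(1)[OF a]])

lemma szego_norm_verblunsky_pos: "0 < szego_norm a n"
  by (rule szego_norm_pos[OF verblunsky_norm(1)[OF a]])

lemma szego_entropy_eq:
  "16 * szego_entropy n = 16 * integral\<^sup>L angle_measure (\<lambda>\<theta>. (1 - cos \<theta>) ^ 4 * ln ((cmod (poly (szego a n) (cis \<theta>)))\<^sup>2))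
     - 70 * (\<Sum>j<n. ln (1 - (cmod (a j))\<^sup>2))"
proof -
  have "ln ((cmod (poly (szego a n) (cis \<theta>)))\<^sup>2 / szego_norm a n) = 
      ln ((cmod (poly (szego a n) (cis \<theta>)))\<^sup>2) - ln (szego_norm a n)" for \<theta>
    using szego_verblunsky_nonzero[of "cis \<theta>" n] szego_norm_verblunsky_pos[of n] by (intro ln_divide_pos) auto
  then have "szego_entropy n = integral\<^sup>L angle_measure (\<lambda>\<theta>. 
     (1 - cos \<theta>) ^ 4 * ln ((cmod (poly (szego a n) (cis \<theta>)))\<^sup>2) - (1 - cos \<theta>) ^ 4 * ln (szego_norm a n))"
    unfolding szego_entropy_def by (simp add: right_diff_distrib)
  also have "\<dots> = integral\<^sup>L angle_measure (\<lambda>\<theta>. (1 - cos \<theta>) ^ 4 * ln ((cmod (poly (szego a n) (cis \<theta>)))\<^sup>2))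
     - integral\<^sup>L angle_measure (\<lambda>\<theta>. (1 - cos \<theta>) ^ 4 * ln (szego_norm a n))"
    using szego_verblunsky_nonzero[of _ n]
    by (intro Bochner_Integration.integral_diff integrable_angle_weighted[of "\<lambda>z. ln ((cmod (poly (szego a n) z))\<^sup>2)"]
          integrable_angle_weighted[of "\<lambda>z. ln (szego_norm a n)"] continuous_intros) auto
  finally show ?thesis
    unfolding integral_mult_left_zero integral_circle_weight ln_szego_norm[OF verblunsky_norm(1)[OF a]] by simp
qed

lemma entropy_le_continuous:
  fixes h :: "complex \<Rightarrow> real"
  assumes h: "continuous_on UNIV h" and pos: "\<And>z. 0 < h z" and K: "\<And>n. szego_entropy n \<le> K"
  shows "integral\<^sup>L angle_measure (\<lambda>\<theta>. (1 - cos \<theta>) ^ 4 * ln (h (cis \<theta>))) \<le> K + integral\<^sup>L M (\<lambda>z. (1 - Re z) ^ 4 * h z)"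
proof -
  let ?P = "\<lambda>z. (1 - Re z) ^ 4 * h z"
  let ?I = "integral\<^sup>L angle_measure (\<lambda>\<theta>. (1 - cos \<theta>) ^ 4 * ln (h (cis \<theta>)))"
  have Pc: "continuous_on UNIV ?P" by (intro continuous_intros h)
  have h': "continuous_on (sphere 0 1) h" using h by (rule continuous_on_subset) auto
  have "?I \<le> K + integral\<^sup>L (bernstein_szego a n) ?P" for n
  proof -
    have bs: "integral\<^sup>L (bernstein_szego a n) ?P = integral\<^sup>L angle_measure (\<lambda>\<theta>. (1 - cos \<theta>) ^ 4 * (bs_weight a n (cis \<theta>) * h (cis \<theta>)))"
      by (subst integral_bernstein_szego[OF verblunsky_norm(1)[OF a] borel_measurable_continuous_onI[OF Pc]])
         (simp add: mult_ac)
    have "?I - szego_entropy n = integral\<^sup>L angle_measure (\<lambda>\<theta>. (1 - cos \<theta>) ^ 4 * ln (h (cis \<theta>)) 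
      - (1 - cos \<theta>) ^ 4 * ln ((cmod (poly (szego a n) (cis \<theta>)))\<^sup>2 / szego_norm a n))"
      unfolding szego_entropy_def using szego_verblunsky_nonzero[of _ n] szego_norm_verblunsky_pos[of n] pos less_imp_neq[OF pos]
      by (intro Bochner_Integration.integral_diff[symmetric] integrable_angle_weighted[of "\<lambda>z. ln (h z)"]
           integrable_angle_weighted[of "\<lambda>z. ln ((cmod (poly (szego a n) z))\<^sup>2 / szego_norm a n)"] continuous_intros h') auto
    also have "\<dots> \<le> integral\<^sup>L angle_measure (\<lambda>\<theta>. (1 - cos \<theta>) ^ 4 * (bs_weight a n (cis \<theta>) * h (cis \<theta>)))"
    proof (rule integral_mono)
      show "integrable angle_measure (\<lambda>\<theta>. (1 - cos \<theta>) ^ 4 * (bs_weight a n (cis \<theta>) * h (cis \<theta>)))"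
        by (rule integrable_angle_weighted[of "\<lambda>z. bs_weight a n z * h z"]) 
           (intro continuous_intros h' bs_weight_continuous verblunsky_norm(1)[OF a])
      show "integrable angle_measure (\<lambda>\<theta>. (1 - cos \<theta>) ^ 4 * ln (h (cis \<theta>)) 
        - (1 - cos \<theta>) ^ 4 * ln ((cmod (poly (szego a n) (cis \<theta>)))\<^sup>2 / szego_norm a n))"
        using szego_verblunsky_nonzero[of _ n] szego_norm_verblunsky_pos[of n] pos less_imp_neq[OF pos]
        by (intro Bochner_Integration.integrable_diff integrable_angle_weighted[of "\<lambda>z. ln (h z)"]
           integrable_angle_weighted[of "\<lambda>z. ln ((cmod (poly (szego a n) z))\<^sup>2 / szego_norm a n)"] continuous_intros h') auto
      fix \<theta> :: real
      let ?p = "(cmod (poly (szego a n) (cis \<theta>)))\<^sup>2"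
      have p: "0 < ?p / szego_norm a n" using szego_verblunsky_nonzero[of "cis \<theta>" n] szego_norm_verblunsky_pos[of n] by simp
      have "ln (h (cis \<theta>)) - ln (?p / szego_norm a n) = ln (h (cis \<theta>) / (?p / szego_norm a n))"
        by (rule ln_divide_pos[symmetric]) (use pos p in auto)
      also have "\<dots> \<le> h (cis \<theta>) / (?p / szego_norm a n) - 1"
        by (rule ln_le_minus_one) (rule divide_pos_pos[OF pos p])
      \<comment> \<open>Discarding -1 only changes the final bound by a constant.\<close>
      also have "\<dots> \<le> bs_weight a n (cis \<theta>) * h (cis \<theta>)"
        unfolding bs_weight_def[OF verblunsky_norm(1)[OF a]] by (simp add: mult.commute)
      finally show "(1 - cos \<theta>) ^ 4 * ln (h (cis \<theta>)) - (1 - cos \<theta>) ^ 4 * ln (?p / szego_norm a n) 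
         \<le> (1 - cos \<theta>) ^ 4 * (bs_weight a n (cis \<theta>) * h (cis \<theta>))"
        unfolding right_diff_distrib[symmetric] by (rule mult_left_mono) simp
    qed
    finally show ?thesis using K[of n] unfolding bs by linarith
  qed
  moreover have "(\<lambda>n. K + integral\<^sup>L (bernstein_szego a n) ?P) \<longlonglongrightarrow> K + integral\<^sup>L M ?P"
    by (intro tendsto_intros bernstein_szego_tendsto Pc)
  ultimately show ?thesis by (intro LIMSEQ_le_const) auto
qed

end

end

section \<open>Finiteness of the entropy\<close>

lemma finite_borel_approx_indicator:
  fixes N :: "complex measure"
  assumes "finite_measure N" and sets: "sets N = sets borel" and A: "A \<in> sets borel" and e: "0 < e"
  shows "\<exists>f::complex \<Rightarrow> real. continuous_on UNIV f \<and> (\<integral>\<^sup>+z. ennreal \<bar>f z - indicator A z\<bar> \<partial>N) < ennreal e"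
proof -
  interpret finite_measure N by fact
  have space: "space N = UNIV" using sets_eq_imp_space_eq[OF sets] by simp
  have fin: "emeasure N (space N) \<noteq> \<infinity>" by (simp add: emeasure_eq_measure)
  obtain K where K: "K \<subseteq> A" "compact K" "measure N A < measure N K + e / 2"
  proof -
    have "\<exists>K\<in>{K. K \<subseteq> A \<and> compact K}. measure N A < measure N K + e / 2"
    proof (rule ccontr)
      assume "\<not> ?thesis"
      then have le: "\<And>K. K \<subseteq> A \<Longrightarrow> compact K \<Longrightarrow> measure N K \<le> measure N A - e / 2" by force
      have "emeasure N A = (SUP K\<in>{K. K \<subseteq> A \<and> compact K}. emeasure N K)"
        by (rule inner_regular[OF sets fin A])
      also have "\<dots> \<le> ennreal (measure N A - e / 2)"
        by (rule SUP_least) (use le in \<open>auto simp: emeasure_eq_measure intro!: ennreal_leI\<close>)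
      finally have le2: "ennreal (measure N A) \<le> ennreal (measure N A - e / 2)" by (simp add: emeasure_eq_measure)
      have "0 \<le> measure N A - e / 2" using le[of "{}"] by simp
      then show False using le2 e by (simp add: ennreal_le_iff)
    qed
    then show ?thesis using that by blast
  qed
  obtain U where U: "A \<subseteq> U" "open U" "measure N U < measure N A + e / 2"
  proof -
    have "\<exists>U\<in>{U. A \<subseteq> U \<and> open U}. measure N U < measure N A + e / 2"
    proof (rule ccontr)
      assume "\<not> ?thesis"
      then have le: "\<And>U. A \<subseteq> U \<Longrightarrow> open U \<Longrightarrow> measure N A + e / 2 \<le> measure N U" by force
      have "ennreal (measure N A + e / 2) \<le> (INF U\<in>{U. A \<subseteq> U \<and> open U}. emeasure N U)"
        by (rule INF_greatest) (use le in \<open>auto simp: emeasure_eq_measure intro!: ennreal_leI\<close>)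
      also have "\<dots> = emeasure N A" by (rule outer_regular[OF sets fin A, symmetric])
      finally have "ennreal (measure N A + e / 2) \<le> ennreal (measure N A)" by (simp add: emeasure_eq_measure)
      then show False using e by (simp add: ennreal_le_iff)
    qed
    then show ?thesis using that by blast
  qed
  have "closed (- U)" "closed K" "K \<inter> - U = {}" using K U by (auto simp: compact_imp_closed)
  \<comment> \<open>A Urysohn function between a compact set inside A and an open set around A
    differs from the indicator of A at most on \<open>U - K\<close>.\<close>
  then obtain f :: "complex \<Rightarrow> real" where f: "continuous_on UNIV f" "\<And>x. f x \<in> closed_segment 1 0" 
    "\<And>x. x \<in> K \<Longrightarrow> f x = 1" "\<And>x. x \<in> - U \<Longrightarrow> f x = 0"
    using Urysohn[of K "- U" "1::real" 0] by metis
  have f01: "0 \<le> f x" "f x \<le> 1" for x using f(2)[of x] by (auto simp: closed_segment_eq_real_ivl)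
  have m: "K \<in> sets N" "U \<in> sets N" using K U by (auto simp: sets intro: borel_compact)
  have "(\<integral>\<^sup>+z. ennreal \<bar>f z - indicator A z\<bar> \<partial>N) \<le> (\<integral>\<^sup>+z. indicator (U - K) z \<partial>N)"
  proof (rule nn_integral_mono)
    fix z
    show "ennreal \<bar>f z - indicator A z\<bar> \<le> indicator (U - K) z"
      using f(3,4)[of z] f01[of z] K(1) U(1) 
      by (auto split: split_indicator simp: ennreal_1[symmetric] simp del: ennreal_1 intro!: ennreal_leI)
  qed
  also have "\<dots> = emeasure N (U - K)" using m by simp
  also have "\<dots> = ennreal (measure N U - measure N K)"
    using m K U by (simp add: emeasure_eq_measure finite_measure_Diff)
  also have "\<dots> < ennreal e"
    using K(3) U(3) e by (intro ennreal_lessI) (auto simp: field_simps)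
  finally show ?thesis using f(1) by blast
qed

lemma finite_borel_approx_continuous:
  fixes N :: "complex measure" and h :: "complex \<Rightarrow> real"
  assumes "finite_measure N" and sets: "sets N = sets borel" and h: "integrable N h" and e: "0 < e"
  shows "\<exists>f. continuous_on UNIV f \<and> (\<integral>\<^sup>+z. ennreal \<bar>f z - h z\<bar> \<partial>N) < ennreal e"
  using h e
proof (induction arbitrary: e)
  case (base A c)
  have A: "A \<in> sets borel" using base(1) sets by simp
  \<comment> \<open>Adding 1 in the denominator covers c = 0.\<close>
  obtain f :: "complex \<Rightarrow> real" where f: "continuous_on UNIV f" 
    "(\<integral>\<^sup>+z. ennreal \<bar>f z - indicator A z\<bar> \<partial>N) < ennreal (e / (\<bar>c\<bar> + 1))"
    using finite_borel_approx_indicator[OF assms(1) sets A, of "e / (\<bar>c\<bar> + 1)"] base by auto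
  have [measurable]: "f \<in> borel_measurable N" "A \<in> sets N"
    using borel_measurable_continuous_onI[OF f(1)] base(1) measurable_cong_sets[OF sets refl] by auto
  have fm: "(\<lambda>z. ennreal \<bar>f z - indicator A z\<bar>) \<in> borel_measurable N" by measurable
  have "(\<integral>\<^sup>+z. ennreal \<bar>c * f z - indicator A z *\<^sub>R c\<bar> \<partial>N) = (\<integral>\<^sup>+z. ennreal \<bar>c\<bar> * ennreal \<bar>f z - indicator A z\<bar> \<partial>N)"
    by (intro nn_integral_cong) (simp add: ennreal_mult[symmetric] abs_mult[symmetric] algebra_simps)
  also have "\<dots> = ennreal \<bar>c\<bar> * (\<integral>\<^sup>+z. ennreal \<bar>f z - indicator A z\<bar> \<partial>N)"
    by (rule nn_integral_cmult[OF fm])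
  also have "\<dots> \<le> ennreal \<bar>c\<bar> * ennreal (e / (\<bar>c\<bar> + 1))"
    by (intro mult_left_mono less_imp_le[OF f(2)]) simp
  also have "\<dots> = ennreal (\<bar>c\<bar> * (e / (\<bar>c\<bar> + 1)))"
    using base by (intro ennreal_mult[symmetric]) auto
  also have "\<dots> < ennreal e" using base by (intro ennreal_lessI) (auto simp: field_simps)
  finally show ?case using f(1) by (intro exI[of _ "\<lambda>z. c * f z"] conjI continuous_intros)
next
  case (add u v)
  obtain f g where f: "continuous_on UNIV f" "(\<integral>\<^sup>+z. ennreal \<bar>f z - u z\<bar> \<partial>N) < ennreal (e / 2)"
    and g: "continuous_on UNIV g" "(\<integral>\<^sup>+z. ennreal \<bar>g z - v z\<bar> \<partial>N) < ennreal (e / 2)"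
    using add.IH(1)[of "e / 2"] add.IH(2)[of "e / 2"] add.prems by auto
  have [measurable]: "u \<in> borel_measurable N" "v \<in> borel_measurable N" using add.hyps by auto
  have [measurable]: "f \<in> borel_measurable N" "g \<in> borel_measurable N"
    using borel_measurable_continuous_onI[OF f(1)] borel_measurable_continuous_onI[OF g(1)] 
      measurable_cong_sets[OF sets refl] by auto
  have "(\<integral>\<^sup>+z. ennreal \<bar>f z + g z - (u z + v z)\<bar> \<partial>N) \<le> (\<integral>\<^sup>+z. ennreal \<bar>f z - u z\<bar> + ennreal \<bar>g z - v z\<bar> \<partial>N)"
    by (intro nn_integral_mono) (auto simp: ennreal_plus[symmetric] simp del: ennreal_plus intro!: ennreal_leI)
  also have "\<dots> = (\<integral>\<^sup>+z. ennreal \<bar>f z - u z\<bar> \<partial>N) + (\<integral>\<^sup>+z. ennreal \<bar>g z - v z\<bar> \<partial>N)"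
    by (rule nn_integral_add) measurable
  also have "\<dots> < ennreal (e / 2) + ennreal (e / 2)" by (rule add_strict_mono[OF f(2) g(2)])
  also have "\<dots> = ennreal e" using add.prems by (simp add: ennreal_plus[symmetric] del: ennreal_plus)
  finally show ?case using f(1) g(1) by (intro exI[of _ "\<lambda>z. f z + g z"] conjI continuous_intros)
next
  case (lim u s)
  have [measurable]: "u \<in> borel_measurable N" "\<And>i. s i \<in> borel_measurable N" using lim.hyps by auto
  have "(\<lambda>i. \<integral>\<^sup>+z. ennreal (norm (u z - s i z)) \<partial>N) \<longlonglongrightarrow> 0"
  proof (rule nn_integral_dominated_convergence_norm[where w = "\<lambda>z. 2 * norm (u z)"])
    show "(\<integral>\<^sup>+z. ennreal (2 * norm (u z)) \<partial>N) < \<infinity>"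
      using lim.hyps(4) by (simp add: integrable_iff_bounded ennreal_mult nn_integral_cmult ennreal_mult_less_top)
  qed (use lim.hyps in auto)
  then have "(\<lambda>i. \<integral>\<^sup>+z. ennreal (norm (s i z - u z)) \<partial>N) \<longlonglongrightarrow> 0"
    by (simp only: norm_minus_commute)
  then have "\<forall>\<^sub>F i in sequentially. (\<integral>\<^sup>+z. ennreal (norm (s i z - u z)) \<partial>N) < ennreal (e / 2)"
    by (rule order_tendstoD) (use lim.prems in simp)
  then obtain i where i: "(\<integral>\<^sup>+z. ennreal \<bar>s i z - u z\<bar> \<partial>N) < ennreal (e / 2)"
    using eventually_happens by force
  obtain f where f: "continuous_on UNIV f" "(\<integral>\<^sup>+z. ennreal \<bar>f z - s i z\<bar> \<partial>N) < ennreal (e / 2)"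
    using lim.IH[of "e / 2" i] lim.prems by auto
  have [measurable]: "f \<in> borel_measurable N"
    using borel_measurable_continuous_onI[OF f(1)] measurable_cong_sets[OF sets refl] by auto
  have "(\<integral>\<^sup>+z. ennreal \<bar>f z - u z\<bar> \<partial>N) \<le> (\<integral>\<^sup>+z. ennreal \<bar>f z - s i z\<bar> + ennreal \<bar>s i z - u z\<bar> \<partial>N)"
    by (intro nn_integral_mono) (auto simp: ennreal_plus[symmetric] simp del: ennreal_plus intro!: ennreal_leI)
  also have "\<dots> = (\<integral>\<^sup>+z. ennreal \<bar>f z - s i z\<bar> \<partial>N) + (\<integral>\<^sup>+z. ennreal \<bar>s i z - u z\<bar> \<partial>N)"
    by (rule nn_integral_add) measurable
  also have "\<dots> < ennreal (e / 2) + ennreal (e / 2)" by (rule add_strict_mono[OF f(2) i])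
  also have "\<dots> = ennreal e" using lim.prems by (simp add: ennreal_plus[symmetric] del: ennreal_plus)
  finally show ?case using f(1) by blast
qed

text \<open>Used to add \<mu> and Lebesgue measure: one continuous function then approximates in L^1
  of both at once.\<close>

lemma exists_sum_measure:
  assumes [simp]: "sets M = sets borel" "sets N = sets borel"
  shows "\<exists>L. sets L = sets borel \<and> (\<forall>A\<in>sets borel. emeasure L A = emeasure M A + emeasure N A)"
proof (intro exI conjI ballI)
  let ?L = "measure_of UNIV (sets borel) (\<lambda>A. emeasure M A + emeasure N A)"
  show "sets ?L = sets borel" using sets.sigma_sets_eq[of borel] by simp
  fix A :: "'a set" assume A: "A \<in> sets borel"
  show "emeasure ?L A = emeasure M A + emeasure N A"
  proof (rule emeasure_measure_of_sigma)
    show "sigma_algebra UNIV (sets borel :: 'a set set)" using sets.sigma_algebra_axioms[of borel] by simp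
    show "positive (sets borel) (\<lambda>A. emeasure M A + emeasure N A)" by (simp add: positive_def)
    show "countably_additive (sets borel) (\<lambda>A. emeasure M A + emeasure N A)"
      by (rule countably_additiveI) (simp add: suminf_add[symmetric] suminf_emeasure)
  qed (rule A)
qed

lemma circle_weight_bounds:
  assumes "cmod z = 1" shows "0 \<le> (1 - Re z) ^ 4" "(1 - Re z) ^ 4 \<le> 16"
proof -
  have "\<bar>Re z\<bar> \<le> 1" using abs_Re_le_cmod[of z] assms by simp
  then have "(1 - Re z) ^ 4 \<le> 2 ^ 4" by (intro power_mono) auto
  then show "0 \<le> (1 - Re z) ^ 4" "(1 - Re z) ^ 4 \<le> 16" by simp_all
qed

lemma (in circle_measure) weighted_integrable:
  fixes g :: "complex \<Rightarrow> real"
  assumes "g \<in> borel_measurable borel" "\<And>z. \<bar>g z\<bar> \<le> B"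
  shows "integrable M (\<lambda>z. (1 - Re z) ^ 4 * g z)"
proof (rule integrable_const_bound)
  show "AE z in M. norm ((1 - Re z) ^ 4 * g z) \<le> 16 * B"
    using AE_circle
  proof eventually_elim
    case (elim z)
    then show ?case using circle_weight_bounds[OF elim] assms(2)[of z]
      by (auto simp: abs_mult intro!: mult_mono)
  qed
  have "(\<lambda>z. (1 - Re z) ^ 4 * g z) \<in> borel_measurable borel" using assms(1) by measurable
  then show "(\<lambda>z. (1 - Re z) ^ 4 * g z) \<in> borel_measurable M"
    using measurable_cong_sets[OF sets_M refl] by blast
qed

lemma (in circle_measure) weighted_integral_diff_le:
  fixes g1 g2 d :: "complex \<Rightarrow> real"
  assumes g: "g1 \<in> borel_measurable borel" "g2 \<in> borel_measurable borel" 
    and B: "\<And>z. \<bar>g1 z\<bar> \<le> B" "\<And>z. \<bar>g2 z\<bar> \<le> B" and d: "integrable M d" "\<And>z. \<bar>g1 z - g2 z\<bar> \<le> d z"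
  shows "integral\<^sup>L M (\<lambda>z. (1 - Re z) ^ 4 * g1 z) \<le> integral\<^sup>L M (\<lambda>z. (1 - Re z) ^ 4 * g2 z) + 16 * integral\<^sup>L M d"
proof -
  note i = weighted_integrable[OF g(1) B(1)] weighted_integrable[OF g(2) B(2)]
  have "integral\<^sup>L M (\<lambda>z. (1 - Re z) ^ 4 * g1 z) \<le> integral\<^sup>L M (\<lambda>z. (1 - Re z) ^ 4 * g2 z + 16 * d z)"
  proof (rule integral_mono_AE)
    show "AE z in M. (1 - Re z) ^ 4 * g1 z \<le> (1 - Re z) ^ 4 * g2 z + 16 * d z"
      using AE_circle
    proof eventually_elim
      case (elim z)
      have "(1 - Re z) ^ 4 * (g1 z - g2 z) \<le> (1 - Re z) ^ 4 * d z"
        using circle_weight_bounds[OF elim] d(2)[of z] by (intro mult_left_mono) auto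
      also have "\<dots> \<le> 16 * d z"
        using circle_weight_bounds[OF elim] d(2)[of z] by (intro mult_right_mono) auto
      finally show ?case by (simp add: algebra_simps)
    qed
  qed (intro Bochner_Integration.integrable_add integrable_mult_right i d(1))+
  also have "\<dots> = integral\<^sup>L M (\<lambda>z. (1 - Re z) ^ 4 * g2 z) + 16 * integral\<^sup>L M d"
    using i d(1) by simp
  finally show ?thesis .
qed

lemma (in circle_measure) integral_less_of_le_measure:
  fixes d :: "complex \<Rightarrow> real"
  assumes "sets N = sets borel" "M \<le> N" "integrable M d" "\<And>z. 0 \<le> d z" "(\<integral>\<^sup>+z. ennreal (d z) \<partial>N) < ennreal e" "0 < e"
  shows "integral\<^sup>L M d < e"
proof -
  have "ennreal (integral\<^sup>L M d) = (\<integral>\<^sup>+z. ennreal (d z) \<partial>M)"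
    using assms(3,4) by (intro nn_integral_eq_integral[symmetric]) auto
  also have "\<dots> \<le> (\<integral>\<^sup>+z. ennreal (d z) \<partial>N)"
    using sets_M assms(1,2) by (intro nn_integral_mono_measure) auto
  finally have "ennreal (integral\<^sup>L M d) < ennreal e" using assms(5) by (rule le_less_trans)
  moreover have "0 \<le> integral\<^sup>L M d" using assms(4) by (intro integral_nonneg_AE) auto
  ultimately show ?thesis using ennreal_less_iff by blast
qed

text \<open>The logarithm is 1-Lipschitz on [1, \<infinity>); for this reason test functions are
  kept at least 1.\<close>

lemma abs_ln_diff_le:
  fixes x y :: real
  assumes "1 \<le> x" "1 \<le> y" shows "\<bar>ln x - ln y\<bar> \<le> \<bar>x - y\<bar>"
proof -
  have *: "ln u - ln v \<le> \<bar>u - v\<bar>" if "1 \<le> u" "1 \<le> v" for u v :: real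
  proof -
    have "ln u - ln v = ln (u / v)" using that by (intro ln_divide_pos[symmetric]) auto
    also have "\<dots> \<le> u / v - 1" using that by (intro ln_le_minus_one) auto
    also have "\<dots> = (u - v) / v" using that by (simp add: diff_divide_distrib)
    also have "\<dots> \<le> \<bar>u - v\<bar> / v" using that by (intro divide_right_mono) auto
    also have "\<dots> \<le> \<bar>u - v\<bar>" using that by (simp add: divide_le_eq mult_le_cancel_left1)
    finally show ?thesis .
  qed
  show ?thesis using *[OF assms] *[OF assms(2,1)] by linarith
qed

context circle_prob
begin

context
  fixes a assumes a: "\<And>n. a n = verblunsky M n"
begin

text \<open>Both integrals are stable under L^1 perturbation of h within [1, B], the left one for
  Lebesgue measure and the right one for \<mu>, so the continuous case extends.\<close>

lemma entropy_le_borel: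
  fixes h :: "complex \<Rightarrow> real"
  assumes [measurable]: "h \<in> borel_measurable borel" and h: "\<And>z. 1 \<le> h z" "\<And>z. h z \<le> B" 
    and K: "\<And>n. szego_entropy a n \<le> K"
  shows "integral\<^sup>L angle_measure (\<lambda>\<theta>. (1 - cos \<theta>) ^ 4 * ln (h (cis \<theta>))) \<le> K + integral\<^sup>L M (\<lambda>z. (1 - Re z) ^ 4 * h z)"
proof (rule field_le_epsilon)
  fix e :: real assume e: "0 < e"
  interpret C: circle_measure circle_lebesgue by (rule circle_measure_circle_lebesgue)
  have B: "1 \<le> B" using h order_trans by blast
  obtain N where N: "sets N = sets borel" "\<And>A. A \<in> sets borel \<Longrightarrow> emeasure N A = emeasure M A + emeasure circle_lebesgue A"
    using exists_sum_measure[OF sets_M sets_circle_lebesgue] by blast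
  have sN: "space N = UNIV" using sets_eq_imp_space_eq[OF N(1)] by simp
  have fin: "finite_measure N"
    by (intro finite_measureI) (simp add: sN N(2) emeasure_eq_measure C.emeasure_eq_measure)
  then interpret N: finite_measure N .
  have le: "M \<le> N" "circle_lebesgue \<le> N"
    by (simp_all add: le_measure N sets_M add_increasing add_increasing2)
  have hB: "\<bar>h z\<bar> \<le> B" for z using h(1)[of z] h(2)[of z] by auto
  have "h \<in> borel_measurable N" using assms(1) measurable_cong_sets[OF N(1) refl] by blast
  then have hN: "integrable N h" by (intro N.integrable_const_bound[of _ B]) (use hB in auto)
  \<comment> \<open>The weight is at most 16 and an error is made on each side: 2 * 16 * (e / 32) =
    e.\<close>
  obtain f where f: "continuous_on UNIV f" "(\<integral>\<^sup>+z. ennreal \<bar>f z - h z\<bar> \<partial>N) < ennreal (e / 32)"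
    using finite_borel_approx_continuous[OF fin N(1) hN, of "e / 32"] e by auto
  \<comment> \<open>Clamping to the range of h cannot increase the distance to h and keeps the
    logarithm Lipschitz.\<close>
  define g where "g z = max 1 (min B (f z))" for z
  have gc: "continuous_on UNIV g" unfolding g_def by (intro continuous_intros f(1))
  have g1: "1 \<le> g z" "g z \<le> B" for z using B by (auto simp: g_def)
  have [measurable]: "g \<in> borel_measurable borel" using gc by (rule borel_measurable_continuous_onI)
  define d where "d z = \<bar>g z - h z\<bar>" for z
  have d: "d z \<le> \<bar>f z - h z\<bar>" for z
    using h(1)[of z] h(2)[of z] unfolding d_def g_def by (auto simp: max_def min_def abs_if)
  have dB: "\<bar>d z\<bar> \<le> B" for z using h(1)[of z] h(2)[of z] g1[of z] unfolding d_def by (auto simp: abs_if)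
  have dm: "d \<in> borel_measurable borel" unfolding d_def by measurable
  have dN: "(\<integral>\<^sup>+z. ennreal (d z) \<partial>N) < ennreal (e / 32)"
    by (rule le_less_trans[OF nn_integral_mono f(2)]) (intro ennreal_leI d)
  have di: "integrable M d" "integrable circle_lebesgue d"
    using dm dB measurable_cong_sets[OF sets_M refl] 
    by (auto intro!: integrable_const_bound[of _ B] C.integrable_const_bound[of _ B])
  have dM: "integral\<^sup>L M d < e / 32"
    by (rule integral_less_of_le_measure[OF N(1) le(1) di(1) _ dN]) (use e in \<open>auto simp: d_def\<close>)
  have dC: "integral\<^sup>L circle_lebesgue d < e / 32"
    by (rule C.integral_less_of_le_measure[OF N(1) le(2) di(2) _ dN]) (use e in \<open>auto simp: d_def\<close>)
  have conv: "integral\<^sup>L angle_measure (\<lambda>\<theta>. (1 - cos \<theta>) ^ 4 * ln (k (cis \<theta>))) = 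
     integral\<^sup>L circle_lebesgue (\<lambda>z. (1 - Re z) ^ 4 * ln (k z))" if [measurable]: "k \<in> borel_measurable borel" 
    for k :: "complex \<Rightarrow> real" by (subst integral_circle_lebesgue) auto
  have lnB: "\<bar>ln (k z)\<bar> \<le> ln B" if "1 \<le> k z" "k z \<le> B" for k :: "complex \<Rightarrow> real" and z
    using that by (auto simp: ln_mono)
  have "integral\<^sup>L circle_lebesgue (\<lambda>z. (1 - Re z) ^ 4 * ln (h z)) 
     \<le> integral\<^sup>L circle_lebesgue (\<lambda>z. (1 - Re z) ^ 4 * ln (g z)) + 16 * integral\<^sup>L circle_lebesgue d"
  proof (rule C.weighted_integral_diff_le)
    show "\<bar>ln (h z)\<bar> \<le> ln B" "\<bar>ln (g z)\<bar> \<le> ln B" for z by (rule lnB; rule h g1)+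
    show "\<bar>ln (h z) - ln (g z)\<bar> \<le> d z" for z
      using abs_ln_diff_le[OF h(1) g1(1), of z z] by (simp add: d_def abs_minus_commute)
  qed (use di in auto)
  moreover have "integral\<^sup>L circle_lebesgue (\<lambda>z. (1 - Re z) ^ 4 * ln (g z)) \<le> K + integral\<^sup>L M (\<lambda>z. (1 - Re z) ^ 4 * g z)"
  proof -
    have "0 < g z" for z using g1(1)[of z] by linarith
    then show ?thesis using entropy_le_continuous[OF a gc _ K] by (simp add: conv)
  qed
  moreover have "integral\<^sup>L M (\<lambda>z. (1 - Re z) ^ 4 * g z) \<le> integral\<^sup>L M (\<lambda>z. (1 - Re z) ^ 4 * h z) + 16 * integral\<^sup>L M d"
  proof (rule weighted_integral_diff_le)
    show "\<bar>g z\<bar> \<le> B" "\<bar>h z\<bar> \<le> B" for z using g1[of z] h(1)[of z] h(2)[of z] by auto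
  qed (use di in \<open>auto simp: d_def\<close>)
  ultimately show "integral\<^sup>L angle_measure (\<lambda>\<theta>. (1 - cos \<theta>) ^ 4 * ln (h (cis \<theta>))) 
      \<le> K + integral\<^sup>L M (\<lambda>z. (1 - Re z) ^ 4 * h z) + e"
    using dM dC by (simp add: conv)
qed

end

end

section \<open>The negative part of the entropy integral\<close>

definition entropy_neg_part :: "(real \<Rightarrow> real) \<Rightarrow> real \<Rightarrow> ennreal" where
  "entropy_neg_part w \<theta> = e2ennreal (- (ereal ((1 - cos \<theta>) ^ 4) * ext_log (w \<theta>)))"

lemma one_minus_cos_le: "(1 - cos \<theta>) ^ 4 \<le> (16::real)"
  using circle_weight_bounds(2)[of "cis \<theta>"] by simp

lemma entropy_neg_part_pos:
  "0 < w \<theta> \<Longrightarrow> entropy_neg_part w \<theta> = ennreal ((1 - cos \<theta>) ^ 4 * (- ln (w \<theta>)))"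
  by (simp add: entropy_neg_part_def ext_log_def ennreal.abs_eq[symmetric] e2ennreal_ereal)

lemma entropy_neg_part_nonpos:
  assumes "w \<theta> \<le> 0" 
  shows "entropy_neg_part w \<theta> = (if cos \<theta> = 1 then 0 else \<top>)"
proof (cases "cos \<theta> = 1")
  case True
  \<comment> \<open>In \<open>ereal\<close> the product of 0 and -\<infinity> is 0, so zeros of the
    weight contribute nothing.\<close>
  then show ?thesis using assms by (simp add: entropy_neg_part_def ext_log_def zero_ereal_def[symmetric])
next
  case False
  then have "(1 - cos \<theta>) ^ 4 > 0" using cos_le_one[of \<theta>] by (intro zero_less_power) (simp add: less_le)
  then show ?thesis using assms False by (simp add: entropy_neg_part_def ext_log_def e2ennreal_infty)
qed

lemma ext_log_measurable [measurable]: "ext_log \<in> borel_measurable borel"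
  unfolding ext_log_def by measurable

lemma entropy_neg_part_measurable:
  assumes [measurable]: "w \<in> borel_measurable borel" 
  shows "entropy_neg_part w \<in> borel_measurable borel"
  unfolding entropy_neg_part_def by measurable

text \<open>The positive part is at most 16 w, because log w is at most w, so only the negative part
  can be infinite.\<close>

lemma ext_integral_entropy_iff:
  assumes w: "w \<in> borel_measurable borel" and fin: "(\<integral>\<^sup>+\<theta>. ennreal (w \<theta>) \<partial>angle_measure) < \<infinity>"
  shows "ext_integral angle_measure (\<lambda>\<theta>. ereal ((1 - cos \<theta>) ^ 4) * ext_log (w \<theta>)) > -\<infinity>
    \<longleftrightarrow> (\<integral>\<^sup>+\<theta>. entropy_neg_part w \<theta> \<partial>angle_measure) < \<infinity>"
proof -
  let ?pos = "\<integral>\<^sup>+\<theta>. e2ennreal (ereal ((1 - cos \<theta>) ^ 4) * ext_log (w \<theta>)) \<partial>angle_measure"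
  let ?neg = "\<integral>\<^sup>+\<theta>. entropy_neg_part w \<theta> \<partial>angle_measure"
  have "?pos \<le> (\<integral>\<^sup>+\<theta>. 16 * ennreal (w \<theta>) \<partial>angle_measure)"
  proof (rule nn_integral_mono)
    fix \<theta>
    show "e2ennreal (ereal ((1 - cos \<theta>) ^ 4) * ext_log (w \<theta>)) \<le> 16 * ennreal (w \<theta>)"
    proof (cases "0 < w \<theta>")
      case True
      have "(1 - cos \<theta>) ^ 4 * ln (w \<theta>) \<le> (1 - cos \<theta>) ^ 4 * w \<theta>"
        using ln_le_minus_one[OF True] by (intro mult_left_mono) auto
      also have "\<dots> \<le> 16 * w \<theta>" using True one_minus_cos_le by (intro mult_right_mono) auto
      finally have "ennreal ((1 - cos \<theta>) ^ 4 * ln (w \<theta>)) \<le> ennreal (16 * w \<theta>)" by (rule ennreal_leI)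
      then show ?thesis using True by (simp add: ext_log_def e2ennreal_ereal ennreal_mult)
    next
      case False
      have "ereal ((1 - cos \<theta>) ^ 4) * ext_log (w \<theta>) \<le> 0"
        using False by (simp add: ext_log_def ereal_mult_le_0_iff)
      then show ?thesis by (simp add: e2ennreal_neg)
    qed
  qed
  also have "\<dots> = 16 * (\<integral>\<^sup>+\<theta>. ennreal (w \<theta>) \<partial>angle_measure)" using w by (intro nn_integral_cmult) auto
  also have "\<dots> < \<infinity>" using fin by (simp add: ennreal_mult_less_top)
  finally have pos: "?pos < \<infinity>" .
  have "ext_integral angle_measure (\<lambda>\<theta>. ereal ((1 - cos \<theta>) ^ 4) * ext_log (w \<theta>)) = enn2ereal ?pos - enn2ereal ?neg"
    unfolding ext_integral_def entropy_neg_part_def ..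
  also have "(\<dots> > -\<infinity>) \<longleftrightarrow> ?neg < \<infinity>"
    using pos by (cases ?pos; cases ?neg) (auto simp: enn2ereal_ennreal)
  finally show ?thesis .
qed

text \<open>The cap at 1 keeps the truncated integrands nonnegative, as monotone convergence
  requires, and the floor keeps each of them bounded. Where w is not positive and the weight is
  nonzero, they grow like log(n+1).\<close>

lemma log_truncation_SUP:
  "entropy_neg_part w \<theta> \<le> (SUP n. ennreal ((1 - cos \<theta>) ^ 4 * (- ln (max (min (w \<theta>) 1) (1 / real (Suc n))))))"
    (is "_ \<le> (SUP n. ?f n)")
proof (cases "0 < w \<theta>")
  case True
  then obtain n where n: "1 / real (Suc n) < w \<theta>" using reals_Archimedean[of "w \<theta>"] by (auto simp: inverse_eq_divide)
  have "entropy_neg_part w \<theta> \<le> ?f n"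
  proof (cases "w \<theta> \<le> 1")
    case True
    then show ?thesis using n \<open>0 < w \<theta>\<close> by (simp add: entropy_neg_part_pos max_def)
  next
    case False
    then have "(1 - cos \<theta>) ^ 4 * (- ln (w \<theta>)) \<le> 0" by (intro mult_nonneg_nonpos) auto
    then show ?thesis using \<open>0 < w \<theta>\<close> by (simp add: entropy_neg_part_pos ennreal_neg)
  qed
  then show ?thesis by (meson SUP_upper UNIV_I order_trans)
next
  case False
  then have neg: "w \<theta> \<le> 0" by simp
  show ?thesis
  proof (cases "cos \<theta> = 1")
    case True
    then show ?thesis using entropy_neg_part_nonpos[of w \<theta>, OF neg] by simp
  next
    case c: False
    then have P: "(1 - cos \<theta>) ^ 4 > 0" using cos_le_one[of \<theta>] by (intro zero_less_power) (simp add: less_le)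
    have f: "?f n = ennreal ((1 - cos \<theta>) ^ 4 * ln (real (Suc n)))" for n
    proof -
      have "max (min (w \<theta>) 1) (1 / real (Suc n)) = 1 / real (Suc n)" using neg by (auto simp: max_def min_def intro: order_trans)
      then show ?thesis by (simp add: ln_div)
    qed
    have top: "(SUP n. ?f n) = \<top>"
    proof (rule ennreal_SUP_eq_top)
      fix k :: nat
      obtain n :: nat where n: "exp (real k / (1 - cos \<theta>) ^ 4) < real n" using reals_Archimedean2 by blast
      then have "exp (real k / (1 - cos \<theta>) ^ 4) \<le> real (Suc n)" by simp
      then have "real k / (1 - cos \<theta>) ^ 4 \<le> ln (real (Suc n))" by (subst ln_ge_iff) auto
      then have "real k \<le> (1 - cos \<theta>) ^ 4 * ln (real (Suc n))" using P by (simp add: divide_le_eq mult.commute)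
      then have "of_nat k \<le> ?f n" unfolding f by (simp add: ennreal_of_nat_eq_real_of_nat ennreal_leI del: of_nat_Suc)
      then show "\<exists>i\<in>UNIV. of_nat k \<le> ?f i" by blast
    qed
    show ?thesis unfolding top by (rule top_greatest)
  qed
qed

lemma Arg2pi_cis: "0 \<le> \<theta> \<Longrightarrow> \<theta> < 2*pi \<Longrightarrow> Arg2pi (cis \<theta>) = \<theta>"
  by (rule Arg2pi_unique[of 1]) (auto simp: cis_conv_exp)

text \<open>Continuity can fail only on the closed set of nonnegative reals, where the value is
  0.\<close>

lemma Arg2pi_measurable [measurable]: "Arg2pi \<in> borel_measurable borel"
proof -
  have c: "continuous_on (- {z. z \<in> \<real>\<^sub>\<ge>\<^sub>0}) Arg2pi"
    by (auto simp: continuous_on_eq_continuous_within intro!: continuous_at_imp_continuous_at_within continuous_at_Arg2pi)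
  have s: "{z. z \<in> \<real>\<^sub>\<ge>\<^sub>0} \<in> sets (borel :: complex measure)" using closed_nonneg_Reals_complex by (simp add: borel_closed)
  have "(\<lambda>z. if z \<in> \<real>\<^sub>\<ge>\<^sub>0 then 0 else Arg2pi z) \<in> borel_measurable borel"
    by (rule borel_measurable_continuous_on_if) (use s c in \<open>auto simp: Compl_eq\<close>)
  moreover have "(if z \<in> \<real>\<^sub>\<ge>\<^sub>0 then 0 else Arg2pi z) = Arg2pi z" for z
    using Arg2pi_eq_0[of z] by (auto simp: complex_nonneg_Reals_iff complex_is_Real_iff)
  ultimately show ?thesis by simp
qed

section \<open>The two inequalities between entropy and approximants\<close>

locale circle_prob_decomposition = circle_prob M for M :: "complex measure" +
  fixes w :: "real \<Rightarrow> real" and Ms :: "complex measure"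
  assumes decomposition: "circle_lebesgue_decomposition M w Ms"
begin

lemma w_measurable [measurable]: "w \<in> borel_measurable borel"
  and w_nonneg: "0 \<le> \<theta> \<Longrightarrow> \<theta> \<le> 2*pi \<Longrightarrow> 0 \<le> w \<theta>"
  using decomposition by (auto simp: circle_lebesgue_decomposition_def)

definition ac_part :: "complex measure" where
  "ac_part = distr (density angle_measure (\<lambda>\<theta>. ennreal (w \<theta>))) borel cis"

lemma sets_ac_part [simp, measurable_cong]: "sets ac_part = sets borel"
  by (simp add: ac_part_def)

lemma emeasure_decomposition: "A \<in> sets borel \<Longrightarrow> emeasure M A = emeasure ac_part A + emeasure Ms A"
  using decomposition by (auto simp: circle_lebesgue_decomposition_def ac_part_def)

lemma nn_integral_ac_part:
  assumes [measurable]: "f \<in> borel_measurable borel"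
  shows "(\<integral>\<^sup>+z. f z \<partial>ac_part) = (\<integral>\<^sup>+\<theta>. ennreal (w \<theta>) * f (cis \<theta>) \<partial>angle_measure)"
  unfolding ac_part_def by (simp add: nn_integral_distr nn_integral_density)

lemma nn_integral_ac_part_le: "nn_integral ac_part f \<le> nn_integral M f"
proof (rule nn_integral_mono_measure)
  show "sets ac_part = sets M" using sets_M by simp
  then show "ac_part \<le> M" by (simp add: le_measure sets_M emeasure_decomposition)
qed

lemma nn_integral_w_le: "(\<integral>\<^sup>+\<theta>. ennreal (w \<theta>) \<partial>angle_measure) \<le> 1"
  using nn_integral_ac_part_le[of "\<lambda>_. 1"] nn_integral_ac_part[of "\<lambda>_. 1"] emeasure_space_1 by simp

context
  fixes a assumes a: "\<And>n. a n = verblunsky M n"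
begin

lemma entropy_bounded_of_finite:
  assumes fin: "(\<integral>\<^sup>+\<theta>. entropy_neg_part w \<theta> \<partial>angle_measure) < \<infinity>"
  shows "\<exists>K. \<forall>n. szego_entropy a n \<le> K"
proof -
  note a1 = verblunsky_norm(1)[OF a]
  let ?neg = "\<integral>\<^sup>+\<theta>. entropy_neg_part w \<theta> \<partial>angle_measure"
  \<comment> \<open>The 16 is the maximal weight times the integral 1 of the squared orthonormal
    polynomial, the absolutely continuous part being dominated by \<mu>.\<close>
  have "szego_entropy a n \<le> enn2real (16 + ?neg)" for n
  proof -
    let ?q = "\<lambda>z. (cmod (poly (szego a n) z))\<^sup>2 / szego_norm a n"
    have q: "0 < ?q (cis \<theta>)" for \<theta> using szego_verblunsky_nonzero[OF a, of "cis \<theta>" n] szego_norm_verblunsky_pos[OF a, of n] by simp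
    have q0: "0 \<le> ?q z" for z using szego_norm_verblunsky_pos[OF a, of n] by simp
    have qm [measurable]: "?q \<in> borel_measurable borel"
      by (intro borel_measurable_continuous_onI continuous_intros) (use szego_norm_verblunsky_pos[OF a, of n] in auto)
    let ?f = "\<lambda>\<theta>. (1 - cos \<theta>) ^ 4 * ln (?q (cis \<theta>))"
    have int: "integrable angle_measure ?f"
      using szego_verblunsky_nonzero[OF a, of _ n] szego_norm_verblunsky_pos[OF a, of n] 
      by (intro integrable_angle_weighted[of "\<lambda>z. ln (?q z)"] continuous_intros) auto
    have "ennreal (?f \<theta>) \<le> 16 * (ennreal (w \<theta>) * ennreal (?q (cis \<theta>))) + entropy_neg_part w \<theta>" for \<theta>
    proof (cases "0 < w \<theta>")
      case True
      have "?f \<theta> + (1 - cos \<theta>) ^ 4 * ln (w \<theta>) = (1 - cos \<theta>) ^ 4 * ln (?q (cis \<theta>) * w \<theta>)"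
        using ln_mult_pos[OF q[of \<theta>] True] by (simp add: algebra_simps)
      also have "\<dots> \<le> (1 - cos \<theta>) ^ 4 * (?q (cis \<theta>) * w \<theta>)"
        using ln_le_minus_one[OF mult_pos_pos[OF q[of \<theta>] True]] by (intro mult_left_mono) auto
      also have "\<dots> \<le> 16 * (?q (cis \<theta>) * w \<theta>)"
        using one_minus_cos_le mult_pos_pos[OF q[of \<theta>] True] by (intro mult_right_mono) auto
      finally have "?f \<theta> \<le> 16 * (w \<theta> * ?q (cis \<theta>)) + (1 - cos \<theta>) ^ 4 * (- ln (w \<theta>))" by (simp add: mult.commute)
      also have "\<dots> \<le> 16 * (w \<theta> * ?q (cis \<theta>)) + max 0 ((1 - cos \<theta>) ^ 4 * (- ln (w \<theta>)))" by simp
      finally have "ennreal (?f \<theta>) \<le> ennreal (16 * (w \<theta> * ?q (cis \<theta>)) + max 0 ((1 - cos \<theta>) ^ 4 * (- ln (w \<theta>))))"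
        by (rule ennreal_leI)
      also have "\<dots> = ennreal (16 * (w \<theta> * ?q (cis \<theta>))) + ennreal (max 0 ((1 - cos \<theta>) ^ 4 * (- ln (w \<theta>))))"
        using True by (intro ennreal_plus mult_nonneg_nonneg q0) auto
      also have "ennreal (16 * (w \<theta> * ?q (cis \<theta>))) = 16 * (ennreal (w \<theta>) * ennreal (?q (cis \<theta>)))"
        using True q0[of "cis \<theta>"] by (simp only: ennreal_mult ennreal_mult' ennreal_numeral zero_le_numeral less_imp_le)
      also have "ennreal (max 0 ((1 - cos \<theta>) ^ 4 * (- ln (w \<theta>)))) = entropy_neg_part w \<theta>"
        using True by (simp add: entropy_neg_part_pos max_def ennreal_neg)
      finally show ?thesis .
    next
      case False
      \<comment> \<open>Either the right side is infinite or the weight, and with it the left side,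
        is 0.\<close>
      then show ?thesis using entropy_neg_part_nonpos[of w \<theta>] by (cases "cos \<theta> = 1") auto
    qed
    then have "(\<integral>\<^sup>+\<theta>. ennreal (?f \<theta>) \<partial>angle_measure) \<le> 
       (\<integral>\<^sup>+\<theta>. 16 * (ennreal (w \<theta>) * ennreal (?q (cis \<theta>))) + entropy_neg_part w \<theta> \<partial>angle_measure)"
      by (rule nn_integral_mono)
    also have "\<dots> = 16 * (\<integral>\<^sup>+\<theta>. ennreal (w \<theta>) * ennreal (?q (cis \<theta>)) \<partial>angle_measure) + ?neg"
      using entropy_neg_part_measurable[OF w_measurable]
      by (subst nn_integral_add) (auto simp: nn_integral_cmult)
    also have "(\<integral>\<^sup>+\<theta>. ennreal (w \<theta>) * ennreal (?q (cis \<theta>)) \<partial>angle_measure) = (\<integral>\<^sup>+z. ennreal (?q z) \<partial>ac_part)"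
      by (rule nn_integral_ac_part[symmetric]) measurable
    also have "(\<integral>\<^sup>+z. ennreal (?q z) \<partial>ac_part) \<le> (\<integral>\<^sup>+z. ennreal (?q z) \<partial>M)" by (rule nn_integral_ac_part_le)
    also have "(\<integral>\<^sup>+z. ennreal (?q z) \<partial>M) = ennreal (integral\<^sup>L M ?q)"
      by (intro nn_integral_eq_integral integrable_continuous continuous_intros AE_I2 q0) (use szego_norm_verblunsky_pos[OF a, of n] in auto)
    also have "integral\<^sup>L M ?q = 1"
    proof -
      have e: "integral\<^sup>L M (\<lambda>z. (cmod (poly (szego a n) z))\<^sup>2) = szego_norm a n"
        using verblunsky_norm(2)[OF a, of n] szego_norm_def[of a n, OF a1] by simp
      show ?thesis unfolding integral_divide_zero e using szego_norm_verblunsky_pos[OF a, of n] by simp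
    qed
    finally have le: "(\<integral>\<^sup>+\<theta>. ennreal (?f \<theta>) \<partial>angle_measure) \<le> 16 + ?neg"
      by (simp add: add_right_mono mult_left_mono)
    have "szego_entropy a n = enn2real (\<integral>\<^sup>+\<theta>. ennreal (?f \<theta>) \<partial>angle_measure) - enn2real (\<integral>\<^sup>+\<theta>. ennreal (- ?f \<theta>) \<partial>angle_measure)"
      unfolding szego_entropy_def[OF a] by (rule real_lebesgue_integral_def[OF int])
    also have "\<dots> \<le> enn2real (\<integral>\<^sup>+\<theta>. ennreal (?f \<theta>) \<partial>angle_measure)" by simp
    also have "\<dots> \<le> enn2real (16 + ?neg)" using le fin by (intro enn2real_mono) (auto simp: top.not_eq_extremum)
    finally show ?thesis .
  qed
  then show ?thesis by blast
qed

lemma singular_support: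
  obtains S where "S \<in> sets borel" "emeasure circle_lebesgue S = 0" "emeasure Ms (- S) = 0"
  using decomposition that by (auto simp: circle_lebesgue_decomposition_def circle_lebesgue_def)

text \<open>Lebesgue measure does not notice the reset to 1 on S, while the reset keeps the singular
  mass from meeting large values of 1/t. Off S the product w/t is at most 1 + w uniformly in n, so
  the truncation can be removed.\<close>

lemma entropy_finite_of_bounded:
  assumes K: "\<And>n. szego_entropy a n \<le> K"
  shows "(\<integral>\<^sup>+\<theta>. entropy_neg_part w \<theta> \<partial>angle_measure) < \<infinity>"
proof -
  obtain S where S [measurable]: "S \<in> sets borel" and S0: "emeasure circle_lebesgue S = 0" "emeasure Ms (- S) = 0"
    by (rule singular_support)
  have aeS: "AE \<theta> in angle_measure. cis \<theta> \<notin> S"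
  proof -
    have "AE z in circle_lebesgue. z \<notin> S" using S0(1) by (intro AE_not_in) (auto simp: null_sets_def)
    then show ?thesis unfolding circle_lebesgue_def by (subst (asm) AE_distr_iff) auto
  qed
  let ?t = "\<lambda>n \<theta>. max (min (w \<theta>) 1) (1 / real (Suc n))"
  let ?g = "\<lambda>n \<theta>. (1 - cos \<theta>) ^ 4 * (- ln (?t n \<theta>))"
  have t: "1 / real (Suc n) \<le> ?t n \<theta> \<and> ?t n \<theta> \<le> 1 \<and> 0 < ?t n \<theta>" for n \<theta>
    by (auto simp: less_max_iff_disj)
  have inv: "1 \<le> 1 / ?t n \<theta> \<and> 1 / ?t n \<theta> \<le> real (Suc n)" for n \<theta>
  proof
    show "1 \<le> 1 / ?t n \<theta>" using t[of n \<theta>] by (subst le_divide_eq_1_pos) auto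
    have "1 / ?t n \<theta> \<le> 1 / (1 / real (Suc n))"
      using t[of n \<theta>] by (intro divide_left_mono mult_pos_pos) auto
    then show "1 / ?t n \<theta> \<le> real (Suc n)" by simp
  qed
  \<comment> \<open>48 = 16 (1 + 1) + 16: off S the integral of 1 + w is at most 2, and S has mass
    at most 1.\<close>
  have bound: "(\<integral>\<^sup>+\<theta>. ennreal (?g n \<theta>) \<partial>angle_measure) \<le> ennreal (K + 48)" for n
  proof -
    \<comment> \<open>\<open>Arg2pi\<close> carries the truncated density from angles to points of
      the circle.\<close>
    define h where "h z = (if z \<in> S then 1 else 1 / ?t n (Arg2pi z))" for z
    have [measurable]: "h \<in> borel_measurable borel" unfolding h_def by measurable
    have h: "1 \<le> h z" "h z \<le> real (Suc n)" for z
      using inv[of "Arg2pi z" n] by (auto simp: h_def simp del: of_nat_Suc)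
    have hB: "\<bar>h z\<bar> \<le> real (Suc n)" and h0: "0 \<le> h z" for z
      using h(1)[of z] h(2)[of z] by (simp_all add: abs_of_nonneg del: of_nat_Suc)
    have "\<bar>?g n \<theta>\<bar> \<le> 16 * ln (real (Suc n))" for \<theta>
    proof -
      have "ln (1 / real (Suc n)) \<le> ln (?t n \<theta>)" using t[of n \<theta>] by (intro ln_mono) auto
      then have "\<bar>- ln (?t n \<theta>)\<bar> \<le> ln (real (Suc n))" 
        using t[of n \<theta>] by (simp add: ln_div)
      then show ?thesis using one_minus_cos_le[of \<theta>] unfolding abs_mult by (intro mult_mono) auto
    qed
    then have gi: "integrable angle_measure (?g n)"
      by (intro angle.integrable_const_bound[of _ "16 * ln (real (Suc n))"]) (auto simp del: of_nat_Suc)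
    have g0: "0 \<le> ?g n \<theta>" for \<theta> using t[of n \<theta>] by (intro mult_nonneg_nonneg) auto
    have "integral\<^sup>L angle_measure (?g n) = integral\<^sup>L angle_measure (\<lambda>\<theta>. (1 - cos \<theta>) ^ 4 * ln (h (cis \<theta>)))"
    proof (rule integral_cong_AE)
      have "AE \<theta> in angle_measure. Arg2pi (cis \<theta>) = \<theta>" by (rule AE_angle_measureI) (rule Arg2pi_cis)
      then show "AE \<theta> in angle_measure. ?g n \<theta> = (1 - cos \<theta>) ^ 4 * ln (h (cis \<theta>))"
        using aeS
      proof eventually_elim
        case (elim \<theta>)
        have "ln (1 / ?t n \<theta>) = ln 1 - ln (?t n \<theta>)" using t[of n \<theta>] by (intro ln_divide_pos) auto
        then show ?case using elim by (simp only: h_def if_False ln_one diff_0)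
      qed
    qed measurable
    also have "\<dots> \<le> K + integral\<^sup>L M (\<lambda>z. (1 - Re z) ^ 4 * h z)"
      by (rule entropy_le_borel[OF a _ h K]) measurable
    also have "integral\<^sup>L M (\<lambda>z. (1 - Re z) ^ 4 * h z) \<le> 48"
    proof -
      have i: "integrable M (\<lambda>z. (1 - Re z) ^ 4 * h z)"
        by (rule weighted_integrable[OF _ hB]) measurable
      have "ennreal (integral\<^sup>L M (\<lambda>z. (1 - Re z) ^ 4 * h z)) = (\<integral>\<^sup>+z. ennreal ((1 - Re z) ^ 4 * h z) \<partial>M)"
        by (intro nn_integral_eq_integral[symmetric] i AE_I2 mult_nonneg_nonneg h0) simp
      also have "\<dots> \<le> (\<integral>\<^sup>+z. 16 * (ennreal (h z) * indicator (- S) z) + 16 * indicator S z \<partial>M)"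
      proof (rule nn_integral_mono_AE)
        show "AE z in M. ennreal ((1 - Re z) ^ 4 * h z) \<le> 16 * (ennreal (h z) * indicator (- S) z) + 16 * indicator S z"
          using AE_circle
        proof eventually_elim
          case (elim z)
          have "(1 - Re z) ^ 4 * h z \<le> 16 * h z"
            using circle_weight_bounds[OF elim] h(1)[of z] by (intro mult_right_mono) auto
          then have "ennreal ((1 - Re z) ^ 4 * h z) \<le> 16 * ennreal (h z)"
            using h(1)[of z] by (metis ennreal_leI ennreal_mult'' ennreal_numeral order_trans zero_le_one zero_le_numeral)
          then show ?case by (cases "z \<in> S") (simp_all add: h_def)
        qed
      qed
      also have "\<dots> = 16 * (\<integral>\<^sup>+z. ennreal (h z) * indicator (- S) z \<partial>M) + 16 * emeasure M S"
        using sets_M by (subst nn_integral_add) (auto simp: nn_integral_cmult cong: measurable_cong_sets)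
      also have "(\<integral>\<^sup>+z. ennreal (h z) * indicator (- S) z \<partial>M) = (\<integral>\<^sup>+z. ennreal (h z) * indicator (- S) z \<partial>ac_part)"
      proof -
        \<comment> \<open>Off S the singular part has no mass, so \<mu> agrees there with its
          absolutely continuous part.\<close>
        have "density M (indicator (- S)) = density ac_part (indicator (- S))"
        proof (rule measure_eqI)
          fix A assume "A \<in> sets (density M (indicator (- S)))"
          then have A [measurable]: "A \<in> sets borel" using sets_M by simp
          have "emeasure Ms (- S \<inter> A) \<le> emeasure Ms (- S)"
            using decomposition by (intro emeasure_mono) (auto simp: circle_lebesgue_decomposition_def)
          then have "emeasure Ms (- S \<inter> A) = 0" using S0(2) by simp
          then have "emeasure M (- S \<inter> A) = emeasure ac_part (- S \<inter> A)" by (simp add: emeasure_decomposition)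
          then show "emeasure (density M (indicator (- S))) A = emeasure (density ac_part (indicator (- S))) A"
            using sets_M by (simp add: emeasure_density indicator_inter_arith[symmetric] cong: measurable_cong_sets)
        qed (simp add: sets_M)
        then have "(\<integral>\<^sup>+z. ennreal (h z) \<partial>density M (indicator (- S))) = (\<integral>\<^sup>+z. ennreal (h z) \<partial>density ac_part (indicator (- S)))"
          by simp
        then show ?thesis using sets_M by (simp add: nn_integral_density mult.commute cong: measurable_cong_sets)
      qed
      also have "(\<integral>\<^sup>+z. ennreal (h z) * indicator (- S) z \<partial>ac_part) = 
          (\<integral>\<^sup>+\<theta>. ennreal (w \<theta>) * (ennreal (h (cis \<theta>)) * indicator (- S) (cis \<theta>)) \<partial>angle_measure)"
        by (rule nn_integral_ac_part) measurable
      also have "\<dots> \<le> (\<integral>\<^sup>+\<theta>. 1 + ennreal (w \<theta>) \<partial>angle_measure)"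
      proof (rule nn_integral_mono_AE)
        have "AE \<theta> in angle_measure. Arg2pi (cis \<theta>) = \<theta> \<and> 0 \<le> w \<theta>" 
          by (rule AE_angle_measureI) (auto intro: Arg2pi_cis w_nonneg)
        then show "AE \<theta> in angle_measure. ennreal (w \<theta>) * (ennreal (h (cis \<theta>)) * indicator (- S) (cis \<theta>)) \<le> 1 + ennreal (w \<theta>)"
          using aeS
        proof eventually_elim
          case (elim \<theta>)
          have "w \<theta> / ?t n \<theta> \<le> 1 + w \<theta>"
          proof (cases "w \<theta> \<le> 1")
            case True
            then have "w \<theta> \<le> ?t n \<theta>" by simp
            then have "w \<theta> / ?t n \<theta> \<le> 1" using t[of n \<theta>] by (simp add: divide_le_eq)
            then show ?thesis using elim by simp
          next
            case False
            then have "?t n \<theta> = 1" by (simp add: max_def)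
            then show ?thesis by simp
          qed
          then have "ennreal (w \<theta> * h (cis \<theta>)) \<le> ennreal (1 + w \<theta>)"
            using elim by (intro ennreal_leI) (simp add: h_def)
          then show ?case using elim h(1)[of "cis \<theta>"] by (simp add: ennreal_mult'' ennreal_plus)
        qed
      qed
      also have "\<dots> = 1 + (\<integral>\<^sup>+\<theta>. ennreal (w \<theta>) \<partial>angle_measure)"
        using angle.emeasure_space_1 by (subst nn_integral_add) auto
      also have "\<dots> \<le> 1 + 1" by (intro add_left_mono nn_integral_w_le)
      also have "emeasure M S \<le> 1" by (rule emeasure_le_1)
      finally have "ennreal (integral\<^sup>L M (\<lambda>z. (1 - Re z) ^ 4 * h z)) \<le> 16 * (1 + 1) + 16 * 1"
        by (simp add: add_mono mult_left_mono)
      also have "\<dots> = ennreal 48" by simp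
      finally show ?thesis by (subst (asm) ennreal_le_iff) auto
    qed
    finally have "integral\<^sup>L angle_measure (?g n) \<le> K + 48" by simp
    moreover have "(\<integral>\<^sup>+\<theta>. ennreal (?g n \<theta>) \<partial>angle_measure) = ennreal (integral\<^sup>L angle_measure (?g n))"
      by (intro nn_integral_eq_integral gi AE_I2 g0)
    ultimately show ?thesis by (simp add: ennreal_leI)
  qed
  have "(\<integral>\<^sup>+\<theta>. entropy_neg_part w \<theta> \<partial>angle_measure) \<le> (\<integral>\<^sup>+\<theta>. (SUP n. ennreal (?g n \<theta>)) \<partial>angle_measure)"
    by (intro nn_integral_mono log_truncation_SUP)
  also have "\<dots> = (SUP n. (\<integral>\<^sup>+\<theta>. ennreal (?g n \<theta>) \<partial>angle_measure))"
  proof (rule nn_integral_monotone_convergence_SUP)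
    show "incseq (\<lambda>n \<theta>. ennreal (?g n \<theta>))"
    proof (intro incseq_SucI le_funI ennreal_leI mult_left_mono)
      fix n \<theta>
      have "?t (Suc n) \<theta> \<le> ?t n \<theta>" by (intro max.mono) (auto simp: frac_le)
      then show "- ln (?t n \<theta>) \<le> - ln (?t (Suc n) \<theta>)" using t[of "Suc n" \<theta>] by (simp add: ln_mono)
    qed simp
  qed measurable
  also have "\<dots> \<le> ennreal (K + 48)" by (intro SUP_least bound)
  finally show ?thesis by (rule le_less_trans) simp
qed

end

end

theorem theorem4p68:
  fixes \<mu> \<mu>s :: "complex measure" and w :: "real \<Rightarrow> real"
  assumes "nontrivial_circle_prob \<mu>"
    and "circle_lebesgue_decomposition \<mu> w \<mu>s"
    and "in_ell 6 (verblunsky \<mu>)"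
    and "in_ell 3 (shift_minus_id (verblunsky \<mu>))"
  shows "ext_integral angle_measure (\<lambda>\<theta>. ereal ((1 - cos \<theta>) ^ 4) * ext_log (w \<theta>)) > -\<infinity>
    \<longleftrightarrow> in_ell 2 ((shift_minus_id ^^ 4) (verblunsky \<mu>))"
proof -
  interpret prob_space \<mu> using assms(1) by (simp add: nontrivial_circle_prob_def)
  interpret circle_prob_decomposition \<mu> w \<mu>s
    using assms(1,2) by unfold_locales (auto simp: nontrivial_circle_prob_def)
  let ?a = "verblunsky \<mu>"
  note a1 = verblunsky_norm(1)[OF refl]
  have "ext_integral angle_measure (\<lambda>\<theta>. ereal ((1 - cos \<theta>) ^ 4) * ext_log (w \<theta>)) > -\<infinity>
      \<longleftrightarrow> (\<integral>\<^sup>+\<theta>. entropy_neg_part w \<theta> \<partial>angle_measure) < \<infinity>"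
    by (rule ext_integral_entropy_iff[OF w_measurable le_less_trans[OF nn_integral_w_le]]) simp
  also have "\<dots> \<longleftrightarrow> (\<exists>K. \<forall>n. szego_entropy ?a n \<le> K)"
    using entropy_bounded_of_finite[OF refl] entropy_finite_of_bounded[OF refl] by blast
  also have "\<dots> \<longleftrightarrow> (\<exists>m. \<forall>n. m \<le> 70 * (\<Sum>j<n. ln (1 - (cmod (?a j))\<^sup>2)) 
      - 16 * integral\<^sup>L angle_measure (\<lambda>\<theta>. (1 - cos \<theta>) ^ 4 * ln ((cmod (poly (szego ?a n) (cis \<theta>)))\<^sup>2)))"
    (is "_ \<longleftrightarrow> (\<exists>m. \<forall>n. m \<le> ?S n)")
  proof -
    have S: "?S n = - 16 * szego_entropy ?a n" for n using szego_entropy_eq[OF refl, of n] by simp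
    have "(\<exists>K. \<forall>n. s n \<le> K) \<longleftrightarrow> (\<exists>m. \<forall>n. m \<le> - 16 * s n)" for s :: "nat \<Rightarrow> real"
    proof
      assume "\<exists>K. \<forall>n. s n \<le> K"
      then obtain K where "\<And>n. s n \<le> K" by blast
      then have "\<And>n. - 16 * K \<le> - 16 * s n" by simp
      then show "\<exists>m. \<forall>n. m \<le> - 16 * s n" by blast
    next
      assume "\<exists>m. \<forall>n. m \<le> - 16 * s n"
      then obtain m where m: "\<And>n. m \<le> - 16 * s n" by blast
      have "s n \<le> - m / 16" for n using m[of n] by (simp add: field_simps)
      then show "\<exists>K. \<forall>n. s n \<le> K" by blast
    qed
    then show ?thesis unfolding S .
  qed
  also have "\<dots> \<longleftrightarrow> in_ell 2 ((shift_minus_id ^^ 4) ?a)"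
    by (rule szego_entropy_bdd_below_iff[OF a1 assms(3,4)])
  finally show ?thesis .
qed

end
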